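(* Consider the incentivized RL problem and the Hidden Hallucination algorithm described in the context, with an arbitrary prior $\mathbf{p}$. Fix parameters $\rho,\delta\in(0,1]$. Assume $r_{\mathrm{alt}}>0$ and $q_{\mathrm{pun}}:=q_{\mathrm{pun}}(\varepsilon_{\mathrm{pun}})>0$, where $\varepsilon_{\mathrm{pun}}=r_{\mathrm{alt}}\,\rho/(18H)$. Then the algorithm with punishment parameter $\varepsilon_{\mathrm{pun}}$ and appropriate phase length $N_{\mathrm{ph}}$ and target $n_{\mathrm{lrn}}$ is guaranteed to $(\rho,n)$-explore with probability at least $1-\delta$ by episode $K_{\rho,n}$, provided $n$ and $K_{\rho,n}$ are sufficiently large. Specifically, there are absolute constants $c_1,c_2$ such that it suffices to take \[n=n_{\mathrm{lrn}}\ \ge\ c_1\,\rho^{-2}r_{\mathrm{alt}}^{-2}H^4\Big(S+\log\frac{SAH}{\delta\rho\, r_{\mathrm{alt}}\, q_{\mathrm{pun}}}\Big),\qquad K_{\rho,n}=c_2\,n\,q_{\mathrm{pun}}^{-1}\rho^{-3}r_{\mathrm{alt}}^{-3}SAH^4.\] In particular one may take $K_{\rho,n}=q_{\mathrm{pun}}^{-1}\cdot\mathrm{poly}(\rho^{-1}r_{\mathrm{alt}}^{-1}SAH)\cdot\log(\delta^{-1}q_{\mathrm{pun}}^{-1})$.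
   Context: MDPs. Fix positive integers $S,A,H$. An MDP model $\mu$ specifies for each triple $(x,a,h)\in[S]\times[A]\times[H]$ a reward distribution $R_\mu(x,a,h)$ on $[0,1]$ (all supported on a common countable set) with mean $r_\mu(x,a,h)$, a transition distribution $p_\mu(\cdot\mid x,a,h)$ on $[S]$, and an initial distribution $p_\mu(\cdot\mid0)$. In an episode, $x_1\sim p_\mu(\cdot\mid0)$; at stage $h$ the agent observes $x_h$, picks $a_h$, receives $r_h\sim R_\mu(x_h,a_h,h)$ and moves to $x_{h+1}\sim p_\mu(\cdot\mid x_h,a_h,h)$. The trajectory is $(x_h,a_h,r_h,h)_{h\in[H]}$. $\Pi_{\mathrm{mkv}}$ is the set of deterministic Markov policies $\pi:[S]\times[H]\to[A]$; $\mathsf{P}^\pi_\mu$ is the trajectory law and $V(\pi,\mu)=\mathsf{E}^\pi_\mu[\sum_h r_\mu(x_h,a_h,h)]$. A triple $(x,a,h)$ is visited in an episode if $(x_h,a_h)=(x,a)$. Incentivized RL. A prior $\mathbf{p}$ over models is known to all; $\mu_\star\sim\mathbf{p}$ is unknown. In each episode $k$ the principal chooses a signal $\sigma_k$ via a known algorithm from past trajectories; agent $k$ chooses $\pi_k\in\arg\max_{\pi\in\Pi_{\mathrm{mkv}}}\mathbb{E}[V(\pi,\mu_\star)\mid\sigma_k]$ (fixed known tie-breaking; expectation over all randomness); $\pi_k$ is run in $\mu_\star$ and the principal observes the trajectory $\tau_k$. A triple is $\rho$-reachable if some $\pi\in\Pi_{\mathrm{mkv}}$ has $\mathsf{P}^\pi_{\mu_\star}[(x_h,a_h)=(x,a)]\ge\rho$;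 the algorithm has $(\rho,n)$-explored by episode $K$ if each $\rho$-reachable triple is visited in at least $n$ distinct episodes among the first $K$. Ledgers and canonical posteriors. A ledger $\lambda$ consists of a censoring set $\mathcal{U}_\lambda\subseteq[S]\times[A]\times[H]$ and a finite sequence $(\pi_i,\tau_i)_{i=1}^m$ of policies in $\Pi_{\mathrm{mkv}}$ and trajectories in which the reward at each stage $h$ with $(x_h,a_h,h)\in\mathcal{U}_\lambda$ is removed; it is partially-censored for arbitrary $\mathcal{U}_\lambda$ and totally-censored if $\mathcal{U}_\lambda$ is the set of all triples. The canonical posterior $\Pr_{\mathrm{can}}[\,\cdot\mid\lambda]$ (expectation $\mathbb{E}_{\mathrm{can}}$) is the conditional law of $\mu_\star$ given $\hat\lambda=\lambda$, where $\mu_\star\sim\mathbf{p}$ and $\hat\lambda$ is obtained by running each fixed (non-random) policy $\pi_1,\dots,\pi_m$ once, independently, in $\mu_\star$ and removing rewards at triples in $\mathcal{U}_\lambda$; conditioning additionally on an event $\mathcal{E}$ about $\mu_\star$ is defined analogously. Define $q_{\mathrm{pun}}(\epsilon):=\min_{\lambda\text{ totally-censored}}\Pr_{\mathrm{can}}[r_{\mu_\star}(x,a,h)\le\epsilon\ \forall(x,a,h)\mid\lambda]$ and $r_{\mathrm{alt}}:=\min_{\lambda\text{ partially-censored}}\min_{(x,a,h)\in\mathcal{U}_\lambda}\mathbb{E}_{\mathrm{can}}[r_{\mu_\star}(x,a,h)\mid\lambda]$. Algorithm (Hidden Hallucination for MDPs), inputs $N_{\mathrm{ph}},n_{\mathrm{lrn}},\varepsilon_{\mathrm{pun}}>0$.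 Phase $\ell$ consists of episodes $(\ell-1)N_{\mathrm{ph}}+1,\dots,\ell N_{\mathrm{ph}}$, and a hallucination episode $k_\ell$ is drawn uniformly from it. A triple is fully explored at phase $\ell$ if visited in at least $n_{\mathrm{lrn}}$ of the episodes $k_1,\dots,k_{\ell-1}$; $\mathcal{U}_\ell$ denotes the set of under-explored triples. Raw ledger at phase $\ell$: the pairs $(\pi_{k_j},\tau_{k_j})$, $j<\ell$; censored ledger $\lambda_{\mathrm{cens},\ell}$: all rewards removed; honest ledger $\lambda_{\mathrm{hon},\ell}$: censoring set $\mathcal{U}_\ell$. Punish event $\mathcal{E}_{\mathrm{pun},\ell}=\{r_{\mu_\star}(x,a,h)\le\varepsilon_{\mathrm{pun}}\ \forall (x,a,h)\notin\mathcal{U}_\ell\}$. At $k=k_\ell$ draw $\mu_{\mathrm{hal},\ell}$ from the posterior of $\mu_\star$ given $\lambda_{\mathrm{cens},\ell}$ and $\mathcal{E}_{\mathrm{pun},\ell}$, and form the hallucinated ledger $\lambda_{\mathrm{hal},\ell}$: censoring set $\mathcal{U}_\ell$, and each occurrence of a fully explored triple $(x,a,h)$ given an independent reward drawn from $R_{\mu_{\mathrm{hal},\ell}}(x,a,h)$. The signal is $\lambda_{\mathrm{hal},\ell}$ at $k=k_\ell$ and $\lambda_{\mathrm{hon},\ell}$ at the other episodes of phase $\ell$. *)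

theory Defs
  imports "HOL-Probability.Probability"
begin

(* Conventions: states, actions, stages are 0-based: [S] = {..<S}, [A] = {..<A}, [H] = {..<H}. *)

record model =
  mrew   :: "nat \<Rightarrow> nat \<Rightarrow> nat \<Rightarrow> real pmf"   (* reward distribution R(x,a,h) *)
  mtrans :: "nat \<Rightarrow> nat \<Rightarrow> nat \<Rightarrow> nat pmf"    (* p(. | x,a,h) *)
  minit  :: "nat pmf"

type_synonym policy = "nat \<Rightarrow> nat \<Rightarrow> nat"          (* pi x h *)
type_synonym traj = "(nat \<times> nat \<times> real) list"        (* (x_h, a_h, r_h), stage = index *)
type_synonym ctraj = "(nat \<times> nat \<times> real option) list"
type_synonym triple = "nat \<times> nat \<times> nat"              (* (x,a,h) *)
type_synonym ledger = "triple set \<times> (policy \<times> ctraj) list"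
type_synonym hist = "nat list \<times> (ledger \<times> policy \<times> traj) list"
  (* hallucination episodes k_l, and for every episode: (signal, policy, trajectory) *)

definition triples :: "nat \<Rightarrow> nat \<Rightarrow> nat \<Rightarrow> triple set" where
  "triples S A H = {..<S} \<times> {..<A} \<times> {..<H}"

definition policies :: "nat \<Rightarrow> nat \<Rightarrow> nat \<Rightarrow> policy set" where
  "policies S A H = {\<pi>. \<forall>x h. if x < S \<and> h < H then \<pi> x h < A else \<pi> x h = 0}"

definition valid_model :: "nat \<Rightarrow> nat \<Rightarrow> nat \<Rightarrow> real set \<Rightarrow> model \<Rightarrow> bool" where
  "valid_model S A H Rset \<mu> \<longleftrightarrow>
     (\<forall>x<S. \<forall>a<A. \<forall>h<H. set_pmf (mrew \<mu> x a h) \<subseteq> Rset \<and> set_pmf (mtrans \<mu> x a h) \<subseteq> {..<S})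
     \<and> set_pmf (minit \<mu>) \<subseteq> {..<S}"

definition model_gen :: "model set set" where
  "model_gen =
     {{\<mu>. pmf (mrew \<mu> x a h) v \<in> B} | x a h v B. B \<in> sets (borel :: real measure)} \<union>
     {{\<mu>. pmf (mtrans \<mu> x a h) y \<in> B} | x a h y B. B \<in> sets (borel :: real measure)} \<union>
     {{\<mu>. pmf (minit \<mu>) y \<in> B} | y B. B \<in> sets (borel :: real measure)}"

definition model_space :: "nat \<Rightarrow> nat \<Rightarrow> nat \<Rightarrow> real set \<Rightarrow> model measure" where
  "model_space S A H Rset =
     sigma {\<mu>. valid_model S A H Rset \<mu>} ((\<lambda>G. G \<inter> {\<mu>. valid_model S A H Rset \<mu>}) ` model_gen)"

primrec traj_steps :: "nat \<Rightarrow> model \<Rightarrow> policy \<Rightarrow> nat \<Rightarrow> nat \<Rightarrow> traj pmf" where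
  "traj_steps 0 \<mu> \<pi> h x = return_pmf []"
| "traj_steps (Suc m) \<mu> \<pi> h x =
     bind_pmf (mrew \<mu> x (\<pi> x h) h) (\<lambda>r.
     bind_pmf (mtrans \<mu> x (\<pi> x h) h) (\<lambda>x'.
     map_pmf (\<lambda>rest. (x, \<pi> x h, r) # rest) (traj_steps m \<mu> \<pi> (Suc h) x')))"

definition traj_pmf :: "nat \<Rightarrow> model \<Rightarrow> policy \<Rightarrow> traj pmf" where
  "traj_pmf H \<mu> \<pi> = bind_pmf (minit \<mu>) (traj_steps H \<mu> \<pi> 0)"

definition mean_rew :: "model \<Rightarrow> triple \<Rightarrow> real" where
  "mean_rew \<mu> t = (case t of (x, a, h) \<Rightarrow> measure_pmf.expectation (mrew \<mu> x a h) (\<lambda>r. r))"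

definition Vpi :: "nat \<Rightarrow> model \<Rightarrow> policy \<Rightarrow> real" where
  "Vpi H \<mu> \<pi> = measure_pmf.expectation (traj_pmf H \<mu> \<pi>)
      (\<lambda>\<tau>. \<Sum>i<length \<tau>. mean_rew \<mu> (fst (\<tau> ! i), fst (snd (\<tau> ! i)), i))"

definition visited :: "triple \<Rightarrow> traj \<Rightarrow> bool" where
  "visited t \<tau> = (case t of (x, a, h) \<Rightarrow> h < length \<tau> \<and> fst (\<tau> ! h) = x \<and> fst (snd (\<tau> ! h)) = a)"

definition censor_traj :: "triple set \<Rightarrow> traj \<Rightarrow> ctraj" where
  "censor_traj U \<tau> = map (\<lambda>(i, (x, a, r)). (x, a, if (x, a, i) \<in> U then None else Some r)) (zip [0..<length \<tau>] \<tau>)"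

(* likelihood of a ledger under a model: each fixed policy run once independently, rewards censored on U *)
definition lik :: "nat \<Rightarrow> ledger \<Rightarrow> model \<Rightarrow> real" where
  "lik H lg \<mu> = prod_list (map (\<lambda>(\<pi>, c). pmf (map_pmf (censor_traj (fst lg)) (traj_pmf H \<mu> \<pi>)) c) (snd lg))"

definition evidence :: "nat \<Rightarrow> model measure \<Rightarrow> ledger \<Rightarrow> real" where
  "evidence H prior lg = (\<integral>\<mu>. lik H lg \<mu> \<partial>prior)"

definition can_exp :: "nat \<Rightarrow> model measure \<Rightarrow> ledger \<Rightarrow> (model \<Rightarrow> real) \<Rightarrow> real" where
  "can_exp H prior lg f = (\<integral>\<mu>. lik H lg \<mu> * f \<mu> \<partial>prior) / evidence H prior lg"

definition can_prob :: "nat \<Rightarrow> model measure \<Rightarrow> ledger \<Rightarrow> (model \<Rightarrow> bool) \<Rightarrow> real" where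
  "can_prob H prior lg P = can_exp H prior lg (\<lambda>\<mu>. if P \<mu> then 1 else 0)"

definition ledger_ok :: "nat \<Rightarrow> nat \<Rightarrow> nat \<Rightarrow> ledger \<Rightarrow> bool" where
  "ledger_ok S A H lg \<longleftrightarrow> fst lg \<subseteq> triples S A H \<and> (\<forall>p \<in> set (snd lg). fst p \<in> policies S A H)"

definition q_pun :: "nat \<Rightarrow> nat \<Rightarrow> nat \<Rightarrow> model measure \<Rightarrow> real \<Rightarrow> real" where
  "q_pun S A H prior \<epsilon> =
     (INF lg \<in> {lg. ledger_ok S A H lg \<and> fst lg = triples S A H \<and> evidence H prior lg > 0}.
        can_prob H prior lg (\<lambda>\<mu>. \<forall>t \<in> triples S A H. mean_rew \<mu> t \<le> \<epsilon>))"

definition r_alt :: "nat \<Rightarrow> nat \<Rightarrow> nat \<Rightarrow> model measure \<Rightarrow> real" where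
  "r_alt S A H prior =
     (INF p \<in> {(lg, t). ledger_ok S A H lg \<and> evidence H prior lg > 0 \<and> t \<in> fst lg}.
        can_exp H prior (fst p) (\<lambda>\<mu>. mean_rew \<mu> (snd p)))"

definition under_explored :: "nat \<Rightarrow> nat \<Rightarrow> nat \<Rightarrow> nat \<Rightarrow> (policy \<times> traj) list \<Rightarrow> triple set" where
  "under_explored S A H nlrn raw = {t \<in> triples S A H. length (filter (\<lambda>p. visited t (snd p)) raw) < nlrn}"

definition censor_raw :: "triple set \<Rightarrow> (policy \<times> traj) list \<Rightarrow> ledger" where
  "censor_raw U raw = (U, map (\<lambda>(\<pi>, \<tau>). (\<pi>, censor_traj U \<tau>)) raw)"

definition pun_event :: "nat \<Rightarrow> nat \<Rightarrow> nat \<Rightarrow> real \<Rightarrow> triple set \<Rightarrow> model \<Rightarrow> bool" where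
  "pun_event S A H \<epsilon> U \<mu> \<longleftrightarrow> (\<forall>t \<in> triples S A H - U. mean_rew \<mu> t \<le> \<epsilon>)"

fun hal_steps :: "model \<Rightarrow> triple set \<Rightarrow> nat \<Rightarrow> traj \<Rightarrow> ctraj pmf" where
  "hal_steps \<mu> U i [] = return_pmf []"
| "hal_steps \<mu> U i ((x, a, r) # \<tau>) =
     bind_pmf (if (x, a, i) \<in> U then return_pmf None else map_pmf Some (mrew \<mu> x a i)) (\<lambda>ro.
     map_pmf (\<lambda>rest. (x, a, ro) # rest) (hal_steps \<mu> U (Suc i) \<tau>))"

fun hal_entries :: "model \<Rightarrow> triple set \<Rightarrow> (policy \<times> traj) list \<Rightarrow> (policy \<times> ctraj) list pmf" where
  "hal_entries \<mu> U [] = return_pmf []"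
| "hal_entries \<mu> U ((\<pi>, \<tau>) # rs) =
     bind_pmf (hal_steps \<mu> U 0 \<tau>) (\<lambda>c. map_pmf (\<lambda>rest. (\<pi>, c) # rest) (hal_entries \<mu> U rs))"

(* law of the hallucinated ledger: mu_hal drawn from the (canonical) posterior given the
   censored ledger and the punish event, then integrated out *)
definition hal_pmf :: "nat \<Rightarrow> nat \<Rightarrow> nat \<Rightarrow> model measure \<Rightarrow> real \<Rightarrow> triple set \<Rightarrow> (policy \<times> traj) list \<Rightarrow> ledger pmf" where
  "hal_pmf S A H prior \<epsilon> U raw = embed_pmf (\<lambda>lg.
     (\<integral>\<mu>. lik H (censor_raw (triples S A H) raw) \<mu> * (if pun_event S A H \<epsilon> U \<mu> then 1 else 0)
           * pmf (map_pmf (\<lambda>l. (U, l)) (hal_entries \<mu> U raw)) lg \<partial>prior)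
     / (\<integral>\<mu>. lik H (censor_raw (triples S A H) raw) \<mu> * (if pun_event S A H \<epsilon> U \<mu> then 1 else 0) \<partial>prior))"

fun run_eps :: "nat \<Rightarrow> model \<Rightarrow> (nat \<Rightarrow> ledger \<Rightarrow> policy) \<Rightarrow> (nat \<Rightarrow> ledger) \<Rightarrow> nat list
                 \<Rightarrow> (ledger \<times> policy \<times> traj) list pmf" where
  "run_eps H \<mu> R sig [] = return_pmf []"
| "run_eps H \<mu> R sig (k # ks) =
     bind_pmf (traj_pmf H \<mu> (R k (sig k))) (\<lambda>\<tau>.
     map_pmf (\<lambda>rest. (sig k, R k (sig k), \<tau>) # rest) (run_eps H \<mu> R sig ks))"

definition phase_step :: "nat \<Rightarrow> nat \<Rightarrow> nat \<Rightarrow> model measure \<Rightarrow> nat \<Rightarrow> nat \<Rightarrow> real \<Rightarrow> model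
                           \<Rightarrow> (nat \<Rightarrow> ledger \<Rightarrow> policy) \<Rightarrow> nat \<Rightarrow> hist \<Rightarrow> hist pmf" where
  "phase_step S A H prior Nph nlrn \<epsilon> \<mu> R l hs =
    (let raw = map (\<lambda>k. snd (snd hs ! k)) (fst hs);
         U = under_explored S A H nlrn raw;
         hon = censor_raw U raw
     in bind_pmf (pmf_of_set {l * Nph..<Suc l * Nph}) (\<lambda>kh.
        bind_pmf (hal_pmf S A H prior \<epsilon> U raw) (\<lambda>hal.
        map_pmf (\<lambda>new. (fst hs @ [kh], snd hs @ new))
          (run_eps H \<mu> R (\<lambda>k. if k = kh then hal else hon) [l * Nph..<Suc l * Nph]))))"

primrec run_phases :: "nat \<Rightarrow> nat \<Rightarrow> nat \<Rightarrow> model measure \<Rightarrow> nat \<Rightarrow> nat \<Rightarrow> real \<Rightarrow> model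
                         \<Rightarrow> (nat \<Rightarrow> ledger \<Rightarrow> policy) \<Rightarrow> nat \<Rightarrow> hist pmf" where
  "run_phases S A H prior Nph nlrn \<epsilon> \<mu> R 0 = return_pmf ([], [])"
| "run_phases S A H prior Nph nlrn \<epsilon> \<mu> R (Suc l) =
     bind_pmf (run_phases S A H prior Nph nlrn \<epsilon> \<mu> R l) (phase_step S A H prior Nph nlrn \<epsilon> \<mu> R l)"

(* E[ V(pi, mu_star) * 1{sigma_k = lg} ]  (unnormalised posterior value; same argmax) *)
definition sig_weight :: "nat \<Rightarrow> nat \<Rightarrow> nat \<Rightarrow> model measure \<Rightarrow> nat \<Rightarrow> nat \<Rightarrow> real
                          \<Rightarrow> (nat \<Rightarrow> ledger \<Rightarrow> policy) \<Rightarrow> nat \<Rightarrow> ledger \<Rightarrow> policy \<Rightarrow> real" where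
  "sig_weight S A H prior Nph nlrn \<epsilon> R k lg \<pi> =
     (\<integral>\<mu>. Vpi H \<mu> \<pi> * measure_pmf.prob (run_phases S A H prior Nph nlrn \<epsilon> \<mu> R (Suc (k div Nph)))
                           {hs. fst (snd hs ! k) = lg} \<partial>prior)"

definition agent_rule :: "nat \<Rightarrow> nat \<Rightarrow> nat \<Rightarrow> model measure \<Rightarrow> (policy set \<Rightarrow> policy) \<Rightarrow> nat \<Rightarrow> nat \<Rightarrow> real
                          \<Rightarrow> (nat \<Rightarrow> ledger \<Rightarrow> policy) \<Rightarrow> nat \<Rightarrow> ledger \<Rightarrow> policy" where
  "agent_rule S A H prior tb Nph nlrn \<epsilon> R k lg =
     tb {\<pi> \<in> policies S A H. \<forall>\<pi>' \<in> policies S A H.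
            sig_weight S A H prior Nph nlrn \<epsilon> R k lg \<pi>' \<le> sig_weight S A H prior Nph nlrn \<epsilon> R k lg \<pi>}"

primrec rules_upto :: "nat \<Rightarrow> nat \<Rightarrow> nat \<Rightarrow> model measure \<Rightarrow> (policy set \<Rightarrow> policy) \<Rightarrow> nat \<Rightarrow> nat \<Rightarrow> real
                         \<Rightarrow> nat \<Rightarrow> (nat \<Rightarrow> ledger \<Rightarrow> policy)" where
  "rules_upto S A H prior tb Nph nlrn \<epsilon> 0 = (\<lambda>k lg x h. 0)"
| "rules_upto S A H prior tb Nph nlrn \<epsilon> (Suc k) =
     (rules_upto S A H prior tb Nph nlrn \<epsilon> k)
       (k := agent_rule S A H prior tb Nph nlrn \<epsilon> (rules_upto S A H prior tb Nph nlrn \<epsilon> k) k)"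

definition hh_rules :: "nat \<Rightarrow> nat \<Rightarrow> nat \<Rightarrow> model measure \<Rightarrow> (policy set \<Rightarrow> policy) \<Rightarrow> nat \<Rightarrow> nat \<Rightarrow> real
                        \<Rightarrow> nat \<Rightarrow> ledger \<Rightarrow> policy" where
  "hh_rules S A H prior tb Nph nlrn \<epsilon> = (\<lambda>k. rules_upto S A H prior tb Nph nlrn \<epsilon> (Suc k) k)"

definition reachable :: "nat \<Rightarrow> nat \<Rightarrow> nat \<Rightarrow> real \<Rightarrow> model \<Rightarrow> triple \<Rightarrow> bool" where
  "reachable S A H \<rho> \<mu> t \<longleftrightarrow> (\<exists>\<pi> \<in> policies S A H. measure_pmf.prob (traj_pmf H \<mu> \<pi>) {\<tau>. visited t \<tau>} \<ge> \<rho>)"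

definition explored :: "nat \<Rightarrow> nat \<Rightarrow> nat \<Rightarrow> real \<Rightarrow> nat \<Rightarrow> nat \<Rightarrow> model \<Rightarrow> hist \<Rightarrow> bool" where
  "explored S A H \<rho> n K \<mu> hs \<longleftrightarrow>
     (\<forall>t \<in> triples S A H. reachable S A H \<rho> \<mu> t \<longrightarrow>
        n \<le> length (filter (\<lambda>k. visited t (snd (snd (snd hs ! k)))) [0..<K]))"

definition hh_success :: "nat \<Rightarrow> nat \<Rightarrow> nat \<Rightarrow> model measure \<Rightarrow> (policy set \<Rightarrow> policy) \<Rightarrow> nat \<Rightarrow> nat \<Rightarrow> real
                          \<Rightarrow> real \<Rightarrow> nat \<Rightarrow> nat \<Rightarrow> real" where
  "hh_success S A H prior tb Nph nlrn \<epsilon> \<rho> n K =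
     (\<integral>\<mu>. measure_pmf.prob
            (run_phases S A H prior Nph nlrn \<epsilon> \<mu> (hh_rules S A H prior tb Nph nlrn \<epsilon>) (Suc (K div Nph)))
            {hs. explored S A H \<rho> n K \<mu> hs} \<partial>prior)"

end

theory Submission
  imports Defs
begin

text \<open>
  Policies of hallucination episodes depend on the true model only through the totally censored
  ledger, so the posterior given an honest ledger is canonical. The hallucinated model and ledger
  have the joint law of the true model and honest ledger conditioned on the punish event given the
  censored ledger; hence any event of probability \<open>\<beta>\<close> for the honest pair has probability at most
  \<open>\<beta> / q\<close> for the hallucinated pair. By Hoeffding's inequality the honest ledger is with high
  probability close to the true model on fully explored triples. Therefore, except with small
  probability, the agent's posterior given the hallucinated ledger concentrates on models whose
  fully explored triples have the empirical transitions and rewards of at most about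
  \<open>\<epsilon>\<^sub>p\<^sub>u\<^sub>n\<close>. The law of the first visit to the under-explored set is then nearly the same in these
  models and the true one, so a policy reaching an under-explored triple with probability \<open>\<rho>\<close> is
  worth almost \<open>r\<^sub>a\<^sub>l\<^sub>t \<rho>\<close>, whereas a policy that avoids this set is worth at most about \<open>H \<epsilon>\<^sub>p\<^sub>u\<^sub>n\<close>. With
  long phases the agent hardly suspects a hallucination, so it visits the under-explored set with
  probability at least \<open>r\<^sub>a\<^sub>l\<^sub>t \<rho> / (3 H)\<close>. Such visits happen at most \<open>S A H n\<close> times, which bounds
  the number of phases needed.
\<close>

section \<open>Countably supported kernels\<close>

text \<open>A hallucinated ledger shares the states and actions of the raw data but none of its
  rewards, so in \<open>progress\<close> the true model supplies dynamics only, and the punished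
  rewards are read from the ledger itself. The assumption on \<open>r_alt\<close> bounds a posterior
  mean and says nothing about a single model; a value under the posterior can use it only after the
  dynamics have been frozen. Three further points shape the proof. The prior is an arbitrary measure
  on models while all outcomes are discrete; \<open>pmf_kernel\<close> holds what is needed to
  interchange the two integrations. A ledger is typical only with high probability, and only on
  average over the prior, so the chance of progress is bounded below on part of the runs; a sticky
  flag removes the others. On the rest an exponentially decaying energy counts the visits, in place
  of a tail bound for dependent trials. The losses \<open>1 / q\<close> and \<open>1 / d\<close> and
  the union over phases are absorbed by the exponentially small Hoeffding error, which is where the
  logarithm in the condition on \<open>n\<close> comes from; the summand \<open>S\<close> pays for
  the \<open>2 ^ S\<close> sets of next states.\<close>

definition pmf_kernel :: "'m measure \<Rightarrow> 'a set \<Rightarrow> ('m \<Rightarrow> 'a pmf) \<Rightarrow> bool" where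
  "pmf_kernel M C K \<longleftrightarrow> countable C \<and> (\<forall>m\<in>space M. set_pmf (K m) \<subseteq> C) \<and>
     (\<forall>x\<in>C. (\<lambda>m. pmf (K m) x) \<in> borel_measurable M)"

lemma nn_integral_pmf_countable:
  assumes "set_pmf p \<subseteq> C"
  shows "(\<integral>\<^sup>+x. f x \<partial>measure_pmf p) = (\<integral>\<^sup>+x. ennreal (pmf p x) * f x \<partial>count_space C)"
proof -
  have "(\<integral>\<^sup>+x. f x \<partial>measure_pmf p) = (\<integral>\<^sup>+x. ennreal (pmf p x) * f x \<partial>count_space UNIV)"
    by (rule nn_integral_measure_pmf)
  also have "\<dots> = (\<integral>\<^sup>+x. ennreal (pmf p x) * f x * indicator C x \<partial>count_space UNIV)"
    using assms by (intro nn_integral_cong) (auto simp: indicator_def set_pmf_iff)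
  also have "\<dots> = (\<integral>\<^sup>+x. ennreal (pmf p x) * f x \<partial>count_space C)"
    by (simp add: nn_integral_count_space_indicator)
  finally show ?thesis .
qed

lemma borel_measurable_pair_count_space:
  assumes "countable C" "\<And>x. x \<in> C \<Longrightarrow> (\<lambda>m. f m x) \<in> borel_measurable M"
  shows "case_prod f \<in> borel_measurable (M \<Otimes>\<^sub>M count_space C)"
  using assms by (subst measurable_pair_swap_iff)
    (auto intro!: measurable_pair_measure_countable1 simp: case_prod_beta)

lemma borel_measurable_nn_integral_count_space:
  fixes f :: "'m \<Rightarrow> 'a \<Rightarrow> ennreal"
  assumes "countable C" "\<And>x. x \<in> C \<Longrightarrow> (\<lambda>m. f m x) \<in> borel_measurable M"
  shows "(\<lambda>m. \<integral>\<^sup>+x. f m x \<partial>count_space C) \<in> borel_measurable M"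
proof -
  interpret sigma_finite_measure "count_space C"
    using assms by (intro sigma_finite_measure_count_space_countable)
  show ?thesis
    using borel_measurable_pair_count_space[OF assms] by (rule borel_measurable_nn_integral)
qed

lemma pmf_kernel_nn_integral:
  fixes f :: "'m \<Rightarrow> 'a \<Rightarrow> ennreal"
  assumes "pmf_kernel M C K" "\<And>x. x \<in> C \<Longrightarrow> (\<lambda>m. f m x) \<in> borel_measurable M"
  shows "(\<lambda>m. \<integral>\<^sup>+x. f m x \<partial>measure_pmf (K m)) \<in> borel_measurable M"
proof -
  have "(\<lambda>m. \<integral>\<^sup>+x. ennreal (pmf (K m) x) * f m x \<partial>count_space C) \<in> borel_measurable M"
    using assms by (intro borel_measurable_nn_integral_count_space) (auto simp: pmf_kernel_def)
  moreover have "(\<integral>\<^sup>+x. f m x \<partial>measure_pmf (K m)) = (\<integral>\<^sup>+x. ennreal (pmf (K m) x) * f m x \<partial>count_space C)"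
    if "m \<in> space M" for m
    using assms(1) that by (intro nn_integral_pmf_countable) (auto simp: pmf_kernel_def)
  ultimately show ?thesis
    by (subst measurable_cong) auto
qed

text \<open>\<open>pmf (K m)\<close> is the density of \<open>K m\<close> with respect to the
  counting measure on \<open>C\<close>, so this is Tonelli. It turns statements about the law of a
  ledger in each model into statements about each fixed ledger averaged over models, where explicit
  likelihoods are available.\<close>

lemma pmf_kernel_swap:
  fixes f :: "'m \<Rightarrow> 'a \<Rightarrow> ennreal"
  assumes "pmf_kernel M C K" "\<And>x. x \<in> C \<Longrightarrow> (\<lambda>m. f m x) \<in> borel_measurable M"
  shows "(\<integral>\<^sup>+m. \<integral>\<^sup>+x. f m x \<partial>measure_pmf (K m) \<partial>M) =
         (\<integral>\<^sup>+x. \<integral>\<^sup>+m. ennreal (pmf (K m) x) * f m x \<partial>M \<partial>count_space C)"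
proof -
  have "(\<integral>\<^sup>+m. \<integral>\<^sup>+x. f m x \<partial>measure_pmf (K m) \<partial>M) =
        (\<integral>\<^sup>+m. \<integral>\<^sup>+x. ennreal (pmf (K m) x) * f m x \<partial>count_space C \<partial>M)"
    using assms(1) by (intro nn_integral_cong nn_integral_pmf_countable) (auto simp: pmf_kernel_def)
  also have "\<dots> = (\<integral>\<^sup>+x. \<integral>\<^sup>+m. ennreal (pmf (K m) x) * f m x \<partial>M \<partial>count_space C)"
    using assms by (intro nn_integral_count_space_nn_integral) (auto simp: pmf_kernel_def)
  finally show ?thesis .
qed

lemma pmf_kernel_prob:
  assumes "pmf_kernel M C K" "\<And>x. x \<in> C \<Longrightarrow> Measurable.pred M (\<lambda>m. P m x)"
  shows "(\<lambda>m. measure_pmf.prob (K m) {x. P m x}) \<in> borel_measurable M"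
proof -
  have "(\<lambda>m. \<integral>\<^sup>+x. indicator {x. P m x} x \<partial>measure_pmf (K m)) \<in> borel_measurable M"
  proof (rule pmf_kernel_nn_integral[OF assms(1)])
    fix x assume "x \<in> C"
    then have [measurable]: "Measurable.pred M (\<lambda>m. P m x)" by (rule assms(2))
    show "(\<lambda>m. indicator {x. P m x} x :: ennreal) \<in> borel_measurable M"
      unfolding indicator_def by simp
  qed
  then have "(\<lambda>m. enn2real (\<integral>\<^sup>+x. indicator {x. P m x} x \<partial>measure_pmf (K m))) \<in> borel_measurable M"
    by simp
  then show ?thesis by (simp add: measure_def)
qed

text \<open>Nonnegativity identifies the Bochner integral with \<open>enn2real\<close> of the
  Lebesgue integral even where the latter is infinite: both are then 0.\<close>

lemma pmf_kernel_expectation: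
  fixes f :: "'m \<Rightarrow> 'a \<Rightarrow> real"
  assumes "pmf_kernel M C K" "\<And>x. x \<in> C \<Longrightarrow> (\<lambda>m. f m x) \<in> borel_measurable M"
    and "\<And>m x. m \<in> space M \<Longrightarrow> x \<in> set_pmf (K m) \<Longrightarrow> 0 \<le> f m x"
  shows "(\<lambda>m. measure_pmf.expectation (K m) (f m)) \<in> borel_measurable M"
proof -
  have "(\<lambda>m. enn2real (\<integral>\<^sup>+x. ennreal (f m x) \<partial>measure_pmf (K m))) \<in> borel_measurable M"
    using assms(2) by (intro measurable_compose[OF pmf_kernel_nn_integral[OF assms(1)] borel_measurable_enn2real]) auto
  moreover have "measure_pmf.expectation (K m) (f m) = enn2real (\<integral>\<^sup>+x. ennreal (f m x) \<partial>measure_pmf (K m))"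
    if "m \<in> space M" for m
    using assms(3)[OF that] by (intro integral_eq_nn_integral) (auto simp: AE_measure_pmf_iff)
  ultimately show ?thesis by (subst measurable_cong) auto
qed

lemma pmf_kernel_pmf:
  assumes "pmf_kernel M C K"
  shows "(\<lambda>m. pmf (K m) x) \<in> borel_measurable M"
proof (cases "x \<in> C")
  case False
  have "pmf (K m) x = 0" if "m \<in> space M" for m
    using assms that False by (auto simp: pmf_kernel_def pmf_eq_0_set_pmf)
  then show ?thesis by (subst measurable_cong[where g="\<lambda>_. 0"]) auto
qed (use assms in \<open>auto simp: pmf_kernel_def\<close>)

lemma pmf_kernelI:
  assumes "countable C" "\<And>m. m \<in> space M \<Longrightarrow> set_pmf (K m) \<subseteq> C"
    "\<And>x. x \<in> C \<Longrightarrow> (\<lambda>m. pmf (K m) x) \<in> borel_measurable M"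
  shows "pmf_kernel M C K"
  using assms by (auto simp: pmf_kernel_def)

lemma pmf_kernel_const:
  assumes "countable C" "set_pmf p \<subseteq> C"
  shows "pmf_kernel M C (\<lambda>_. p)"
  using assms by (auto simp: pmf_kernel_def)

lemma pmf_kernel_bind:
  assumes "pmf_kernel M C K" "\<And>x. x \<in> C \<Longrightarrow> pmf_kernel M D (\<lambda>m. F m x)" "countable D"
  shows "pmf_kernel M D (\<lambda>m. bind_pmf (K m) (F m))"
proof (rule pmf_kernelI)
  show "countable D" by fact
  show "set_pmf (bind_pmf (K m) (F m)) \<subseteq> D" if "m \<in> space M" for m
    using assms that by (fastforce simp: pmf_kernel_def)
  fix y
  have "(\<lambda>m. enn2real (\<integral>\<^sup>+x. ennreal (pmf (F m x) y) \<partial>measure_pmf (K m))) \<in> borel_measurable M"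
    using assms(2)[THEN pmf_kernel_pmf]
    by (intro measurable_compose[OF pmf_kernel_nn_integral[OF assms(1)] borel_measurable_enn2real]) auto
  then show "(\<lambda>m. pmf (bind_pmf (K m) (F m)) y) \<in> borel_measurable M"
    by (simp add: ennreal_pmf_bind[symmetric])
qed

lemma pmf_kernel_map:
  assumes "pmf_kernel M C K" "\<And>x. x \<in> C \<Longrightarrow> f x \<in> D" "countable D"
  shows "pmf_kernel M D (\<lambda>m. map_pmf f (K m))"
  unfolding map_pmf_def using assms
  by (intro pmf_kernel_bind[OF assms(1)] pmf_kernel_const) auto

lemma pmf_kernel_mono:
  assumes "pmf_kernel M C K" "C \<subseteq> D" "countable D"
  shows "pmf_kernel M D K"
  using assms pmf_kernel_pmf[OF assms(1)] by (fastforce simp: pmf_kernel_def)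

text \<open>A mixture of probability mass functions has total mass equal to the total weight. With
  the unnormalised punished posterior as \<open>w\<close>, this certifies that the function under
  \<open>embed_pmf\<close> in \<open>hal_pmf\<close> sums to 1.\<close>

lemma pmf_kernel_mixture:
  assumes K: "pmf_kernel M C K" and w: "integrable M w" "\<And>m. m \<in> space M \<Longrightarrow> 0 \<le> w m"
  shows "(\<integral>\<^sup>+x. ennreal (\<integral>m. w m * pmf (K m) x \<partial>M) \<partial>count_space UNIV) = ennreal (\<integral>m. w m \<partial>M)"
proof -
  have meas[measurable]: "(\<lambda>m. pmf (K m) x) \<in> borel_measurable M" for x
    using K by (rule pmf_kernel_pmf)
  have wm[measurable]: "w \<in> borel_measurable M" using w by auto
  have int: "integrable M (\<lambda>m. w m * pmf (K m) x)" for x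
    by (rule Bochner_Integration.integrable_bound[OF w(1)]) (auto simp: abs_mult pmf_le_1 intro!: mult_left_le)
  have zero: "(\<integral>m. w m * pmf (K m) x \<partial>M) = 0" if "x \<notin> C" for x
  proof -
    have "pmf (K m) x = 0" if "m \<in> space M" for m
      using K that \<open>x \<notin> C\<close> by (auto simp: pmf_kernel_def pmf_eq_0_set_pmf)
    then have "(\<integral>m. w m * pmf (K m) x \<partial>M) = (\<integral>m. 0 \<partial>M)"
      by (intro Bochner_Integration.integral_cong) auto
    then show ?thesis by simp
  qed
  have "(\<integral>\<^sup>+x. ennreal (\<integral>m. w m * pmf (K m) x \<partial>M) \<partial>count_space UNIV) =
        (\<integral>\<^sup>+x. ennreal (\<integral>m. w m * pmf (K m) x \<partial>M) * indicator C x \<partial>count_space UNIV)"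
    by (intro nn_integral_cong) (auto simp: indicator_def zero)
  also have "\<dots> = (\<integral>\<^sup>+x. ennreal (\<integral>m. w m * pmf (K m) x \<partial>M) \<partial>count_space C)"
    by (simp add: nn_integral_count_space_indicator)
  also have "\<dots> = (\<integral>\<^sup>+x. \<integral>\<^sup>+m. ennreal (pmf (K m) x) * ennreal (w m) \<partial>M \<partial>count_space C)"
    using w(2) int
    by (intro nn_integral_cong, subst nn_integral_eq_integral[symmetric])
       (auto intro!: nn_integral_cong simp: ennreal_mult'' mult.commute)
  also have "\<dots> = (\<integral>\<^sup>+m. \<integral>\<^sup>+x. ennreal (w m) \<partial>measure_pmf (K m) \<partial>M)"
    by (intro pmf_kernel_swap[symmetric] K) auto
  also have "\<dots> = ennreal (\<integral>m. w m \<partial>M)"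
    using w by (simp add: nn_integral_eq_integral)
  finally show ?thesis .
qed

section \<open>Trajectories and censoring\<close>

text \<open>Recursive form of \<open>censor_traj\<close> with the stage of the head as an argument,
  matching the recursions of \<open>traj_steps\<close> and \<open>hal_steps\<close>.\<close>

fun censor_steps :: "triple set \<Rightarrow> nat \<Rightarrow> traj \<Rightarrow> ctraj" where
  "censor_steps U i [] = []"
| "censor_steps U i ((x, a, r) # \<tau>) = (x, a, if (x, a, i) \<in> U then None else Some r) # censor_steps U (Suc i) \<tau>"

lemma censor_traj_eq: "censor_traj U \<tau> = censor_steps U 0 \<tau>"
proof -
  have "map (\<lambda>(i, (x, a, r)). (x, a, if (x, a, i) \<in> U then None else Some r)) (zip [k..<k + length \<tau>] \<tau>)
    = censor_steps U k \<tau>" for k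
  proof (induction \<tau> arbitrary: k)
    case (Cons e \<tau>)
    obtain x a r where "e = (x, a, r)" by (cases e) auto
    then show ?case using Cons[of "Suc k"] by (simp add: upt_conv_Cons del: upt_Suc)
  qed simp
  from this[of 0] show ?thesis by (simp add: censor_traj_def)
qed

text \<open>Erasing rewards (as value 0) turns raw and censored data with the same states and actions
  into the same raw data, so erased data plays the role of the totally censored ledger.\<close>

definition erase_traj :: "(nat \<times> nat \<times> 'r) list \<Rightarrow> traj" where
  "erase_traj = map (\<lambda>(x, a, _). (x, a, 0))"

definition erase :: "(policy \<times> (nat \<times> nat \<times> 'r) list) list \<Rightarrow> (policy \<times> traj) list" where
  "erase = map (\<lambda>(\<pi>, \<tau>). (\<pi>, erase_traj \<tau>))"

lemma erase_traj_simps [simp]: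
  "erase_traj [] = []" "erase_traj ((x, a, r) # \<tau>) = (x, a, 0) # erase_traj \<tau>"
  "erase_traj (erase_traj \<tau>) = erase_traj \<tau>" "length (erase_traj \<tau>) = length \<tau>"
  by (auto simp: erase_traj_def case_prod_beta)

lemma erase_simps [simp]:
  "erase [] = []" "erase ((\<pi>, \<tau>) # rs) = (\<pi>, erase_traj \<tau>) # erase rs"
  "erase (rs @ ss) = erase rs @ erase ss" "length (erase rs) = length rs"
  by (auto simp: erase_def)

lemma erase_erase [simp]: "erase (erase rs) = erase rs"
  by (induction rs) auto

lemma erase_censor_steps [simp]: "erase_traj (censor_steps U i \<tau>) = erase_traj \<tau>"
  by (induction U i \<tau> rule: censor_steps.induct) auto

lemma erase_censor_traj [simp]: "erase_traj (censor_traj U \<tau>) = erase_traj \<tau>"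
  by (simp add: censor_traj_eq)

definition censor_list :: "triple set \<Rightarrow> (policy \<times> traj) list \<Rightarrow> (policy \<times> ctraj) list" where
  "censor_list U = map (\<lambda>(\<pi>, \<tau>). (\<pi>, censor_traj U \<tau>))"

lemma censor_raw_eq: "censor_raw U raw = (U, censor_list U raw)"
  by (simp add: censor_raw_def censor_list_def)

lemma censor_list_simps [simp]:
  "censor_list U [] = []" "censor_list U ((\<pi>, \<tau>) # rs) = (\<pi>, censor_traj U \<tau>) # censor_list U rs"
  "censor_list U (rs @ ss) = censor_list U rs @ censor_list U ss"
  by (auto simp: censor_list_def)

lemma erase_censor_list [simp]: "erase (censor_list U rs) = erase rs"
  by (induction rs) auto

lemma visited_erase [simp]: "visited t (erase_traj \<tau>) \<longleftrightarrow> visited t \<tau>"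
  by (cases t) (auto simp: visited_def erase_traj_def nth_map case_prod_beta)

lemma under_explored_erase [simp]: "under_explored S A H n (erase raw) = under_explored S A H n raw"
proof -
  have "length (filter (\<lambda>p. visited t (snd p)) (erase raw)) = length (filter (\<lambda>p. visited t (snd p)) raw)" for t
    by (induction raw) auto
  then show ?thesis by (simp add: under_explored_def)
qed

lemma hal_steps_erase: "hal_steps \<mu> U i (erase_traj \<tau>) = hal_steps \<mu> U i \<tau>"
  by (induction \<tau> arbitrary: i) auto

lemma set_hal_steps: "c \<in> set_pmf (hal_steps \<mu> U i \<tau>) \<Longrightarrow> erase_traj c = erase_traj \<tau>"
  by (induction \<mu> U i \<tau> arbitrary: c rule: hal_steps.induct) auto

lemma hal_entries_erase: "hal_entries \<mu> U (erase raw) = hal_entries \<mu> U raw"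
  by (induction raw) (auto simp: hal_steps_erase)

lemma set_hal_entries: "es \<in> set_pmf (hal_entries \<mu> U raw) \<Longrightarrow> erase es = erase raw"
  by (induction \<mu> U raw arbitrary: es rule: hal_entries.induct) (auto dest: set_hal_steps)

text \<open>This is why the likelihood of a ledger factors into the likelihood of its erasure and the law of
  hallucinated rewards.\<close>

lemma bind_traj_hal_steps:
  "bind_pmf (traj_steps m \<mu> \<pi> h x) (hal_steps \<mu> U h) = map_pmf (censor_steps U h) (traj_steps m \<mu> \<pi> h x)"
proof (induction m arbitrary: h x)
  case (Suc m)
  let ?a = "\<pi> x h"
  let ?ro = "if (x, ?a, h) \<in> U then return_pmf None else map_pmf Some (mrew \<mu> x ?a h)"
  have "bind_pmf (traj_steps (Suc m) \<mu> \<pi> h x) (hal_steps \<mu> U h) =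
    bind_pmf (mtrans \<mu> x ?a h) (\<lambda>x'. bind_pmf (traj_steps m \<mu> \<pi> (Suc h) x') (\<lambda>rest.
      bind_pmf ?ro (\<lambda>ro. map_pmf (\<lambda>c. (x, ?a, ro) # c) (hal_steps \<mu> U (Suc h) rest))))"
    by (simp add: bind_assoc_pmf bind_map_pmf)
  also have "\<dots> = bind_pmf ?ro (\<lambda>ro. bind_pmf (mtrans \<mu> x ?a h) (\<lambda>x'.
      map_pmf (\<lambda>c. (x, ?a, ro) # c) (bind_pmf (traj_steps m \<mu> \<pi> (Suc h) x') (hal_steps \<mu> U (Suc h)))))"
    by (subst bind_commute_pmf[of _ ?ro], subst bind_commute_pmf[of _ ?ro]) (simp add: map_bind_pmf)
  also have "\<dots> = map_pmf (censor_steps U h) (traj_steps (Suc m) \<mu> \<pi> h x)"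
    unfolding Suc by (simp add: map_bind_pmf bind_map_pmf map_pmf_comp bind_return_pmf)
  finally show ?case .
qed (simp add: bind_return_pmf)

lemma bind_traj_pmf_hal_steps:
  "bind_pmf (traj_pmf H \<mu> \<pi>) (hal_steps \<mu> U 0) = map_pmf (censor_traj U) (traj_pmf H \<mu> \<pi>)"
  by (simp add: traj_pmf_def bind_assoc_pmf bind_traj_hal_steps map_bind_pmf censor_traj_eq[abs_def])

text \<open>Only trajectories with the erasure of \<open>c\<close> can be turned into
  \<open>c\<close> by \<open>hal_steps\<close>, and \<open>hal_steps\<close> acts in the same way on
  all of them; so the law of the visible rewards factors out of the sum over trajectories. What
  remains is the law of states and actions.\<close>

lemma pmf_censor_traj:
  "pmf (map_pmf (censor_traj U) (traj_pmf H \<mu> \<pi>)) c =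
   pmf (map_pmf erase_traj (traj_pmf H \<mu> \<pi>)) (erase_traj c) * pmf (hal_steps \<mu> U 0 (erase_traj c)) c"
proof -
  let ?p = "traj_pmf H \<mu> \<pi>"
  have *: "pmf (hal_steps \<mu> U 0 \<tau>) c =
      indicator {\<tau>. erase_traj \<tau> = erase_traj c} \<tau> * pmf (hal_steps \<mu> U 0 (erase_traj c)) c" for \<tau> :: traj
    by (metis (mono_tags) hal_steps_erase set_hal_steps indicator_simps mem_Collect_eq mult_1 mult_zero_left set_pmf_iff)
  have "pmf (map_pmf (censor_traj U) ?p) c = (\<integral>\<tau>. pmf (hal_steps \<mu> U 0 \<tau>) c \<partial>?p)"
    by (simp add: bind_traj_pmf_hal_steps[symmetric] pmf_bind)
  also have "\<dots> = measure_pmf.prob ?p {\<tau>. erase_traj \<tau> = erase_traj c} * pmf (hal_steps \<mu> U 0 (erase_traj c)) c"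
    by (subst *) simp
  finally show ?thesis by (simp add: pmf_map vimage_def)
qed

lemma pmf_bind_map_Cons:
  "pmf (bind_pmf K (\<lambda>c. map_pmf (\<lambda>rest. (\<pi>, c) # rest) L)) ((\<pi>', c0) # es) =
   (if \<pi> = \<pi>' then pmf K c0 * pmf L es else 0)"
proof -
  have eq: "bind_pmf K (\<lambda>c. map_pmf (\<lambda>rest. (\<pi>, c) # rest) L) = map_pmf (\<lambda>(c, rest). (\<pi>, c) # rest) (pair_pmf K L)"
    by (simp add: pair_pmf_def map_bind_pmf bind_assoc_pmf bind_return_pmf map_pmf_def)
  show ?thesis
  proof (cases "\<pi> = \<pi>'")
    case True
    have "inj (\<lambda>(c, rest). (\<pi>', c) # rest)" by (auto simp: inj_def)
    from pmf_map_inj'[OF this, of "pair_pmf K L" "(c0, es)"] show ?thesis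
      unfolding eq using True by (simp add: pmf_pair)
  next
    case False
    then show ?thesis unfolding eq by (auto simp: pmf_eq_0_set_pmf)
  qed
qed

section \<open>Measurability of trajectories and values over the space of models\<close>

locale mdp =
  fixes S A H :: nat and Rset :: "real set" and prior :: "model measure"
  assumes pos: "0 < S" "0 < A" "0 < H"
    and countable_Rset: "countable Rset" and Rset_subset: "Rset \<subseteq> {0..1}"
    and prob_prior: "prob_space prior"
    and sets_prior: "sets prior = sets (model_space S A H Rset)"
begin

abbreviation valid :: "model \<Rightarrow> bool" where "valid \<equiv> valid_model S A H Rset"
abbreviation pols :: "policy set" where "pols \<equiv> policies S A H"
abbreviation trips :: "triple set" where "trips \<equiv> triples S A H"

sublocale prob_space prior by (rule prob_prior)

lemma space_prior: "space prior = {\<mu>. valid \<mu>}"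
  unfolding sets_eq_imp_space_eq[OF sets_prior] model_space_def by (auto simp: space_measure_of_conv)

lemma validD:
  assumes "valid \<mu>" "x < S" "a < A" "h < H"
  shows "set_pmf (mrew \<mu> x a h) \<subseteq> Rset" "set_pmf (mtrans \<mu> x a h) \<subseteq> {..<S}"
  using assms by (auto simp: valid_model_def)

lemma valid_minit: "valid \<mu> \<Longrightarrow> set_pmf (minit \<mu>) \<subseteq> {..<S}"
  by (auto simp: valid_model_def)

lemma policy_less: "\<pi> \<in> pols \<Longrightarrow> x < S \<Longrightarrow> h < H \<Longrightarrow> \<pi> x h < A"
  by (auto simp: policies_def)

lemma model_gen_measurable:
  assumes "\<And>B. B \<in> sets (borel :: real measure) \<Longrightarrow> {\<mu>. f \<mu> \<in> B} \<in> model_gen"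
  shows "f \<in> borel_measurable prior"
proof (rule measurableI)
  fix B :: "real set" assume "B \<in> sets borel"
  then have "{\<mu>. f \<mu> \<in> B} \<inter> {\<mu>. valid \<mu>} \<in> (\<lambda>G. G \<inter> {\<mu>. valid \<mu>}) ` model_gen"
    using assms by blast
  moreover have "f -` B \<inter> space prior = {\<mu>. f \<mu> \<in> B} \<inter> {\<mu>. valid \<mu>}"
    by (auto simp: space_prior)
  ultimately show "f -` B \<inter> space prior \<in> sets prior"
    unfolding sets_prior model_space_def by (subst sets_measure_of) auto
qed auto

lemma measurable_model_pmf:
  "(\<lambda>\<mu>. pmf (mrew \<mu> x a h) v) \<in> borel_measurable prior"
  "(\<lambda>\<mu>. pmf (mtrans \<mu> x a h) y) \<in> borel_measurable prior"
  "(\<lambda>\<mu>. pmf (minit \<mu>) y) \<in> borel_measurable prior"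
  by (rule model_gen_measurable; force simp: model_gen_def)+

lemma kernel_mrew: "x < S \<Longrightarrow> a < A \<Longrightarrow> h < H \<Longrightarrow> pmf_kernel prior Rset (\<lambda>\<mu>. mrew \<mu> x a h)"
  by (rule pmf_kernelI) (auto simp: space_prior measurable_model_pmf countable_Rset dest: validD)

lemma kernel_mtrans: "x < S \<Longrightarrow> a < A \<Longrightarrow> h < H \<Longrightarrow> pmf_kernel prior {..<S} (\<lambda>\<mu>. mtrans \<mu> x a h)"
  by (rule pmf_kernelI) (auto simp: space_prior measurable_model_pmf dest: validD)

lemma kernel_minit: "pmf_kernel prior {..<S} minit"
  by (rule pmf_kernelI) (auto simp: space_prior measurable_model_pmf dest: valid_minit)

definition trajs :: "nat \<Rightarrow> traj set" where
  "trajs m = {\<tau> \<in> lists ({..<S} \<times> {..<A} \<times> Rset). length \<tau> = m}"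

lemma countable_trajs: "countable (trajs m)"
  unfolding trajs_def
  by (rule countable_subset[of _ "lists ({..<S} \<times> {..<A} \<times> Rset)"]) (auto intro!: countable_SIGMA countable_Rset)

lemma kernel_traj_steps:
  assumes "\<pi> \<in> pols"
  shows "x < S \<Longrightarrow> h + m \<le> H \<Longrightarrow> pmf_kernel prior (trajs m) (\<lambda>\<mu>. traj_steps m \<mu> \<pi> h x)"
proof (induction m arbitrary: h x)
  case 0
  show ?case using countable_trajs[of 0] by (auto intro!: pmf_kernel_const) (auto simp: trajs_def)
next
  case (Suc m)
  have a: "\<pi> x h < A" and h: "h < H" using Suc.prems policy_less[OF assms] by auto
  show ?case unfolding traj_steps.simps
  proof (rule pmf_kernel_bind[OF kernel_mrew], goal_cases)
    case (4 r)
    show ?case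
    proof (rule pmf_kernel_bind[OF kernel_mtrans], goal_cases)
      case (4 y)
      show ?case
        by (rule pmf_kernel_map[OF Suc.IH]) (use \<open>r \<in> Rset\<close> 4 Suc.prems a in \<open>auto simp: countable_trajs\<close>, auto simp: trajs_def)
    qed (use Suc.prems a h countable_trajs in auto)
  qed (use Suc.prems a h countable_trajs in auto)
qed

lemma kernel_traj_pmf: "\<pi> \<in> pols \<Longrightarrow> pmf_kernel prior (trajs H) (\<lambda>\<mu>. traj_pmf H \<mu> \<pi>)"
  unfolding traj_pmf_def by (intro pmf_kernel_bind[OF kernel_minit] kernel_traj_steps countable_trajs) auto

lemma set_traj_steps:
  "valid \<mu> \<Longrightarrow> \<pi> \<in> pols \<Longrightarrow> x < S \<Longrightarrow> h + m \<le> H \<Longrightarrow> set_pmf (traj_steps m \<mu> \<pi> h x) \<subseteq> trajs m"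
  using kernel_traj_steps[of \<pi> x h m] by (auto simp: pmf_kernel_def space_prior)

lemma set_traj_pmf: "valid \<mu> \<Longrightarrow> \<pi> \<in> pols \<Longrightarrow> set_pmf (traj_pmf H \<mu> \<pi>) \<subseteq> trajs H"
  using kernel_traj_pmf[of \<pi>] by (auto simp: pmf_kernel_def space_prior)

lemma mean_rew_measurable [measurable]: "t \<in> trips \<Longrightarrow> (\<lambda>\<mu>. mean_rew \<mu> t) \<in> borel_measurable prior"
  using Rset_subset by (auto simp: mean_rew_def triples_def space_prior subset_iff dest!: validD(1)
      intro!: pmf_kernel_expectation[OF kernel_mrew])

lemma mean_rew_bounds:
  assumes "valid \<mu>" "t \<in> trips"
  shows "0 \<le> mean_rew \<mu> t" "mean_rew \<mu> t \<le> 1"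
proof -
  obtain x a h where t: "t = (x, a, h)" "x < S" "a < A" "h < H"
    using assms(2) by (auto simp: triples_def)
  have sub: "set_pmf (mrew \<mu> x a h) \<subseteq> {0..1}"
    using validD(1)[OF assms(1) t(2-)] Rset_subset by auto
  show "0 \<le> mean_rew \<mu> t"
    unfolding mean_rew_def t using sub by (auto intro!: integral_nonneg_AE simp: AE_measure_pmf_iff subset_iff)
  show "mean_rew \<mu> t \<le> 1"
    unfolding mean_rew_def t prod.case
    by (rule order_trans[OF _ measure_pmf.integral_le_const[of _ _ 1]])
       (use sub in \<open>auto simp: AE_measure_pmf_iff subset_iff intro!: measure_pmf.integrable_const_bound[where B=1]\<close>)
qed

lemma trajs_nth:
  assumes "\<tau> \<in> trajs m" "i < m"
  shows "fst (\<tau> ! i) < S" "fst (snd (\<tau> ! i)) < A" "snd (snd (\<tau> ! i)) \<in> Rset"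
proof -
  have "\<tau> ! i \<in> {..<S} \<times> {..<A} \<times> Rset"
    using assms by (auto simp: trajs_def)
  then show "fst (\<tau> ! i) < S" "fst (snd (\<tau> ! i)) < A" "snd (snd (\<tau> ! i)) \<in> Rset" by auto
qed

lemma trajs_trips: "\<tau> \<in> trajs H \<Longrightarrow> i < length \<tau> \<Longrightarrow> (fst (\<tau> ! i), fst (snd (\<tau> ! i)), i) \<in> trips"
  using trajs_nth[of \<tau> H i] by (auto simp: triples_def trajs_def)

lemma Vpi_measurable: "\<pi> \<in> pols \<Longrightarrow> (\<lambda>\<mu>. Vpi H \<mu> \<pi>) \<in> borel_measurable prior"
  unfolding Vpi_def
  apply (rule pmf_kernel_expectation[OF kernel_traj_pmf], assumption)
  subgoal by (auto intro!: borel_measurable_sum mean_rew_measurable trajs_trips)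
  subgoal using set_traj_pmf by (auto simp: space_prior intro!: sum_nonneg mean_rew_bounds trajs_trips)
  done

lemma sum_mean_rew_bounds:
  assumes "valid \<mu>" "\<tau> \<in> trajs H"
  shows "0 \<le> (\<Sum>i<length \<tau>. mean_rew \<mu> (fst (\<tau> ! i), fst (snd (\<tau> ! i)), i))"
    "(\<Sum>i<length \<tau>. mean_rew \<mu> (fst (\<tau> ! i), fst (snd (\<tau> ! i)), i)) \<le> real H"
proof -
  have "(\<Sum>i<length \<tau>. mean_rew \<mu> (fst (\<tau> ! i), fst (snd (\<tau> ! i)), i)) \<le> real (card {..<length \<tau>}) * 1"
    using assms by (intro sum_bounded_above mean_rew_bounds trajs_trips) auto
  then show "(\<Sum>i<length \<tau>. mean_rew \<mu> (fst (\<tau> ! i), fst (snd (\<tau> ! i)), i)) \<le> real H"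
    using assms by (simp add: trajs_def)
  show "0 \<le> (\<Sum>i<length \<tau>. mean_rew \<mu> (fst (\<tau> ! i), fst (snd (\<tau> ! i)), i))"
    using assms by (intro sum_nonneg mean_rew_bounds trajs_trips) auto
qed

lemma Vpi_bounds:
  assumes "valid \<mu>" "\<pi> \<in> pols"
  shows "0 \<le> Vpi H \<mu> \<pi>" "Vpi H \<mu> \<pi> \<le> real H"
proof -
  note b = sum_mean_rew_bounds[OF assms(1) subsetD[OF set_traj_pmf[OF assms]]]
  show "0 \<le> Vpi H \<mu> \<pi>"
    unfolding Vpi_def using b by (auto intro!: integral_nonneg_AE simp: AE_measure_pmf_iff)
  show "Vpi H \<mu> \<pi> \<le> real H"
    unfolding Vpi_def
    by (rule measure_pmf.integral_le_const)
       (use b in \<open>auto simp: AE_measure_pmf_iff intro!: measure_pmf.integrable_const_bound[where B="real H"]\<close>)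
qed

end

section \<open>Likelihoods and the hallucinated ledger\<close>

text \<open>The likelihood of states and actions alone. The reward type is left open so that raw,
  censored and hallucinated data of the same run all have the same value.\<close>

definition erased_lik :: "nat \<Rightarrow> (policy \<times> (nat \<times> nat \<times> 'r) list) list \<Rightarrow> model \<Rightarrow> real" where
  "erased_lik H rs \<mu> = prod_list (map (\<lambda>(\<pi>, c). pmf (map_pmf erase_traj (traj_pmf H \<mu> \<pi>)) (erase_traj c)) rs)"

lemma erased_lik_simps [simp]:
  "erased_lik H [] \<mu> = 1"
  "erased_lik H ((\<pi>, c) # rs) \<mu> = pmf (map_pmf erase_traj (traj_pmf H \<mu> \<pi>)) (erase_traj c) * erased_lik H rs \<mu>"
  by (auto simp: erased_lik_def)

lemma lik_simps [simp]:
  "lik H (U, []) \<mu> = 1"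
  "lik H (U, (\<pi>, c) # es) \<mu> = pmf (map_pmf (censor_traj U) (traj_pmf H \<mu> \<pi>)) c * lik H (U, es) \<mu>"
  by (auto simp: lik_def)

lemma erased_lik_erase [simp]: "erased_lik H (erase rs) \<mu> = erased_lik H rs \<mu>"
  by (induction rs) auto

text \<open>Rewards influence neither the transitions nor the listed policies, so they are
  independent given states and actions. The second factor is exactly the law from which hallucinated
  rewards are drawn, which is why hallucinated and honest ledgers can be compared through one
  likelihood.\<close>

lemma lik_factor: "lik H (U, es) \<mu> = erased_lik H es \<mu> * pmf (hal_entries \<mu> U (erase es)) es"
proof (induction es)
  case (Cons e es)
  obtain \<pi> c where e: "e = (\<pi>, c)" by (cases e)
  show ?case
    unfolding e erase_simps hal_entries.simps lik_simps erased_lik_simps pmf_bind_map_Cons Cons pmf_censor_traj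
    by simp
qed simp

lemma lik_nonneg [simp]: "0 \<le> lik H lg \<mu>"
  unfolding lik_def by (intro prod_list_nonneg) auto

lemma erased_lik_nonneg [simp]: "0 \<le> erased_lik H rs \<mu>"
  by (induction rs) auto

lemma lik_le_1: "lik H lg \<mu> \<le> 1"
proof -
  have "lik H (U, es) \<mu> \<le> 1" for U es by (induction es) (auto intro!: mult_le_one pmf_le_1)
  then show ?thesis by (cases lg) auto
qed

lemma erased_lik_le_1: "erased_lik H rs \<mu> \<le> 1"
  by (induction rs) (auto intro!: mult_le_one pmf_le_1)

lemma finite_policies: "finite (policies S A H)"
proof -
  let ?D = "{..<S} \<times> {..<H}"
  have "policies S A H \<subseteq> (\<lambda>f x h. if (x, h) \<in> ?D then f (x, h) else 0) ` (PiE ?D (\<lambda>_. {..<A}))"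
  proof
    fix \<pi> assume \<pi>: "\<pi> \<in> policies S A H"
    define f where "f = restrict (case_prod \<pi>) ?D"
    have "f \<in> PiE ?D (\<lambda>_. {..<A})" using \<pi> by (auto simp: f_def policies_def)
    moreover have "\<pi> = (\<lambda>x h. if (x, h) \<in> ?D then f (x, h) else 0)"
      using \<pi> by (auto simp: f_def policies_def intro!: ext)
    ultimately show "\<pi> \<in> (\<lambda>f x h. if (x, h) \<in> ?D then f (x, h) else 0) ` (PiE ?D (\<lambda>_. {..<A}))" by blast
  qed
  then show ?thesis by (rule finite_subset) (auto intro!: finite_PiE)
qed

lemma finite_triples: "finite (triples S A H)" by (auto simp: triples_def)

lemma card_triples: "card (triples S A H) = S * A * H" by (simp add: triples_def card_cartesian_product)

lemma under_explored_subset: "under_explored S A H n raw \<subseteq> triples S A H"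
  by (auto simp: under_explored_def)

section \<open>Totally censored data, posterior bounds, and the mass function of a
  hallucination\<close>

context mdp begin

text \<open>Weaker than membership in \<open>trajs\<close>: rewards are unrestricted, because an
  erased trajectory carries the value 0, which may lie outside \<open>Rset\<close>, and a censored
  one carries options.\<close>

definition shape :: "(nat \<times> nat \<times> 'r) list \<Rightarrow> bool" where
  "shape \<tau> \<longleftrightarrow> length \<tau> = H \<and> set \<tau> \<subseteq> {..<S} \<times> {..<A} \<times> UNIV"

definition raw_ok :: "(policy \<times> (nat \<times> nat \<times> 'r) list) list \<Rightarrow> bool" where
  "raw_ok rs \<longleftrightarrow> (\<forall>(\<pi>, \<tau>)\<in>set rs. \<pi> \<in> pols \<and> shape \<tau>)"

lemma raw_ok_simps [simp]: "raw_ok []" "raw_ok ((\<pi>, \<tau>) # rs) \<longleftrightarrow> \<pi> \<in> pols \<and> shape \<tau> \<and> raw_ok rs"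
  "raw_ok (rs @ ss) \<longleftrightarrow> raw_ok rs \<and> raw_ok ss"
  by (auto simp: raw_ok_def)

lemma shape_erase [simp]: "shape (erase_traj \<tau>) \<longleftrightarrow> shape \<tau>"
  by (auto simp: shape_def erase_traj_def)

lemma raw_ok_erase [simp]: "raw_ok (erase rs) \<longleftrightarrow> raw_ok rs"
  by (induction rs) auto

lemma raw_ok_cong: "erase rs = erase rs' \<Longrightarrow> raw_ok rs \<longleftrightarrow> raw_ok rs'"
  by (metis raw_ok_erase)

lemma trajs_shape: "\<tau> \<in> trajs H \<Longrightarrow> shape \<tau>"
  by (auto simp: trajs_def shape_def)

lemma censor_all: 
  assumes "shape \<tau>"
  shows "censor_traj trips \<tau> = map (\<lambda>(x, a, _). (x, a, None)) (erase_traj \<tau>)"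
proof -
  have "i + length \<tau> \<le> H \<Longrightarrow> set \<tau> \<subseteq> {..<S} \<times> {..<A} \<times> UNIV \<Longrightarrow>
     censor_steps trips i \<tau> = map (\<lambda>(x, a, _). (x, a, None)) (erase_traj \<tau>)" for i
    by (induction trips i \<tau> rule: censor_steps.induct) (auto simp: triples_def)
  from this[of 0] show ?thesis using assms by (auto simp: shape_def censor_traj_eq)
qed

text \<open>\<open>None\<close> in every place and 0 in every place carry the same information. The
  restriction to well-shaped data matters: \<open>trips\<close> hides rewards only at states,
  actions and stages within bounds, and in a valid model no other trajectory occurs.\<close>

lemma pmf_censor_all:
  assumes "valid \<mu>" "\<pi> \<in> pols" "shape \<tau>"
  shows "pmf (map_pmf (censor_traj trips) (traj_pmf H \<mu> \<pi>)) (censor_traj trips \<tau>) =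
         pmf (map_pmf erase_traj (traj_pmf H \<mu> \<pi>)) (erase_traj \<tau>)"
proof -
  have "censor_traj trips \<tau>' = censor_traj trips \<tau> \<longleftrightarrow> erase_traj \<tau>' = erase_traj \<tau>"
    if "\<tau>' \<in> set_pmf (traj_pmf H \<mu> \<pi>)" for \<tau>'
  proof
    have "shape \<tau>'" using set_traj_pmf[OF assms(1,2)] that by (intro trajs_shape) auto
    then show "censor_traj trips \<tau>' = censor_traj trips \<tau>" if "erase_traj \<tau>' = erase_traj \<tau>"
      by (simp only: censor_all assms(3) that)
    show "erase_traj \<tau>' = erase_traj \<tau>" if "censor_traj trips \<tau>' = censor_traj trips \<tau>"
      using arg_cong[OF that, of erase_traj] by simp
  qed
  then show ?thesis
    unfolding pmf_map
    by (intro measure_prob_cong_0) (auto simp: pmf_eq_0_set_pmf)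
qed

lemma lik_censor_all:
  assumes "valid \<mu>" "raw_ok rs"
  shows "lik H (censor_raw trips rs) \<mu> = erased_lik H rs \<mu>"
  using assms(2) by (induction rs) (auto simp: censor_raw_eq pmf_censor_all assms(1))

definition ledgers :: "(policy \<times> ctraj) list set" where
  "ledgers = {es \<in> lists (pols \<times> lists ({..<S} \<times> {..<A} \<times> insert None (Some ` Rset))). raw_ok es}"

lemma ledgers_Cons:
  "\<pi> \<in> pols \<Longrightarrow> c \<in> lists ({..<S} \<times> {..<A} \<times> insert None (Some ` Rset)) \<Longrightarrow> length c = H \<Longrightarrow>
   es \<in> ledgers \<Longrightarrow> (\<pi>, c) # es \<in> ledgers"
proof -
  assume a: "\<pi> \<in> pols" "c \<in> lists ({..<S} \<times> {..<A} \<times> insert None (Some ` Rset))" "length c = H" "es \<in> ledgers"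
  then have "shape c" unfolding shape_def lists_eq_set by blast
  with a show ?thesis by (simp add: ledgers_def)
qed

lemma countable_ledgers: "countable ledgers"
proof -
  have "countable (lists (pols \<times> lists ({..<S} \<times> {..<A} \<times> insert None (Some ` Rset))))"
    by (intro countable_lists countable_SIGMA countable_insert countable_image countable_Rset)
       (auto simp: finite_policies countable_finite)
  then show ?thesis by (rule countable_subset[rotated]) (auto simp: ledgers_def)
qed

lemma kernel_hal_steps:
  assumes "set \<tau> \<subseteq> {..<S} \<times> {..<A} \<times> UNIV"
  shows "i + length \<tau> \<le> H \<Longrightarrow>
    pmf_kernel prior {c \<in> lists ({..<S} \<times> {..<A} \<times> insert None (Some ` Rset)). length c = length \<tau>} (\<lambda>\<mu>. hal_steps \<mu> U i \<tau>)"
  using assms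
proof (induction \<tau> arbitrary: i)
  case Nil
  have eq: "{c \<in> lists X. length c = length []} = {[]}" for X :: "'z set" by auto
  show ?case unfolding eq hal_steps.simps by (rule pmf_kernel_const) simp_all
next
  case (Cons e \<tau>)
  obtain x a r where e: "e = (x, a, r)" by (cases e)
  let ?R = "insert None (Some ` Rset)"
  let ?C = "\<lambda>n. {c \<in> lists ({..<S} \<times> {..<A} \<times> ?R). length c = n}"
  have cnt: "countable (?C n)" for n
    by (rule countable_subset[of _ "lists ({..<S} \<times> {..<A} \<times> ?R)"])
       (auto intro!: countable_lists countable_SIGMA countable_insert countable_image countable_Rset)
  have K: "pmf_kernel prior ?R (\<lambda>\<mu>. if (x, a, i) \<in> U then return_pmf None else map_pmf Some (mrew \<mu> x a i))"
    using Cons.prems countable_Rset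
    by (cases "(x, a, i) \<in> U") (auto simp: e intro!: pmf_kernel_const pmf_kernel_map[OF kernel_mrew])
  have *: "length (e # \<tau>) = Suc (length \<tau>)" by simp
  have xa: "x < S" "a < A" and \<tau>: "Suc i + length \<tau> \<le> H" "set \<tau> \<subseteq> {..<S} \<times> {..<A} \<times> UNIV"
    using Cons.prems by (auto simp: e)
  show ?case unfolding e hal_steps.simps *[unfolded e]
  proof (rule pmf_kernel_bind[OF K pmf_kernel_map[OF Cons.IH[OF \<tau>]]])
    fix ro rest assume "ro \<in> ?R" "rest \<in> ?C (length \<tau>)"
    then show "(x, a, ro) # rest \<in> ?C (Suc (length \<tau>))" using xa by simp
  qed (rule cnt)+
qed

lemma kernel_hal_entries:
  assumes "raw_ok rs"
  shows "pmf_kernel prior ledgers (\<lambda>\<mu>. hal_entries \<mu> U rs)"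
  using assms
proof (induction rs)
  case Nil
  show ?case using countable_ledgers by (auto intro!: pmf_kernel_const simp: ledgers_def)
next
  case (Cons e rs)
  obtain \<pi> \<tau> where e: "e = (\<pi>, \<tau>)" by (cases e)
  have ok: "\<pi> \<in> pols" "shape \<tau>" "raw_ok rs" using Cons.prems by (auto simp: e)
  then have \<tau>: "set \<tau> \<subseteq> {..<S} \<times> {..<A} \<times> UNIV" "0 + length \<tau> \<le> H" "length \<tau> = H"
    by (auto simp: shape_def)
  show ?case unfolding e hal_entries.simps
  proof (rule pmf_kernel_bind[OF kernel_hal_steps[OF \<tau>(1,2)] pmf_kernel_map[OF Cons.IH[OF ok(3)]]])
    fix c rest assume "c \<in> {c \<in> lists ({..<S} \<times> {..<A} \<times> insert None (Some ` Rset)). length c = length \<tau>}" "rest \<in> ledgers"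
    then show "(\<pi>, c) # rest \<in> ledgers" using ok \<tau> by (intro ledgers_Cons) auto
  qed (rule countable_ledgers)+
qed

lemma erased_lik_measurable [measurable]:
  "raw_ok rs \<Longrightarrow> (\<lambda>\<mu>. erased_lik H rs \<mu>) \<in> borel_measurable prior"
proof (induction rs)
  case (Cons e rs)
  obtain \<pi> \<tau> where e: "e = (\<pi>, \<tau>)" by (cases e)
  have "(\<lambda>\<mu>. pmf (map_pmf erase_traj (traj_pmf H \<mu> \<pi>)) (erase_traj \<tau>)) \<in> borel_measurable prior"
    using Cons.prems e countable_trajs by (auto intro!: pmf_kernel_pmf[OF pmf_kernel_map[OF kernel_traj_pmf, where D="erase_traj ` trajs H"]])
  then show ?case using Cons by (auto simp: e)
qed (simp add: erased_lik_def[abs_def])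

lemma lik_measurable [measurable]:
  "raw_ok es \<Longrightarrow> (\<lambda>\<mu>. lik H (U, es) \<mu>) \<in> borel_measurable prior"
  unfolding lik_factor by (intro borel_measurable_times erased_lik_measurable pmf_kernel_pmf[OF kernel_hal_entries]) auto

lemma pred_mean_rew_le [measurable]:
  "t \<in> trips \<Longrightarrow> Measurable.pred prior (\<lambda>\<mu>. mean_rew \<mu> t \<le> e)"
  using mean_rew_measurable[of t] by measurable

lemma pred_all_mean_rew_le [measurable]: "Measurable.pred prior (\<lambda>\<mu>. \<forall>t\<in>trips. mean_rew \<mu> t \<le> e)"
  using finite_triples by (intro pred_intros_finite) auto

lemma pred_pun_event [measurable]: "Measurable.pred prior (\<lambda>\<mu>. pun_event S A H e U \<mu>)"
  unfolding pun_event_def using finite_triples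
  by (intro pred_intros_finite) auto

abbreviation pun_ind :: "real \<Rightarrow> triple set \<Rightarrow> model \<Rightarrow> real" where
  "pun_ind e U \<mu> \<equiv> (if pun_event S A H e U \<mu> then 1 else 0)"

lemma pun_ind_measurable [measurable]: "(\<lambda>\<mu>. pun_ind e U \<mu>) \<in> borel_measurable prior"
  by (rule measurable_If) (use pred_pun_event[of e U] in \<open>auto simp: pred_def\<close>)

lemma integrable_bounded:
  assumes "f \<in> borel_measurable prior" "\<And>\<mu>. valid \<mu> \<Longrightarrow> \<bar>f \<mu>\<bar> \<le> (B::real)"
  shows "integrable prior f"
  using assms by (intro integrable_const_bound[where B=B]) (auto simp: space_prior)

lemma valid_space: "\<mu> \<in> space prior \<Longrightarrow> valid \<mu>" by (simp add: space_prior)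

lemma integrable_lik_times:
  assumes "raw_ok es" "f \<in> borel_measurable prior" "\<And>\<mu>. valid \<mu> \<Longrightarrow> \<bar>f \<mu>\<bar> \<le> (B::real)"
  shows "integrable prior (\<lambda>\<mu>. lik H (U, es) \<mu> * f \<mu>)"
proof (rule integrable_bounded)
  show "(\<lambda>\<mu>. lik H (U, es) \<mu> * f \<mu>) \<in> borel_measurable prior"
    using assms by measurable
  show "\<bar>lik H (U, es) \<mu> * f \<mu>\<bar> \<le> 1 * B" if "valid \<mu>" for \<mu>
    unfolding abs_mult using assms(3)[OF that] by (intro mult_mono) (auto intro: lik_le_1)
qed

lemma integrable_erased_lik_times:
  assumes "raw_ok es" "f \<in> borel_measurable prior" "\<And>\<mu>. valid \<mu> \<Longrightarrow> \<bar>f \<mu>\<bar> \<le> (B::real)"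
  shows "integrable prior (\<lambda>\<mu>. erased_lik H es \<mu> * f \<mu>)"
proof (rule integrable_bounded)
  show "(\<lambda>\<mu>. erased_lik H es \<mu> * f \<mu>) \<in> borel_measurable prior"
    using assms by measurable
  show "\<bar>erased_lik H es \<mu> * f \<mu>\<bar> \<le> 1 * B" if "valid \<mu>" for \<mu>
    unfolding abs_mult using assms(3)[OF that] by (intro mult_mono) (auto intro: erased_lik_le_1)
qed

lemma integrable_lik: "raw_ok es \<Longrightarrow> integrable prior (\<lambda>\<mu>. lik H (U, es) \<mu>)"
  using integrable_lik_times[of es "\<lambda>_. 1" 1 U] by simp

lemma integrable_erased_lik: "raw_ok es \<Longrightarrow> integrable prior (\<lambda>\<mu>. erased_lik H es \<mu>)"
  using integrable_erased_lik_times[of es "\<lambda>_. 1" 1] by simp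

lemma integral_mono_prior:
  fixes f g :: "model \<Rightarrow> real"
  assumes "integrable prior f" "integrable prior g" "\<And>\<mu>. valid \<mu> \<Longrightarrow> f \<mu> \<le> g \<mu>"
  shows "(\<integral>\<mu>. f \<mu> \<partial>prior) \<le> (\<integral>\<mu>. g \<mu> \<partial>prior)"
  using assms by (intro integral_mono) (auto simp: space_prior)

lemma integral_cong_prior:
  fixes f g :: "model \<Rightarrow> real"
  assumes "\<And>\<mu>. valid \<mu> \<Longrightarrow> f \<mu> = g \<mu>"
  shows "(\<integral>\<mu>. f \<mu> \<partial>prior) = (\<integral>\<mu>. g \<mu> \<partial>prior)"
  using assms by (intro Bochner_Integration.integral_cong) (auto simp: space_prior)

lemma integral_nonneg_prior:
  fixes f :: "model \<Rightarrow> real"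
  assumes "\<And>\<mu>. valid \<mu> \<Longrightarrow> 0 \<le> f \<mu>"
  shows "0 \<le> (\<integral>\<mu>. f \<mu> \<partial>prior)"
  using assms by (intro integral_nonneg_AE AE_I2) (auto simp: space_prior)

lemma can_exp_nonneg:
  assumes "\<And>\<mu>. valid \<mu> \<Longrightarrow> 0 \<le> f \<mu>"
  shows "0 \<le> can_exp H prior lg f"
  unfolding can_exp_def evidence_def using assms
  by (intro divide_nonneg_nonneg integral_nonneg_prior) auto

lemma evidence_Nil: "evidence H prior (U, []) = 1"
  by (simp add: evidence_def prob_space)

lemma q_pun_bdd: "bdd_below ((\<lambda>lg. can_prob H prior lg (\<lambda>\<mu>. \<forall>t \<in> trips. mean_rew \<mu> t \<le> e)) ` X)"
  by (rule bdd_belowI[where m=0]) (auto simp: can_prob_def intro!: can_exp_nonneg)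

lemma q_pun_le_1: "q_pun S A H prior e \<le> 1"
proof -
  \<comment> \<open>The empty ledger has evidence 1, so it belongs to the set under the
    infimum.\<close>
  have "q_pun S A H prior e \<le> can_prob H prior (trips, []) (\<lambda>\<mu>. \<forall>t \<in> trips. mean_rew \<mu> t \<le> e)"
    unfolding q_pun_def by (intro cINF_lower q_pun_bdd) (auto simp: ledger_ok_def evidence_Nil)
  also have "\<dots> = (\<integral>\<mu>. (if \<forall>t \<in> trips. mean_rew \<mu> t \<le> e then 1 else 0) \<partial>prior)"
    by (simp add: can_prob_def can_exp_def evidence_Nil)
  also have "\<dots> \<le> (\<integral>\<mu>. 1 \<partial>prior)"
  proof (intro integral_mono_prior integrable_bounded[where B=1])
    show "(\<lambda>\<mu>. if \<forall>t\<in>trips. mean_rew \<mu> t \<le> e then 1 else 0 :: real) \<in> borel_measurable prior"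
      by measurable
  qed auto
  finally show ?thesis by (simp add: prob_space)
qed

text \<open>The definition cleared of its denominator. The event in \<open>q_pun\<close> punishes
  all triples and so implies \<open>pun_event\<close> for every \<open>U\<close>; when the evidence
  vanishes the left side is 0.\<close>

lemma q_pun_le:
  assumes "raw_ok rs"
  shows "q_pun S A H prior e * (\<integral>\<mu>. erased_lik H rs \<mu> \<partial>prior) \<le>
    (\<integral>\<mu>. erased_lik H rs \<mu> * (if pun_event S A H e U \<mu> then 1 else 0) \<partial>prior)"
proof -
  let ?lg = "censor_raw trips (erase rs)"
  have lik_eq: "lik H ?lg \<mu> = erased_lik H rs \<mu>" if "valid \<mu>" for \<mu>
    using lik_censor_all[OF that, of "erase rs"] assms by simp
  have ev: "evidence H prior ?lg = (\<integral>\<mu>. erased_lik H rs \<mu> \<partial>prior)"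
    unfolding evidence_def by (intro integral_cong_prior lik_eq)
  show ?thesis
  proof (cases "evidence H prior ?lg > 0")
    case True
    have "q_pun S A H prior e \<le> can_prob H prior ?lg (\<lambda>\<mu>. \<forall>t \<in> trips. mean_rew \<mu> t \<le> e)"
      unfolding q_pun_def using assms True
      by (intro cINF_lower q_pun_bdd) (auto simp: ledger_ok_def censor_raw_eq censor_list_def raw_ok_def erase_def)
    also have "\<dots> = (\<integral>\<mu>. erased_lik H rs \<mu> * (if \<forall>t \<in> trips. mean_rew \<mu> t \<le> e then 1 else 0) \<partial>prior) / evidence H prior ?lg"
      unfolding can_prob_def can_exp_def
      by (intro arg_cong2[where f="(/)"] refl integral_cong_prior) (simp add: lik_eq)
    also have "\<dots> \<le> (\<integral>\<mu>. erased_lik H rs \<mu> * (if pun_event S A H e U \<mu> then 1 else 0) \<partial>prior) / evidence H prior ?lg"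
    proof (intro divide_right_mono integral_mono_prior integrable_erased_lik_times[where B=1])
      show "(\<lambda>\<mu>. if \<forall>t\<in>trips. mean_rew \<mu> t \<le> e then 1 else 0) \<in> borel_measurable prior"
        by measurable
      show "(\<lambda>\<mu>. pun_ind e U \<mu>) \<in> borel_measurable prior"
        by (rule pun_ind_measurable)
    qed (use True assms in \<open>auto simp: pun_event_def[of S A H e U] intro!: mult_left_mono\<close>)
    finally show ?thesis using True by (simp add: ev field_simps)
  next
    case False
    then have "(\<integral>\<mu>. erased_lik H rs \<mu> \<partial>prior) = 0"
      unfolding ev[symmetric] evidence_def using integral_nonneg_prior[of "lik H ?lg", OF lik_nonneg] by linarith
    then show ?thesis by (simp add: integral_nonneg_prior)
  qed
qed

lemma r_alt_bdd:
  "bdd_below ((\<lambda>p. can_exp H prior (fst p) (\<lambda>\<mu>. mean_rew \<mu> (snd p))) `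
     {(lg, t). ledger_ok S A H lg \<and> evidence H prior lg > 0 \<and> t \<in> fst lg})"
  by (rule bdd_belowI[where m=0]) (auto simp: ledger_ok_def intro!: can_exp_nonneg mean_rew_bounds)

lemma r_alt_le_1: "r_alt S A H prior \<le> 1"
proof -
  have t: "(0, 0, 0) \<in> trips" using pos by (auto simp: triples_def)
  have "r_alt S A H prior \<le> can_exp H prior (trips, []) (\<lambda>\<mu>. mean_rew \<mu> (0, 0, 0))"
    unfolding r_alt_def using t by (intro cINF_lower2[OF r_alt_bdd, where x="((trips, []), (0, 0, 0))"]) (auto simp: ledger_ok_def evidence_Nil)
  also have "\<dots> = (\<integral>\<mu>. mean_rew \<mu> (0, 0, 0) \<partial>prior)"
    by (simp add: can_exp_def evidence_Nil)
  also have "\<dots> \<le> (\<integral>\<mu>. 1 \<partial>prior)"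
    using t mean_rew_bounds[OF _ t] by (intro integral_mono_prior integrable_bounded[where B=1]) auto
  finally show ?thesis by (simp add: prob_space)
qed

text \<open>Clearing the denominator lets the bound be summed over triples against fixed weights,
  with no case distinction on the evidence.\<close>

lemma r_alt_le:
  assumes "raw_ok es" "U \<subseteq> trips" "t \<in> U"
  shows "r_alt S A H prior * (\<integral>\<mu>. lik H (U, es) \<mu> \<partial>prior) \<le> (\<integral>\<mu>. lik H (U, es) \<mu> * mean_rew \<mu> t \<partial>prior)"
proof (cases "evidence H prior (U, es) > 0")
  case True
  have "r_alt S A H prior \<le> can_exp H prior (U, es) (\<lambda>\<mu>. mean_rew \<mu> t)"
    unfolding r_alt_def using assms True
    by (intro cINF_lower2[OF r_alt_bdd, where x="((U, es), t)"]) (auto simp: ledger_ok_def raw_ok_def)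
  then show ?thesis using True by (simp add: can_exp_def evidence_def field_simps)
next
  case False
  then have "(\<integral>\<mu>. lik H (U, es) \<mu> \<partial>prior) = 0"
    unfolding evidence_def using integral_nonneg_prior[of "lik H (U, es)", OF lik_nonneg] by linarith
  then show ?thesis using assms by (auto intro!: integral_nonneg_prior mult_nonneg_nonneg mean_rew_bounds)
qed

text \<open>True rewards enter neither the totally censored likelihood nor
  \<open>hal_entries\<close>, which redraws them. Hence neither the hallucinated ledger nor the
  response to it reveals more about the true model than the erased data.\<close>

lemma hal_pmf_erase:
  assumes "raw_ok rs"
  shows "hal_pmf S A H prior e U (erase rs) = hal_pmf S A H prior e U rs"
proof -
  have "(\<integral>\<mu>. lik H (censor_raw trips (erase rs)) \<mu> * f \<mu> \<partial>prior) = (\<integral>\<mu>. lik H (censor_raw trips rs) \<mu> * f \<mu> \<partial>prior)" for f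
    using assms by (intro integral_cong_prior) (simp add: lik_censor_all)
  then show ?thesis unfolding hal_pmf_def hal_entries_erase by (simp add: mult.assoc)
qed

text \<open>By \<open>lik_factor\<close>, drawing a punished model from the posterior and then its
  rewards gives \<open>es\<close> the mass of its honest likelihood restricted to the punish event.
  The positivity in \<open>D\<close> makes the normalisation legitimate, so that
  \<open>embed_pmf\<close> returns the intended law.\<close>

lemma pmf_hal_pmf:
  assumes rs: "raw_ok rs" and D: "(\<integral>\<mu>. erased_lik H rs \<mu> * pun_ind e U \<mu> \<partial>prior) > 0"
  shows "pmf (hal_pmf S A H prior e U rs) (U', es) =
    (if U' = U \<and> erase es = erase rs
     then (\<integral>\<mu>. lik H (U, es) \<mu> * pun_ind e U \<mu> \<partial>prior) / (\<integral>\<mu>. erased_lik H rs \<mu> * pun_ind e U \<mu> \<partial>prior) else 0)"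
proof -
  let ?w = "\<lambda>\<mu>. erased_lik H rs \<mu> * pun_ind e U \<mu>"
  let ?K = "\<lambda>\<mu>. map_pmf (\<lambda>l. (U, l)) (hal_entries \<mu> U rs)"
  let ?D = "\<integral>\<mu>. ?w \<mu> \<partial>prior"
  define f where "f = (\<lambda>lg. (\<integral>\<mu>. ?w \<mu> * pmf (?K \<mu>) lg \<partial>prior) / ?D)"
  have K: "pmf_kernel prior (Pair U ` ledgers) ?K"
    by (rule pmf_kernel_map[OF kernel_hal_entries]) (auto simp: rs countable_ledgers)
  have "hal_pmf S A H prior e U rs = embed_pmf f"
    unfolding hal_pmf_def f_def
    by (intro arg_cong[where f=embed_pmf] ext arg_cong2[where f="(/)"] integral_cong_prior) (simp_all add: lik_censor_all rs)
  moreover have "pmf (embed_pmf f) lg = f lg" for lg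
  proof (rule pmf_embed_pmf)
    show "0 \<le> f lg" for lg
      unfolding f_def by (intro divide_nonneg_nonneg integral_nonneg_prior) auto
    have "(\<integral>\<^sup>+lg. ennreal (f lg) \<partial>count_space UNIV) =
        (\<integral>\<^sup>+lg. ennreal (\<integral>\<mu>. ?w \<mu> * pmf (?K \<mu>) lg \<partial>prior) / ennreal ?D \<partial>count_space UNIV)"
      unfolding f_def using D by (intro nn_integral_cong divide_ennreal[symmetric] integral_nonneg_prior) auto
    also have "\<dots> = (\<integral>\<^sup>+lg. ennreal (\<integral>\<mu>. ?w \<mu> * pmf (?K \<mu>) lg \<partial>prior) \<partial>count_space UNIV) / ennreal ?D"
      by (rule nn_integral_divide) simp
    also have "\<dots> = ennreal ?D / ennreal ?D"
      by (subst pmf_kernel_mixture[OF K integrable_erased_lik_times[OF rs pun_ind_measurable, where B=1]]) auto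
    also have "\<dots> = 1" using D by (simp add: divide_ennreal)
    finally show "(\<integral>\<^sup>+lg. ennreal (f lg) \<partial>count_space UNIV) = 1" .
  qed
  ultimately have "pmf (hal_pmf S A H prior e U rs) (U', es) = f (U', es)" by simp
  also have "\<dots> = (if U' = U \<and> erase es = erase rs then (\<integral>\<mu>. lik H (U, es) \<mu> * pun_ind e U \<mu> \<partial>prior) / ?D else 0)"
  proof (cases "U' = U \<and> erase es = erase rs")
    case True
    have "pmf (?K \<mu>) (U, es) = pmf (hal_entries \<mu> U rs) es" for \<mu>
      by (rule pmf_map_inj') (auto simp: inj_def)
    moreover have "hal_entries \<mu> U rs = hal_entries \<mu> U (erase es)" for \<mu>
      using True by (simp add: hal_entries_erase)
    moreover have "erased_lik H rs \<mu> = erased_lik H es \<mu>" for \<mu>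
      using True erased_lik_erase[of H rs \<mu>] erased_lik_erase[of H es \<mu>] by simp
    ultimately have "?w \<mu> * pmf (?K \<mu>) (U, es) = lik H (U, es) \<mu> * pun_ind e U \<mu>" for \<mu>
      by (simp only: lik_factor mult.commute mult.left_commute)
    with True show ?thesis by (simp only: f_def simp_thms if_True)
  next
    case False
    have "pmf (?K \<mu>) (U', es) = 0" for \<mu>
    proof -
      have "(U', es) \<notin> set_pmf (?K \<mu>)"
        using False set_hal_entries[of es \<mu> U rs] by auto
      then show ?thesis unfolding pmf_eq_0_set_pmf .
    qed
    with False show ?thesis by (simp only: f_def mult_zero_right integral_zero div_0 if_False)
  qed
  finally show ?thesis .
qed

end

section \<open>The process of hallucination episodes\<close>

text \<open>Once the signals are fixed, the episodes of a phase are independent, so the marginal at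
  one position is a single run of the policy chosen there.\<close>

lemma run_eps_nth:
  "i < length ks \<Longrightarrow> map_pmf (\<lambda>es. es ! i) (run_eps H \<mu> R sig ks) =
     map_pmf (\<lambda>\<tau>. (sig (ks ! i), R (ks ! i) (sig (ks ! i)), \<tau>)) (traj_pmf H \<mu> (R (ks ! i) (sig (ks ! i))))"
proof (induction ks arbitrary: i)
  case (Cons k ks)
  show ?case
  proof (cases i)
    case 0
    then show ?thesis by (simp add: map_bind_pmf map_pmf_comp) (simp add: map_pmf_def)
  next
    case (Suc j)
    then show ?thesis using Cons by (simp add: map_bind_pmf map_pmf_comp)
  qed
qed simp

lemma run_eps_set:
  "es \<in> set_pmf (run_eps H \<mu> R sig ks) \<Longrightarrow> length es = length ks \<and> (\<forall>i<length ks. fst (es ! i) = sig (ks ! i))"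
proof (induction ks arbitrary: es)
  case (Cons k ks)
  then show ?case by (fastforce simp: nth_Cons split: nat.splits)
qed simp

lemma pmf_bind_map_Pair:
  "pmf (bind_pmf P (\<lambda>x. map_pmf (Pair x) (Q x))) (x, y) = pmf P x * pmf (Q x) y"
proof -
  have "pmf (map_pmf (Pair x') (Q x')) (x, y) = indicator {x} x' * pmf (Q x) y" for x'
  proof (cases "x' = x")
    case True
    then show ?thesis using pmf_map_inj'[of "Pair x" "Q x" y] by (simp add: inj_def)
  next
    case False
    then have "(x, y) \<notin> set_pmf (map_pmf (Pair x') (Q x'))" by auto
    then show ?thesis using False by (simp add: pmf_eq_0_set_pmf)
  qed
  then show ?thesis by (simp add: pmf_bind measure_pmf_single)
qed

definition hallucinations :: "hist \<Rightarrow> (policy \<times> traj) list" where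
  "hallucinations hs = map (\<lambda>k. snd (snd hs ! k)) (fst hs)"

locale hidden_hallucination = mdp +
  fixes N n :: nat and e :: real
  assumes N_pos [simp]: "0 < N"
begin

abbreviation UE :: "(policy \<times> traj) list \<Rightarrow> triple set" where "UE \<equiv> under_explored S A H n"
abbreviation hal :: "(policy \<times> traj) list \<Rightarrow> ledger pmf" where
  "hal raw \<equiv> hal_pmf S A H prior e (UE raw) raw"
abbreviation phase :: "nat \<Rightarrow> nat set" where "phase l \<equiv> {l * N..<Suc l * N}"
abbreviation hon :: "(policy \<times> traj) list \<Rightarrow> ledger" where "hon raw \<equiv> censor_raw (UE raw) raw"

text \<open>The law of the policy run in the hallucination episode. The index \<open>k\<close> is
  averaged along with the ledger, since an agent's rule depends on the episode it is in.\<close>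

definition choice :: "(nat \<Rightarrow> ledger \<Rightarrow> policy) \<Rightarrow> nat \<Rightarrow> (policy \<times> traj) list \<Rightarrow> policy pmf" where
  "choice R l raw = bind_pmf (pmf_of_set (phase l)) (\<lambda>k. map_pmf (R k) (hal raw))"

definition raw_step :: "model \<Rightarrow> (nat \<Rightarrow> ledger \<Rightarrow> policy) \<Rightarrow> nat \<Rightarrow> (policy \<times> traj) list \<Rightarrow> (policy \<times> traj) list pmf" where
  "raw_step \<mu> R l raw = bind_pmf (choice R l raw) (\<lambda>\<pi>. map_pmf (\<lambda>\<tau>. raw @ [(\<pi>, \<tau>)]) (traj_pmf H \<mu> \<pi>))"

text \<open>A chain on raw ledgers alone suffices: the signals of a phase are computed from earlier
  hallucination episodes, so the remaining episodes never feed back.\<close>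

primrec raw_proc :: "model \<Rightarrow> (nat \<Rightarrow> ledger \<Rightarrow> policy) \<Rightarrow> nat \<Rightarrow> (policy \<times> traj) list pmf" where
  "raw_proc \<mu> R 0 = return_pmf []"
| "raw_proc \<mu> R (Suc l) = bind_pmf (raw_proc \<mu> R l) (raw_step \<mu> R l)"

definition hist_ok :: "nat \<Rightarrow> hist \<Rightarrow> bool" where
  "hist_ok l hs \<longleftrightarrow> length (snd hs) = l * N \<and> length (fst hs) = l \<and> (\<forall>j<l. fst hs ! j \<in> phase j)"

lemma phase_finite [simp]: "finite (phase l)" "phase l \<noteq> {}" "card (phase l) = N"
  by auto

lemma set_phase [simp]: "set_pmf (pmf_of_set (phase l)) = phase l"
  by (rule set_pmf_of_set) auto

lemma phase_step_cases:
  assumes hs': "hs' \<in> set_pmf (phase_step S A H prior N n e \<mu> R l hs)"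
  obtains kh new where "hs' = (fst hs @ [kh], snd hs @ new)" "kh \<in> phase l" "length new = N"
proof -
  from hs' obtain kh new sig where "kh \<in> set_pmf (pmf_of_set (phase l))"
    "new \<in> set_pmf (run_eps H \<mu> R sig [l * N..<Suc l * N])" "hs' = (fst hs @ [kh], snd hs @ new)"
    by (auto simp: phase_step_def Let_def simp del: mult_Suc)
  then show thesis using that run_eps_set by fastforce
qed

lemma hist_ok_step:
  assumes "hist_ok l hs" "hs' \<in> set_pmf (phase_step S A H prior N n e \<mu> R l hs)"
  shows "hist_ok (Suc l) hs'"
  using assms(2)
proof (rule phase_step_cases)
  fix kh new assume "hs' = (fst hs @ [kh], snd hs @ new)" "kh \<in> phase l" "length new = N"
  then show ?thesis using assms(1) by (auto simp: hist_ok_def nth_append less_Suc_eq)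
qed

lemma hist_ok_run: "hs \<in> set_pmf (run_phases S A H prior N n e \<mu> R l) \<Longrightarrow> hist_ok l hs"
  by (induction l arbitrary: hs) (auto simp: hist_ok_def[of 0] intro: hist_ok_step)

lemma hist_ok_less: "hist_ok l hs \<Longrightarrow> k \<in> set (fst hs) \<Longrightarrow> k < l * N"
proof -
  assume h: "hist_ok l hs" and k: "k \<in> set (fst hs)"
  then obtain j where j: "j < l" "k \<in> phase j" by (auto simp: hist_ok_def in_set_conv_nth)
  then have "Suc j * N \<le> l * N" by (intro mult_le_mono1) auto
  with j show "k < l * N" by auto
qed

lemma hallucinations_append:
  assumes "hist_ok l hs" "kh \<in> phase l"
  shows "hallucinations (fst hs @ [kh], snd hs @ new) = hallucinations hs @ [snd (new ! (kh - l * N))]"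
  using assms hist_ok_less[OF assms(1)] by (auto simp: hallucinations_def nth_append hist_ok_def)

lemma hallucinations_phase_step:
  assumes "hist_ok l hs"
  shows "map_pmf hallucinations (phase_step S A H prior N n e \<mu> R l hs) = raw_step \<mu> R l (hallucinations hs)"
proof -
  let ?raw = "hallucinations hs"
  have raw: "map (\<lambda>k. snd (snd hs ! k)) (fst hs) = ?raw" by (simp add: hallucinations_def)
  have *: "map_pmf (\<lambda>new. hallucinations (fst hs @ [kh], snd hs @ new))
      (run_eps H \<mu> R (\<lambda>k. if k = kh then h else hon ?raw) [l * N..<Suc l * N]) =
      map_pmf (\<lambda>\<tau>. ?raw @ [(R kh h, \<tau>)]) (traj_pmf H \<mu> (R kh h))" if "kh \<in> phase l" for kh h
  proof -
    let ?i = "kh - l * N" and ?ks = "[l * N..<Suc l * N]"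
    let ?run = "run_eps H \<mu> R (\<lambda>k. if k = kh then h else hon ?raw) ?ks"
    have i: "?i < length ?ks" "?ks ! ?i = kh" using that by (auto simp del: mult_Suc)
    have "map_pmf (\<lambda>new. hallucinations (fst hs @ [kh], snd hs @ new)) ?run =
      map_pmf (\<lambda>e. ?raw @ [snd e]) (map_pmf (\<lambda>new. new ! ?i) ?run)"
      by (simp add: map_pmf_comp hallucinations_append[OF assms that])
    also have "\<dots> = map_pmf (\<lambda>\<tau>. ?raw @ [(R kh h, \<tau>)]) (traj_pmf H \<mu> (R kh h))"
      unfolding run_eps_nth[OF i(1)] i(2) by (simp add: map_pmf_comp)
    finally show ?thesis .
  qed
  show ?thesis
    unfolding phase_step_def Let_def raw raw_step_def choice_def map_bind_pmf map_pmf_comp bind_assoc_pmf bind_map_pmf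
    by (intro bind_pmf_cong refl *) (simp del: mult_Suc)
qed

lemma hallucinations_run: "map_pmf hallucinations (run_phases S A H prior N n e \<mu> R l) = raw_proc \<mu> R l"
proof (induction l)
  case 0 show ?case by (simp add: hallucinations_def)
next
  case (Suc l)
  have "map_pmf hallucinations (run_phases S A H prior N n e \<mu> R (Suc l)) =
    bind_pmf (run_phases S A H prior N n e \<mu> R l) (\<lambda>hs. raw_step \<mu> R l (hallucinations hs))"
    unfolding run_phases.simps map_bind_pmf
    by (intro bind_pmf_cong refl hallucinations_phase_step hist_ok_run)
  also have "\<dots> = raw_proc \<mu> R (Suc l)"
    by (simp add: Suc[symmetric] bind_map_pmf)
  finally show ?case .
qed

definition signal :: "nat \<Rightarrow> nat \<Rightarrow> (policy \<times> traj) list \<Rightarrow> ledger pmf" where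
  "signal l k raw = bind_pmf (pmf_of_set (phase l)) (\<lambda>kh. if k = kh then hal raw else return_pmf (hon raw))"

text \<open>The signal at \<open>k\<close> is determined before any policy of phase \<open>l\<close>
  acts; the right side therefore involves \<open>R\<close> only through the first \<open>l\<close>
  phases.\<close>

lemma signal_run:
  assumes k: "k div N = l"
  shows "map_pmf (\<lambda>hs. fst (snd hs ! k)) (run_phases S A H prior N n e \<mu> R (Suc l)) =
    bind_pmf (raw_proc \<mu> R l) (signal l k)"
proof -
  have kp: "l * N \<le> k" "k < Suc l * N"
    using k N_pos by (metis div_times_less_eq_dividend, metis dividend_less_div_times k mult.commute mult_Suc)
  have *: "map_pmf (\<lambda>hs. fst (snd hs ! k)) (phase_step S A H prior N n e \<mu> R l hs) = signal l k (hallucinations hs)"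
    if hs: "hist_ok l hs" for hs
  proof -
    let ?raw = "hallucinations hs"
    have raw: "map (\<lambda>k. snd (snd hs ! k)) (fst hs) = ?raw" by (simp add: hallucinations_def)
    have len: "length (snd hs) = l * N" using hs by (simp add: hist_ok_def)
    have **: "map_pmf (\<lambda>new. fst (snd (fst hs @ [kh], snd hs @ new) ! k))
        (run_eps H \<mu> R (\<lambda>k. if k = kh then h else hon ?raw) [l * N..<Suc l * N]) =
        return_pmf (if k = kh then h else hon ?raw)" for kh h
    proof -
      let ?i = "k - l * N" and ?ks = "[l * N..<Suc l * N]"
      let ?run = "run_eps H \<mu> R (\<lambda>k. if k = kh then h else hon ?raw) ?ks"
      have i: "?i < length ?ks" "?ks ! ?i = k" using kp by (auto simp del: mult_Suc)
      have "map_pmf (\<lambda>new. fst (snd (fst hs @ [kh], snd hs @ new) ! k)) ?run =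
         map_pmf (\<lambda>new. fst (new ! ?i)) ?run"
        using kp by (simp add: nth_append len)
      also have "\<dots> = map_pmf fst (map_pmf (\<lambda>new. new ! ?i) ?run)"
        by (simp add: map_pmf_comp)
      also have "\<dots> = return_pmf (if k = kh then h else hon ?raw)"
        unfolding run_eps_nth[OF i(1)] i(2) by (simp add: map_pmf_comp)
      finally show ?thesis .
    qed
    show ?thesis
      unfolding phase_step_def Let_def raw signal_def map_bind_pmf map_pmf_comp **
      by (intro bind_pmf_cong refl) (simp add: bind_return_pmf' )
  qed
  have "map_pmf (\<lambda>hs. fst (snd hs ! k)) (run_phases S A H prior N n e \<mu> R (Suc l)) =
    bind_pmf (run_phases S A H prior N n e \<mu> R l) (\<lambda>hs. signal l k (hallucinations hs))"
    unfolding run_phases.simps map_bind_pmf by (intro bind_pmf_cong refl * hist_ok_run)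
  also have "\<dots> = bind_pmf (raw_proc \<mu> R l) (signal l k)"
    by (simp add: hallucinations_run[symmetric] bind_map_pmf)
  finally show ?thesis .
qed

text \<open>Seen from episode \<open>k\<close>, the uniform draw selects \<open>k\<close> with
  probability \<open>1 / N\<close>; each of the other \<open>N - 1\<close> outcomes yields the
  honest ledger. This is how the phase length dilutes the hallucination.\<close>

lemma pmf_signal:
  assumes k: "k div N = l"
  shows "pmf (signal l k raw) lg = 1 / N * pmf (hal raw) lg + (1 - 1 / N) * indicator {hon raw} lg"
proof -
  have kp: "k \<in> phase l"
    using k N_pos by (metis atLeastLessThan_iff div_times_less_eq_dividend dividend_less_div_times mult.commute mult_Suc)
  have "pmf (signal l k raw) lg =
      (\<Sum>kh\<in>phase l. pmf (if k = kh then hal raw else return_pmf (hon raw)) lg) / N"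
    unfolding signal_def by (subst pmf_bind_pmf_of_set) auto
  also have "(\<Sum>kh\<in>phase l. pmf (if k = kh then hal raw else return_pmf (hon raw)) lg) =
      pmf (hal raw) lg + (\<Sum>kh\<in>phase l - {k}. pmf (if k = kh then hal raw else return_pmf (hon raw)) lg)"
    using kp by (subst sum.remove[of _ k]) auto
  also have "(\<Sum>kh\<in>phase l - {k}. pmf (if k = kh then hal raw else return_pmf (hon raw)) lg) =
      (\<Sum>kh\<in>phase l - {k}. indicator {hon raw} lg)"
    by (intro sum.cong) (auto simp: indicator_def)
  also have "\<dots> = (real N - 1) * indicator {hon raw} lg"
    using kp N_pos by (simp add: card_Diff_singleton of_nat_diff)
  finally show ?thesis using N_pos by (simp add: field_simps)
qed

text \<open>The rules are built episode by episode, each from its predecessors. The first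
  \<open>l\<close> phases consult only episodes below \<open>l * N\<close>, so the partial table
  from which an agent's rule is computed can be replaced by the final one.\<close>

lemma raw_proc_cong: "(\<And>k. k < l * N \<Longrightarrow> R k = R' k) \<Longrightarrow> raw_proc \<mu> R l = raw_proc \<mu> R' l"
proof (induction l)
  case (Suc l)
  have "choice R l = choice R' l"
    unfolding choice_def using Suc.prems
    by (intro ext bind_pmf_cong refl map_pmf_cong) (auto simp del: mult_Suc)
  moreover have "raw_proc \<mu> R l = raw_proc \<mu> R' l"
    using Suc.prems by (intro Suc.IH) auto
  ultimately show ?case by (simp add: raw_step_def[abs_def])
qed simp

definition raws :: "(policy \<times> traj) list set" where
  "raws = lists (pols \<times> trajs H)"

lemma countable_raws: "countable raws"
  unfolding raws_def by (intro countable_lists countable_SIGMA countable_trajs) (auto simp: finite_policies countable_finite)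

lemma raws_ok: "raw \<in> raws \<Longrightarrow> raw_ok raw"
  by (auto simp: raws_def raw_ok_def dest: trajs_shape)

lemma set_choice:
  assumes "\<forall>k lg. R k lg \<in> pols"
  shows "set_pmf (choice R l raw) \<subseteq> pols"
  using assms by (auto simp: choice_def)

lemma kernel_raw_step:
  assumes R: "\<forall>k lg. R k lg \<in> pols" and raw: "raw \<in> raws"
  shows "pmf_kernel prior raws (\<lambda>\<mu>. raw_step \<mu> R l raw)"
  unfolding raw_step_def
proof (rule pmf_kernel_bind[where C=pols])
  show "pmf_kernel prior pols (\<lambda>\<mu>. choice R l raw)"
    using set_choice[OF R] by (intro pmf_kernel_const) (auto simp: finite_policies countable_finite)
  fix \<pi> assume \<pi>: "\<pi> \<in> pols"
  show "pmf_kernel prior raws (\<lambda>\<mu>. map_pmf (\<lambda>\<tau>. raw @ [(\<pi>, \<tau>)]) (traj_pmf H \<mu> \<pi>))"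
  proof (rule pmf_kernel_map[OF kernel_traj_pmf[OF \<pi>]])
    show "raw @ [(\<pi>, \<tau>)] \<in> raws" if "\<tau> \<in> trajs H" for \<tau>
      using raw \<pi> that by (simp add: raws_def)
  qed (rule countable_raws)
qed (rule countable_raws)

lemma kernel_raw_proc:
  assumes R: "\<forall>k lg. R k lg \<in> pols"
  shows "pmf_kernel prior raws (\<lambda>\<mu>. raw_proc \<mu> R l)"
proof (induction l)
  case 0
  show ?case unfolding raw_proc.simps by (rule pmf_kernel_const) (auto simp: countable_raws, simp add: raws_def)
next
  case (Suc l)
  show ?case unfolding raw_proc.simps
    by (rule pmf_kernel_bind[OF Suc kernel_raw_step[OF R] countable_raws])
qed

lemma set_raw_proc:
  assumes "\<forall>k lg. R k lg \<in> pols" "valid \<mu>"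
  shows "set_pmf (raw_proc \<mu> R l) \<subseteq> raws"
  using kernel_raw_proc[of R l] assms by (auto simp: pmf_kernel_def space_prior)

lemma length_raw_proc: "raw \<in> set_pmf (raw_proc \<mu> R l) \<Longrightarrow> length raw = l"
  by (induction l arbitrary: raw) (auto simp: raw_step_def)

lemma choice_erase:
  assumes "raw_ok raw"
  shows "choice R l (erase raw) = choice R l raw"
  using assms by (simp add: choice_def hal_pmf_erase)

text \<open>This weight does not depend on the model, because hallucinated signals are drawn from the
  totally censored ledger; that is what makes posteriors given an honest ledger canonical.\<close>

definition choice_weight :: "(nat \<Rightarrow> ledger \<Rightarrow> policy) \<Rightarrow> (policy \<times> traj) list \<Rightarrow> real" where
  "choice_weight R z = (\<Prod>j<length z. pmf (choice R j (take j z)) (fst (z ! j)))"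

lemma choice_weight_nonneg [simp]: "0 \<le> choice_weight R z"
  by (simp add: choice_weight_def prod_nonneg)

lemma choice_weight_snoc: "choice_weight R (z @ [(\<pi>, \<tau>)]) = choice_weight R z * pmf (choice R (length z) z) \<pi>"
  by (simp add: choice_weight_def nth_append)

text \<open>The chain rule over phases. The policy at each phase depends on the past only through
  its erasure, which \<open>f\<close> preserves, so the choice probabilities are constant on all raw
  ledgers with a given image and come out as one factor. The instances are
  \<open>censor_traj U\<close> and \<open>erase_traj\<close>.\<close>

lemma pmf_raw_proc_map:
  fixes f :: "traj \<Rightarrow> (nat \<times> nat \<times> 'r) list"
  assumes R: "\<forall>k lg. R k lg \<in> pols" and \<mu>: "valid \<mu>" and f: "\<And>\<tau>. erase_traj (f \<tau>) = erase_traj \<tau>"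
  shows "pmf (map_pmf (map (apsnd f)) (raw_proc \<mu> R l)) es =
    (if length es = l then choice_weight R (erase es) *
       prod_list (map (\<lambda>(\<pi>, c). pmf (map_pmf f (traj_pmf H \<mu> \<pi>)) c) es) else 0)"
proof (induction l arbitrary: es)
  case 0
  show ?case by (auto simp: choice_weight_def)
next
  case (Suc l)
  have erase_map: "erase (map (apsnd f) raw) = erase raw" for raw
    by (induction raw) (auto simp: f)
  show ?case
  proof (cases "length es = Suc l")
    case False
    have "es \<notin> set_pmf (map_pmf (map (apsnd f)) (raw_proc \<mu> R (Suc l)))"
      using False length_raw_proc[of _ \<mu> R "Suc l"] by (auto simp del: raw_proc.simps)
    then show ?thesis using False by (simp add: pmf_eq_0_set_pmf del: raw_proc.simps)
  next
    case True
    then obtain es' \<pi> c where es: "es = es' @ [(\<pi>, c)]" "length es' = l"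
      by (cases es rule: rev_cases) auto
    let ?K = "pmf (choice R l (erase es')) \<pi> * pmf (map_pmf f (traj_pmf H \<mu> \<pi>)) c"
    have step: "pmf (map_pmf (map (apsnd f)) (raw_step \<mu> R l raw)) es = indicator {raw. map (apsnd f) raw = es'} raw * ?K"
      if raw: "raw \<in> set_pmf (raw_proc \<mu> R l)" for raw
    proof -
      let ?B = "bind_pmf (choice R l raw) (\<lambda>\<pi>. map_pmf (Pair \<pi>) (map_pmf f (traj_pmf H \<mu> \<pi>)))"
      have eq: "map_pmf (map (apsnd f)) (raw_step \<mu> R l raw) = map_pmf (\<lambda>p. map (apsnd f) raw @ [p]) ?B"
        by (simp add: raw_step_def map_bind_pmf map_pmf_comp)
      show ?thesis
      proof (cases "map (apsnd f) raw = es'")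
        case True
        have "raw_ok raw" using set_raw_proc[OF R \<mu>] raw by (intro raws_ok) auto
        then have "choice R l raw = choice R l (erase es')"
          using choice_erase[of raw R l] erase_map[of raw] True by simp
        moreover have "pmf (map_pmf (\<lambda>p. es' @ [p]) ?B) (es' @ [(\<pi>, c)]) = pmf ?B (\<pi>, c)"
          by (rule pmf_map_inj') (auto simp: inj_def)
        ultimately show ?thesis using True unfolding eq es by (simp add: pmf_bind_map_Pair)
      next
        case False
        then have "es \<notin> set_pmf (map_pmf (\<lambda>p. map (apsnd f) raw @ [p]) ?B)" by (auto simp: es)
        then have "pmf (map_pmf (\<lambda>p. map (apsnd f) raw @ [p]) ?B) es = 0" unfolding pmf_eq_0_set_pmf .
        then show ?thesis unfolding eq using False by simp
      qed
    qed
    have "pmf (map_pmf (map (apsnd f)) (raw_proc \<mu> R (Suc l))) es =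
      (\<integral>raw. pmf (map_pmf (map (apsnd f)) (raw_step \<mu> R l raw)) es \<partial>raw_proc \<mu> R l)"
      by (simp add: map_bind_pmf pmf_bind)
    also have "\<dots> = (\<integral>raw. indicator {raw. map (apsnd f) raw = es'} raw * ?K \<partial>raw_proc \<mu> R l)"
      by (intro integral_cong_AE) (auto simp: AE_measure_pmf_iff step)
    also have "\<dots> = pmf (map_pmf (map (apsnd f)) (raw_proc \<mu> R l)) es' * ?K"
      by (simp add: pmf_map vimage_def)
    finally show ?thesis unfolding Suc es by (simp add: choice_weight_snoc es)
  qed
qed

lemma pmf_raw_proc_censor:
  assumes "\<forall>k lg. R k lg \<in> pols" "valid \<mu>"
  shows "pmf (map_pmf (censor_list U) (raw_proc \<mu> R l)) es =
    (if length es = l then choice_weight R (erase es) * lik H (U, es) \<mu> else 0)"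
proof -
  have "censor_list U = map (apsnd (censor_traj U))"
    by (auto simp: censor_list_def fun_eq_iff)
  then show ?thesis using pmf_raw_proc_map[OF assms, of "censor_traj U" l es] by (simp add: lik_def)
qed

lemma pmf_raw_proc_erase:
  assumes "\<forall>k lg. R k lg \<in> pols" "valid \<mu>"
  shows "pmf (map_pmf erase (raw_proc \<mu> R l)) (erase es) =
    (if length es = l then choice_weight R (erase es) * erased_lik H es \<mu> else 0)"
proof -
  have e: "erase = map (apsnd erase_traj)"
    by (auto simp: erase_def fun_eq_iff)
  have "prod_list (map (\<lambda>(\<pi>, c). pmf (map_pmf erase_traj (traj_pmf H \<mu> \<pi>)) c) (erase es)) = erased_lik H es \<mu>"
    by (induction es) auto
  then show ?thesis using pmf_raw_proc_map[OF assms, of erase_traj l "erase es"] unfolding e[symmetric] by simp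
qed

text \<open>The censoring set is itself a function of states and actions, so it can be recovered
  from \<open>es\<close>: either it disagrees with \<open>U\<close> and the ledger is impossible, or
  the data-dependent censoring coincides with censoring by the fixed set \<open>U\<close>.\<close>

lemma pmf_hon:
  assumes "\<forall>k lg. R k lg \<in> pols" "valid \<mu>"
  shows "pmf (map_pmf hon (raw_proc \<mu> R l)) (U, es) =
    (if length es = l \<and> U = UE (erase es) then choice_weight R (erase es) * lik H (U, es) \<mu> else 0)"
proof (cases "U = UE (erase es)")
  case True
  have "hon raw = (U, es) \<longleftrightarrow> censor_list U raw = es" for raw
    using True by (metis censor_raw_eq erase_censor_list under_explored_erase prod.inject)
  then have "pmf (map_pmf hon (raw_proc \<mu> R l)) (U, es) = pmf (map_pmf (censor_list U) (raw_proc \<mu> R l)) es"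
    by (simp add: pmf_map vimage_def)
  then show ?thesis using True pmf_raw_proc_censor[OF assms] by simp
next
  case False
  have "(U, es) \<noteq> hon raw" for raw
    using False by (metis censor_raw_eq erase_censor_list under_explored_erase prod.inject)
  then have "(U, es) \<notin> set_pmf (map_pmf hon (raw_proc \<mu> R l))" by auto
  then show ?thesis using False unfolding pmf_eq_0_set_pmf[symmetric] by simp
qed

end

section \<open>The law of the hallucinated ledger and the agents' choices\<close>

context hidden_hallucination begin

abbreviation rule_ok :: "(nat \<Rightarrow> ledger \<Rightarrow> policy) \<Rightarrow> bool" where
  "rule_ok R \<equiv> \<forall>k lg. R k lg \<in> pols"

definition hal_proc :: "model \<Rightarrow> (nat \<Rightarrow> ledger \<Rightarrow> policy) \<Rightarrow> nat \<Rightarrow> ledger pmf" where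
  "hal_proc \<mu> R l = bind_pmf (raw_proc \<mu> R l) hal"

definition hon_proc :: "model \<Rightarrow> (nat \<Rightarrow> ledger \<Rightarrow> policy) \<Rightarrow> nat \<Rightarrow> ledger pmf" where
  "hon_proc \<mu> R l = map_pmf hon (raw_proc \<mu> R l)"

text \<open>One countable support for both the honest and the hallucinated ledger, so that the two
  can be compared outcome by outcome after exchanging integrals.\<close>

definition signals :: "ledger set" where
  "signals = hon ` raws \<union> (\<Union>raw\<in>raws. set_pmf (hal raw))"

lemma countable_signals: "countable signals"
  unfolding signals_def by (auto intro!: countable_raws)

lemma kernel_hal_proc: "rule_ok R \<Longrightarrow> pmf_kernel prior signals (\<lambda>\<mu>. hal_proc \<mu> R l)"
  unfolding hal_proc_def
  by (rule pmf_kernel_bind[OF kernel_raw_proc pmf_kernel_const])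
     (auto simp: countable_signals, auto simp: signals_def)

lemma kernel_hon_proc: "rule_ok R \<Longrightarrow> pmf_kernel prior signals (\<lambda>\<mu>. hon_proc \<mu> R l)"
  unfolding hon_proc_def
  by (rule pmf_kernel_map[OF kernel_raw_proc])
     (auto simp: countable_signals, auto simp: signals_def)

lemma pmf_raw_proc_support:
  assumes "rule_ok R" "valid \<mu>" "raw \<in> set_pmf (raw_proc \<mu> R l)"
  shows "0 < choice_weight R (erase raw)" "0 < erased_lik H raw \<mu>"
proof -
  have "erase raw \<in> set_pmf (map_pmf erase (raw_proc \<mu> R l))" using assms(3) by auto
  then have "pmf (map_pmf erase (raw_proc \<mu> R l)) (erase raw) \<noteq> 0" unfolding set_pmf_iff .
  then have "choice_weight R (erase raw) * erased_lik H raw \<mu> \<noteq> 0"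
    using pmf_raw_proc_erase[OF assms(1,2), of l raw] by (auto split: if_splits)
  then show "0 < choice_weight R (erase raw)" "0 < erased_lik H raw \<mu>"
    using choice_weight_nonneg[of R "erase raw"] erased_lik_nonneg[of H raw \<mu>] by (auto simp: less_le)
qed

text \<open>\<open>hal_pmf\<close> divides by a posterior mass, which vanishes on data of evidence
  0. Such data has likelihood 0 in almost every model; as there are only countably many raw ledgers,
  one null set of models covers them all.\<close>

lemma AE_raw_evidence:
  assumes R: "rule_ok R"
  shows "AE \<mu> in prior. \<forall>raw\<in>set_pmf (raw_proc \<mu> R l). 0 < (\<integral>\<nu>. erased_lik H raw \<nu> \<partial>prior)"
proof -
  have "AE \<mu> in prior. \<forall>raw\<in>raws. 0 < (\<integral>\<nu>. erased_lik H raw \<nu> \<partial>prior) \<or> erased_lik H raw \<mu> = 0"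
    unfolding AE_ball_countable[OF countable_raws]
  proof
    fix raw assume "raw \<in> raws"
    then have ok: "raw_ok raw" by (rule raws_ok)
    show "AE \<mu> in prior. 0 < (\<integral>\<nu>. erased_lik H raw \<nu> \<partial>prior) \<or> erased_lik H raw \<mu> = 0"
    proof (cases "(\<integral>\<nu>. erased_lik H raw \<nu> \<partial>prior) = 0")
      case True
      then have "AE \<mu> in prior. erased_lik H raw \<mu> = 0"
        using integral_nonneg_eq_0_iff_AE[OF integrable_erased_lik[OF ok]] by simp
      then show ?thesis by eventually_elim simp
    next
      case False
      then have "0 < (\<integral>\<nu>. erased_lik H raw \<nu> \<partial>prior)"
        using integral_nonneg_prior[of "erased_lik H raw"] by (simp add: less_le)
      then show ?thesis by simp
    qed
  qed
  moreover have "AE \<mu> in prior. valid \<mu>" by (auto simp: space_prior intro!: AE_I2)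
  ultimately show ?thesis
  proof eventually_elim
    case (elim \<mu>)
    show ?case
    proof
      fix raw assume raw: "raw \<in> set_pmf (raw_proc \<mu> R l)"
      then have "raw \<in> raws" using set_raw_proc[OF R elim(2)] by auto
      with elim(1) pmf_raw_proc_support(2)[OF R elim(2) raw] show "0 < (\<integral>\<nu>. erased_lik H raw \<nu> \<partial>prior)"
        by auto
    qed
  qed
qed

text \<open>The conditional mass of the visible rewards in \<open>es\<close>, given its states and
  actions, under the punished posterior.\<close>

definition hal_weight :: "triple set \<Rightarrow> (policy \<times> ctraj) list \<Rightarrow> real" where
  "hal_weight U es = (\<integral>\<mu>. lik H (U, es) \<mu> * pun_ind e U \<mu> \<partial>prior) / (\<integral>\<mu>. erased_lik H es \<mu> * pun_ind e U \<mu> \<partial>prior)"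

lemma hal_weight_nonneg [simp]: "0 \<le> hal_weight U es"
  unfolding hal_weight_def by (intro divide_nonneg_nonneg integral_nonneg_prior) auto

lemma erased_lik_cong: "erase rs = erase rs' \<Longrightarrow> erased_lik H rs = erased_lik H rs'"
  by (metis erased_lik_erase ext)

lemma under_explored_cong: "erase rs = erase rs' \<Longrightarrow> UE rs = UE rs'"
  by (metis under_explored_erase)

end

locale punishable = hidden_hallucination +
  assumes q_pos: "0 < q_pun S A H prior e"
begin

abbreviation q :: real where "q \<equiv> q_pun S A H prior e"

lemma pun_mass_pos:
  assumes "raw_ok rs" "0 < (\<integral>\<mu>. erased_lik H rs \<mu> \<partial>prior)"
  shows "0 < (\<integral>\<mu>. erased_lik H rs \<mu> * pun_ind e U \<mu> \<partial>prior)"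
  using q_pun_le[OF assms(1), of e U] mult_pos_pos[OF q_pos assms(2)] by linarith

lemma pmf_hal:
  assumes "raw_ok raw" "0 < (\<integral>\<mu>. erased_lik H raw \<mu> \<partial>prior)"
  shows "pmf (hal raw) (U, es) = (if U = UE (erase es) \<and> erase es = erase raw then hal_weight U es else 0)"
proof -
  have "pmf (hal raw) (U, es) = (if U = UE raw \<and> erase es = erase raw
     then (\<integral>\<mu>. lik H (UE raw, es) \<mu> * pun_ind e (UE raw) \<mu> \<partial>prior) / (\<integral>\<mu>. erased_lik H raw \<mu> * pun_ind e (UE raw) \<mu> \<partial>prior) else 0)"
    by (rule pmf_hal_pmf[OF assms(1) pun_mass_pos[OF assms]])
  moreover have "UE (erase es) = UE raw" "erased_lik H es = erased_lik H raw" if "erase es = erase raw"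
    using under_explored_cong[of "erase es" raw] erased_lik_cong[OF that] that by auto
  ultimately show ?thesis by (auto simp: hal_weight_def)
qed

text \<open>Given the erased data, the hallucinated rewards are drawn without reference to the true
  model, so \<open>\<mu>\<close> survives only in \<open>erased_lik\<close>. The claim is made
  almost everywhere because it relies on positive evidence.\<close>

lemma pmf_hal_proc:
  assumes R: "rule_ok R"
  shows "AE \<mu> in prior. pmf (hal_proc \<mu> R l) (U, es) =
    (if length es = l \<and> U = UE (erase es)
     then hal_weight U es * (choice_weight R (erase es) * erased_lik H es \<mu>) else 0)"
  using AE_raw_evidence[OF R, of l] AE_space
proof eventually_elim
  case (elim \<mu>)
  have \<mu>: "valid \<mu>" using elim(2) by (simp add: space_prior)
  have "pmf (hal_proc \<mu> R l) (U, es) = (\<integral>raw. pmf (hal raw) (U, es) \<partial>raw_proc \<mu> R l)"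
    by (simp add: hal_proc_def pmf_bind)
  also have "\<dots> = (\<integral>raw. indicator {raw. erase raw = erase es} raw * (if U = UE (erase es) then hal_weight U es else 0) \<partial>raw_proc \<mu> R l)"
  proof (intro integral_cong_AE)
    show "AE raw in raw_proc \<mu> R l. pmf (hal raw) (U, es) =
      indicator {raw. erase raw = erase es} raw * (if U = UE (erase es) then hal_weight U es else 0)"
      unfolding AE_measure_pmf_iff
    proof
      fix raw assume raw: "raw \<in> set_pmf (raw_proc \<mu> R l)"
      then have "raw_ok raw" using set_raw_proc[OF R \<mu>] by (intro raws_ok) auto
      then show "pmf (hal raw) (U, es) =
         indicator {raw. erase raw = erase es} raw * (if U = UE (erase es) then hal_weight U es else 0)"
        using elim(1) raw by (auto simp: pmf_hal indicator_def)
    qed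
  qed auto
  also have "\<dots> = pmf (map_pmf erase (raw_proc \<mu> R l)) (erase es) * (if U = UE (erase es) then hal_weight U es else 0)"
    by (simp add: pmf_map vimage_def)
  finally show ?case using pmf_raw_proc_erase[OF R \<mu>, of l es] by auto
qed

text \<open>Ill-shaped data is never produced, so the product formula for its probability must
  vanish, although its factors are defined for arbitrary lists.\<close>

lemma choice_weight_lik_zero:
  assumes "rule_ok R" "valid \<mu>" "\<not> raw_ok es"
  shows "choice_weight R (erase es) * erased_lik H es \<mu> = 0"
proof -
  have "erase es \<notin> set_pmf (map_pmf erase (raw_proc \<mu> R (length es)))"
  proof
    assume "erase es \<in> set_pmf (map_pmf erase (raw_proc \<mu> R (length es)))"
    then obtain raw where "raw \<in> raws" "erase es = erase raw" using set_raw_proc[OF assms(1,2)] by auto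
    then show False using raws_ok[of raw] raw_ok_cong[of es raw] assms(3) by simp
  qed
  then show ?thesis using pmf_raw_proc_erase[OF assms(1,2), of "length es" es]
    by (simp only: pmf_eq_0_set_pmf[symmetric] if_True simp_thms)
qed

text \<open>By \<open>q_pun_le\<close> the denominator of \<open>hal_weight\<close> is at least
  \<open>q\<close> times the evidence of the erased data. The factors \<open>1 / q\<close> in the
  quantitative bounds come from here.\<close>

lemma hal_weight_le:
  assumes "raw_ok es"
  shows "hal_weight U es * (\<integral>\<mu>. erased_lik H es \<mu> \<partial>prior) \<le>
    1 / q * (\<integral>\<mu>. lik H (U, es) \<mu> * pun_ind e U \<mu> \<partial>prior)"
proof (cases "(\<integral>\<mu>. erased_lik H es \<mu> \<partial>prior) = 0")
  case True
  then show ?thesis using q_pos by (auto intro!: integral_nonneg_prior)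
next
  case False
  let ?E = "\<integral>\<mu>. erased_lik H es \<mu> \<partial>prior" and ?D = "\<integral>\<mu>. erased_lik H es \<mu> * pun_ind e U \<mu> \<partial>prior"
    and ?L = "\<integral>\<mu>. lik H (U, es) \<mu> * pun_ind e U \<mu> \<partial>prior"
  have E: "0 < ?E" using False integral_nonneg_prior[of "erased_lik H es"] by (simp add: less_le)
  have D: "0 < ?D" by (rule pun_mass_pos[OF assms E])
  have L: "0 \<le> ?L" by (rule integral_nonneg_prior) auto
  have "?L * (q * ?E) \<le> ?L * ?D" by (rule mult_left_mono[OF q_pun_le[OF assms] L])
  then show ?thesis using E D q_pos unfolding hal_weight_def by (simp add: field_simps)
qed

text \<open>Averaging over the prior turns \<open>erased_lik\<close> in the hallucinated law into
  the evidence, which \<open>hal_weight_le\<close> cancels; the factor \<open>choice_weight\<close>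
  is common to both sides. Outside the ledgers that can arise, the left side is 0.\<close>

lemma hal_proc_le:
  assumes R: "rule_ok R"
  shows "(\<integral>\<mu>. pmf (hal_proc \<mu> R l) (U, es) \<partial>prior) \<le> 1 / q * (\<integral>\<mu>. pun_ind e U \<mu> * pmf (hon_proc \<mu> R l) (U, es) \<partial>prior)"
proof -
  let ?c = "choice_weight R (erase es)"
  have hal: "(\<integral>\<mu>. pmf (hal_proc \<mu> R l) (U, es) \<partial>prior) = (\<integral>\<mu>. (if length es = l \<and> U = UE (erase es)
     then hal_weight U es * (?c * erased_lik H es \<mu>) else 0) \<partial>prior)" if "raw_ok es"
    using that
    by (intro integral_cong_AE pmf_hal_proc[OF R] pmf_kernel_pmf[OF kernel_hal_proc[OF R]]) auto
  have hon: "(\<integral>\<mu>. pun_ind e U \<mu> * pmf (hon_proc \<mu> R l) (U, es) \<partial>prior) =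
     (\<integral>\<mu>. (if length es = l \<and> U = UE (erase es) then ?c * (lik H (U, es) \<mu> * pun_ind e U \<mu>) else 0) \<partial>prior)"
    unfolding hon_proc_def by (intro integral_cong_prior) (auto simp: pmf_hon[OF R])
  show ?thesis
  proof (cases "raw_ok es \<and> length es = l \<and> U = UE (erase es)")
    case True
    then show ?thesis
      using mult_left_mono[OF hal_weight_le[of es U], of ?c] unfolding hon hal[OF conjunct1[OF True]] by (simp add: mult_ac)
  next
    case False
    have "(\<integral>\<mu>. pmf (hal_proc \<mu> R l) (U, es) \<partial>prior) = (\<integral>\<mu>. 0 \<partial>prior)"
    proof (intro integral_cong_AE pmf_kernel_pmf[OF kernel_hal_proc[OF R]])
      show "AE \<mu> in prior. pmf (hal_proc \<mu> R l) (U, es) = 0"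
        using pmf_hal_proc[OF R, of l U es] AE_space
        by eventually_elim (use False choice_weight_lik_zero[OF R, of _ es] in \<open>auto simp: space_prior\<close>)
    qed simp
    moreover have "0 \<le> (\<integral>\<mu>. pun_ind e U \<mu> * pmf (hon_proc \<mu> R l) (U, es) \<partial>prior)"
      by (rule integral_nonneg_prior) auto
    ultimately show ?thesis using q_pos by simp
  qed
qed

lemma nn_integral_hal_proc_le:
  assumes R: "rule_ok R"
  shows "(\<integral>\<^sup>+\<mu>. ennreal (pmf (hal_proc \<mu> R l) (U, es)) \<partial>prior) \<le>
    ennreal (1 / q) * (\<integral>\<^sup>+\<mu>. ennreal (pun_ind e U \<mu> * pmf (hon_proc \<mu> R l) (U, es)) \<partial>prior)"
proof -
  have [measurable]: "(\<lambda>\<mu>. pmf (hal_proc \<mu> R l) (U, es)) \<in> borel_measurable prior"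
      "(\<lambda>\<mu>. pmf (hon_proc \<mu> R l) (U, es)) \<in> borel_measurable prior"
    by (rule pmf_kernel_pmf[OF kernel_hal_proc[OF R]], rule pmf_kernel_pmf[OF kernel_hon_proc[OF R]])
  have "(\<integral>\<^sup>+\<mu>. ennreal (pmf (hal_proc \<mu> R l) (U, es)) \<partial>prior) = ennreal (\<integral>\<mu>. pmf (hal_proc \<mu> R l) (U, es) \<partial>prior)"
    by (intro nn_integral_eq_integral integrable_bounded[where B=1]) (auto simp: pmf_le_1)
  also have "\<dots> \<le> ennreal (1 / q * (\<integral>\<mu>. pun_ind e U \<mu> * pmf (hon_proc \<mu> R l) (U, es) \<partial>prior))"
    by (intro ennreal_leI hal_proc_le R)
  also have "\<dots> = ennreal (1 / q) * ennreal (\<integral>\<mu>. pun_ind e U \<mu> * pmf (hon_proc \<mu> R l) (U, es) \<partial>prior)"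
    using q_pos by (intro ennreal_mult integral_nonneg_prior) auto
  also have "ennreal (\<integral>\<mu>. pun_ind e U \<mu> * pmf (hon_proc \<mu> R l) (U, es) \<partial>prior) =
      (\<integral>\<^sup>+\<mu>. ennreal (pun_ind e U \<mu> * pmf (hon_proc \<mu> R l) (U, es)) \<partial>prior)"
  proof (intro nn_integral_eq_integral[symmetric] integrable_bounded[where B=1])
    show "(\<lambda>\<mu>. pun_ind e U \<mu> * pmf (hon_proc \<mu> R l) (U, es)) \<in> borel_measurable prior"
      using pun_ind_measurable[of e U] by (intro borel_measurable_times) auto
  qed (auto simp: pmf_le_1)
  finally show ?thesis .
qed

text \<open>Given the censored ledger, the joint law of the hallucinated model and ledger is the law of
  the true model and honest ledger conditioned on the punish event, hence dominated by
  \<open>1 / q\<close> times the honest law.\<close>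

lemma hal_proc_bad:
  assumes R: "rule_ok R" and c: "0 \<le> c" and \<beta>: "0 \<le> \<beta>"
    and G: "\<And>lg. Measurable.pred prior (\<lambda>\<mu>. G \<mu> lg)"
    and Bad: "\<And>U es. (U, es) \<in> Bad \<Longrightarrow> raw_ok es \<Longrightarrow>
       (\<integral>\<mu>. pun_ind e U \<mu> * lik H (U, es) \<mu> \<partial>prior) \<le> c * (\<integral>\<mu>. (if G \<mu> (U, es) then 1 else 0) * lik H (U, es) \<mu> \<partial>prior)"
    and hon: "\<And>\<mu>. valid \<mu> \<Longrightarrow> measure_pmf.prob (hon_proc \<mu> R l) {lg. G \<mu> lg} \<le> \<beta>"
  shows "(\<integral>\<mu>. measure_pmf.prob (hal_proc \<mu> R l) Bad \<partial>prior) \<le> c * \<beta> / q"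
proof -
  have Gm[measurable]: "Measurable.pred prior (\<lambda>\<mu>. G \<mu> lg)" for lg by (rule G)
  have pm[measurable]: "(\<lambda>\<mu>. pmf (hal_proc \<mu> R l) lg) \<in> borel_measurable prior"
      "(\<lambda>\<mu>. pmf (hon_proc \<mu> R l) lg) \<in> borel_measurable prior" for lg
    by (rule pmf_kernel_pmf[OF kernel_hal_proc[OF R]], rule pmf_kernel_pmf[OF kernel_hon_proc[OF R]])
  \<comment> \<open>For a single ledger \<open>choice_weight\<close> is a common factor of both
    sides, so the hypothesis on \<open>Bad\<close> can be applied to bare likelihoods. Ledgers that
    the process cannot produce have mass 0.\<close>
  have pointwise: "(\<integral>\<^sup>+\<mu>. ennreal (pmf (hal_proc \<mu> R l) lg) * indicator Bad lg \<partial>prior) \<le>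
      ennreal (c / q) * (\<integral>\<^sup>+\<mu>. ennreal (pmf (hon_proc \<mu> R l) lg) * indicator {\<mu>. G \<mu> lg} \<mu> \<partial>prior)" for lg
  proof (cases "lg \<in> Bad")
    case True
    obtain U es where lg: "lg = (U, es)" by (cases lg)
    show ?thesis
    proof (cases "raw_ok es \<and> length es = l \<and> U = UE (erase es)")
      case ok: True
      let ?w = "choice_weight R (erase es)"
      have hon_eq: "pmf (hon_proc \<mu> R l) lg = ?w * lik H (U, es) \<mu>" if "valid \<mu>" for \<mu>
        using pmf_hon[OF R that, of l U es] ok by (simp add: hon_proc_def lg)
      have "(\<integral>\<^sup>+\<mu>. ennreal (pun_ind e U \<mu> * pmf (hon_proc \<mu> R l) (U, es)) \<partial>prior) =
          (\<integral>\<^sup>+\<mu>. ennreal (?w * (lik H (U, es) \<mu> * pun_ind e U \<mu>)) \<partial>prior)"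
        by (intro nn_integral_cong) (auto simp: space_prior hon_eq[unfolded lg])
      also have "\<dots> = ennreal (?w * (\<integral>\<mu>. lik H (U, es) \<mu> * pun_ind e U \<mu> \<partial>prior))"
        using ok by (subst nn_integral_eq_integral)
           (auto intro!: integrable_mult_right integrable_lik_times[OF _ pun_ind_measurable, where B=1])
      also have "\<dots> \<le> ennreal (c * (?w * (\<integral>\<mu>. lik H (U, es) \<mu> * (if G \<mu> (U, es) then 1 else 0) \<partial>prior)))"
        using mult_left_mono[OF Bad[of U es], of ?w] True ok by (intro ennreal_leI) (simp add: lg mult_ac)
      also have "\<dots> = ennreal c * ennreal (?w * (\<integral>\<mu>. lik H (U, es) \<mu> * (if G \<mu> (U, es) then 1 else 0) \<partial>prior))"
        using c by (rule ennreal_mult) (auto intro!: mult_nonneg_nonneg integral_nonneg_prior)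
      finally have 1: "(\<integral>\<^sup>+\<mu>. ennreal (pun_ind e U \<mu> * pmf (hon_proc \<mu> R l) (U, es)) \<partial>prior) \<le>
        ennreal c * ennreal (?w * (\<integral>\<mu>. lik H (U, es) \<mu> * (if G \<mu> (U, es) then 1 else 0) \<partial>prior))" .
      have "ennreal (?w * (\<integral>\<mu>. lik H (U, es) \<mu> * (if G \<mu> (U, es) then 1 else 0) \<partial>prior)) =
          (\<integral>\<^sup>+\<mu>. ennreal (?w * (lik H (U, es) \<mu> * (if G \<mu> (U, es) then 1 else 0))) \<partial>prior)"
        using ok by (subst nn_integral_eq_integral)
           (auto intro!: integrable_mult_right integrable_lik_times[where B=1])
      also have "\<dots> = (\<integral>\<^sup>+\<mu>. ennreal (pmf (hon_proc \<mu> R l) lg) * indicator {\<mu>. G \<mu> lg} \<mu> \<partial>prior)"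
        by (intro nn_integral_cong) (auto simp: space_prior hon_eq lg[symmetric] indicator_def)
      finally have 2: "ennreal (?w * (\<integral>\<mu>. lik H (U, es) \<mu> * (if G \<mu> (U, es) then 1 else 0) \<partial>prior)) =
        (\<integral>\<^sup>+\<mu>. ennreal (pmf (hon_proc \<mu> R l) lg) * indicator {\<mu>. G \<mu> lg} \<mu> \<partial>prior)" .
      have "(\<integral>\<^sup>+\<mu>. ennreal (pmf (hal_proc \<mu> R l) lg) * indicator Bad lg \<partial>prior) =
          (\<integral>\<^sup>+\<mu>. ennreal (pmf (hal_proc \<mu> R l) (U, es)) \<partial>prior)"
        using True by (simp add: lg)
      also have "\<dots> \<le> ennreal (1 / q) * (\<integral>\<^sup>+\<mu>. ennreal (pun_ind e U \<mu> * pmf (hon_proc \<mu> R l) (U, es)) \<partial>prior)"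
        by (rule nn_integral_hal_proc_le[OF R])
      also have "\<dots> \<le> ennreal (1 / q) * (ennreal c * (\<integral>\<^sup>+\<mu>. ennreal (pmf (hon_proc \<mu> R l) lg) * indicator {\<mu>. G \<mu> lg} \<mu> \<partial>prior))"
        using 1 unfolding 2 by (rule mult_left_mono) simp
      also have "\<dots> = ennreal (c / q) * (\<integral>\<^sup>+\<mu>. ennreal (pmf (hon_proc \<mu> R l) lg) * indicator {\<mu>. G \<mu> lg} \<mu> \<partial>prior)"
        using c q_pos by (simp add: mult.assoc[symmetric] ennreal_mult[symmetric])
      finally show ?thesis .
    next
      case False
      have "AE \<mu> in prior. ennreal (pmf (hal_proc \<mu> R l) lg) * indicator Bad lg = 0"
        using pmf_hal_proc[OF R, of l U es] AE_space
        by eventually_elim (use False choice_weight_lik_zero[OF R, of _ es] in \<open>auto simp: space_prior lg\<close>)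
      then have "(\<integral>\<^sup>+\<mu>. ennreal (pmf (hal_proc \<mu> R l) lg) * indicator Bad lg \<partial>prior) = (\<integral>\<^sup>+\<mu>. 0 \<partial>prior)"
        by (rule nn_integral_cong_AE)
      then show ?thesis by simp
    qed
  qed simp
  have "(\<integral>\<^sup>+\<mu>. emeasure (hal_proc \<mu> R l) Bad \<partial>prior) = (\<integral>\<^sup>+\<mu>. \<integral>\<^sup>+lg. indicator Bad lg \<partial>hal_proc \<mu> R l \<partial>prior)"
    by simp
  also have "\<dots> = (\<integral>\<^sup>+lg. \<integral>\<^sup>+\<mu>. ennreal (pmf (hal_proc \<mu> R l) lg) * indicator Bad lg \<partial>prior \<partial>count_space signals)"
    by (rule pmf_kernel_swap[OF kernel_hal_proc[OF R]]) simp
  also have "\<dots> \<le> (\<integral>\<^sup>+lg. ennreal (c / q) * (\<integral>\<^sup>+\<mu>. ennreal (pmf (hon_proc \<mu> R l) lg) * indicator {\<mu>. G \<mu> lg} \<mu> \<partial>prior) \<partial>count_space signals)"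
    by (intro nn_integral_mono pointwise)
  also have "\<dots> = ennreal (c / q) * (\<integral>\<^sup>+lg. \<integral>\<^sup>+\<mu>. ennreal (pmf (hon_proc \<mu> R l) lg) * indicator {\<mu>. G \<mu> lg} \<mu> \<partial>prior \<partial>count_space signals)"
    by (rule nn_integral_cmult) simp
  also have "(\<integral>\<^sup>+lg. \<integral>\<^sup>+\<mu>. ennreal (pmf (hon_proc \<mu> R l) lg) * indicator {\<mu>. G \<mu> lg} \<mu> \<partial>prior \<partial>count_space signals)
      = (\<integral>\<^sup>+\<mu>. \<integral>\<^sup>+lg. indicator {\<mu>. G \<mu> lg} \<mu> \<partial>hon_proc \<mu> R l \<partial>prior)"
    by (rule pmf_kernel_swap[OF kernel_hon_proc[OF R], symmetric]) (simp add: indicator_def)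
  also have "\<dots> \<le> (\<integral>\<^sup>+\<mu>. ennreal \<beta> \<partial>prior)"
  proof (intro nn_integral_mono)
    fix \<mu> assume "\<mu> \<in> space prior"
    then have \<mu>: "valid \<mu>" by (simp add: space_prior)
    have "(\<integral>\<^sup>+lg. indicator {\<mu>. G \<mu> lg} \<mu> \<partial>hon_proc \<mu> R l) = (\<integral>\<^sup>+lg. indicator {lg. G \<mu> lg} lg \<partial>hon_proc \<mu> R l)"
      by (intro nn_integral_cong) (auto simp: indicator_def)
    also have "\<dots> = emeasure (hon_proc \<mu> R l) {lg. G \<mu> lg}" by simp
    also have "\<dots> \<le> ennreal \<beta>"
      using hon[OF \<mu>] by (simp add: measure_pmf.emeasure_eq_measure ennreal_leI)
    finally show "(\<integral>\<^sup>+lg. indicator {\<mu>. G \<mu> lg} \<mu> \<partial>hon_proc \<mu> R l) \<le> ennreal \<beta>" .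
  qed
  also have "(\<integral>\<^sup>+\<mu>. ennreal \<beta> \<partial>prior) = ennreal \<beta>" by (simp add: emeasure_space_1)
  finally have le: "(\<integral>\<^sup>+\<mu>. emeasure (hal_proc \<mu> R l) Bad \<partial>prior) \<le> ennreal (c / q) * ennreal \<beta>"
    by (simp add: mult_left_mono)
  have "(\<integral>\<mu>. measure_pmf.prob (hal_proc \<mu> R l) Bad \<partial>prior) = enn2real (\<integral>\<^sup>+\<mu>. ennreal (measure_pmf.prob (hal_proc \<mu> R l) Bad) \<partial>prior)"
    using pmf_kernel_prob[OF kernel_hal_proc[OF R], of "\<lambda>\<mu> lg. lg \<in> Bad" l] by (intro integral_eq_nn_integral) auto
  also have "\<dots> \<le> enn2real (ennreal (c * \<beta> / q))"
    using le c \<beta> q_pos by (intro enn2real_mono) (auto simp: measure_pmf.emeasure_eq_measure ennreal_mult[symmetric])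
  finally show ?thesis using c \<beta> q_pos by simp
qed

end

section \<open>The agents' rules and their near-optimality for the honest posterior\<close>

context hidden_hallucination begin

abbreviation upto_rules :: "(policy set \<Rightarrow> policy) \<Rightarrow> nat \<Rightarrow> nat \<Rightarrow> ledger \<Rightarrow> policy" where
  "upto_rules tb \<equiv> rules_upto S A H prior tb N n e"
abbreviation rules :: "(policy set \<Rightarrow> policy) \<Rightarrow> nat \<Rightarrow> ledger \<Rightarrow> policy" where
  "rules tb \<equiv> hh_rules S A H prior tb N n e"

text \<open>There are finitely many policies, so the maximum is attained and the tie-breaking
  function is applied to a nonempty set.\<close>

lemma agent_rule_argmax:
  assumes tb: "\<forall>X. X \<noteq> {} \<longrightarrow> tb X \<in> X"
  shows "agent_rule S A H prior tb N n e R k lg \<in> pols \<and> (\<forall>\<pi>'\<in>pols.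
     sig_weight S A H prior N n e R k lg \<pi>' \<le> sig_weight S A H prior N n e R k lg (agent_rule S A H prior tb N n e R k lg))"
proof -
  let ?w = "sig_weight S A H prior N n e R k lg"
  have zero: "(\<lambda>x h. 0) \<in> pols" using pos by (auto simp: policies_def)
  then have "Max (?w ` pols) \<in> ?w ` pols" using finite_policies[of S A H] by (intro Max_in) auto
  then obtain \<pi> where \<pi>: "\<pi> \<in> pols" "?w \<pi> = Max (?w ` pols)" by auto
  then have "\<pi> \<in> {\<pi> \<in> pols. \<forall>\<pi>'\<in>pols. ?w \<pi>' \<le> ?w \<pi>}" using finite_policies[of S A H] by auto
  then have "{\<pi> \<in> pols. \<forall>\<pi>'\<in>pols. ?w \<pi>' \<le> ?w \<pi>} \<noteq> {}" by blast
  from tb[rule_format, OF this] have "agent_rule S A H prior tb N n e R k lg \<in> {\<pi> \<in> pols. \<forall>\<pi>'\<in>pols. ?w \<pi>' \<le> ?w \<pi>}"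
    unfolding agent_rule_def .
  then show ?thesis by blast
qed

lemma upto_rules_ok: "\<forall>X. X \<noteq> {} \<longrightarrow> tb X \<in> X \<Longrightarrow> rule_ok (upto_rules tb k)"
  using pos by (induction k) (auto simp: agent_rule_argmax, auto simp: policies_def)

lemma rules_ok: "\<forall>X. X \<noteq> {} \<longrightarrow> tb X \<in> X \<Longrightarrow> rule_ok (rules tb)"
  using upto_rules_ok[of tb] unfolding hh_rules_def by blast

lemma rules_eq_upto: "j < k \<Longrightarrow> upto_rules tb k j = rules tb j"
  by (induction k) (auto simp: hh_rules_def less_Suc_eq)

lemma rules_agent: "rules tb k = agent_rule S A H prior tb N n e (upto_rules tb k) k"
  by (simp add: hh_rules_def)

lemma Vpi_lik_integrable:
  assumes "\<pi> \<in> pols" "raw_ok es"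
  shows "integrable prior (\<lambda>\<mu>. lik H (U, es) \<mu> * Vpi H \<mu> \<pi>)" "integrable prior (\<lambda>\<mu>. erased_lik H es \<mu> * Vpi H \<mu> \<pi>)"
  using assms Vpi_bounds
  by (auto intro!: integrable_lik_times[where B="real H"] integrable_erased_lik_times[where B="real H"] Vpi_measurable)

end

context punishable begin

text \<open>The signal is hallucinated with weight \<open>1 / N\<close> and honest with weight
  \<open>1 - 1 / N\<close>. A hallucinated ledger informs about the model through states and actions
  only, whence \<open>erased_lik\<close> in the first integral. The factor
  \<open>choice_weight\<close> is common to all policies, so it drops out of the agent's
  comparison.\<close>

lemma sig_weight_eq:
  assumes tb: "\<forall>X. X \<noteq> {} \<longrightarrow> tb X \<in> X" and k: "k div N = length es" and es: "raw_ok es" "U = UE (erase es)"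
    and \<pi>: "\<pi> \<in> pols"
  shows "sig_weight S A H prior N n e (upto_rules tb k) k (U, es) \<pi> = choice_weight (rules tb) (erase es) *
     (1 / N * (hal_weight U es * (\<integral>\<mu>. erased_lik H es \<mu> * Vpi H \<mu> \<pi> \<partial>prior)) +
      (1 - 1 / N) * (\<integral>\<mu>. lik H (U, es) \<mu> * Vpi H \<mu> \<pi> \<partial>prior))"
proof -
  let ?R = "rules tb" and ?l = "length es" and ?c = "choice_weight (rules tb) (erase es)"
  have R: "rule_ok ?R" by (rule rules_ok[OF tb])
  have "?l * N \<le> k" using k by (metis div_times_less_eq_dividend)
  then have proc: "raw_proc \<mu> (upto_rules tb k) ?l = raw_proc \<mu> ?R ?l" for \<mu>
    by (intro raw_proc_cong rules_eq_upto) auto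
  have prob: "measure_pmf.prob (run_phases S A H prior N n e \<mu> (upto_rules tb k) (Suc (k div N))) {hs. fst (snd hs ! k) = (U, es)} =
     1 / N * pmf (hal_proc \<mu> ?R ?l) (U, es) + (1 - 1 / N) * pmf (hon_proc \<mu> ?R ?l) (U, es)" for \<mu>
  proof -
    have "measure_pmf.prob (run_phases S A H prior N n e \<mu> (upto_rules tb k) (Suc (k div N))) {hs. fst (snd hs ! k) = (U, es)} =
      pmf (map_pmf (\<lambda>hs. fst (snd hs ! k)) (run_phases S A H prior N n e \<mu> (upto_rules tb k) (Suc ?l))) (U, es)"
      by (simp add: pmf_map vimage_def k del: run_phases.simps)
    also have "\<dots> = (\<integral>raw. pmf (signal ?l k raw) (U, es) \<partial>raw_proc \<mu> ?R ?l)"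
      by (simp only: signal_run[OF k] proc pmf_bind)
    also have "\<dots> = (\<integral>raw. 1 / real N * pmf (hal raw) (U, es) + (1 - 1 / real N) * indicator (hon -` {(U, es)}) raw \<partial>raw_proc \<mu> ?R ?l)"
      by (intro Bochner_Integration.integral_cong refl) (simp add: pmf_signal[OF k] indicator_def eq_commute)
    also have "\<dots> = 1 / N * pmf (hal_proc \<mu> ?R ?l) (U, es) + (1 - 1 / N) * pmf (hon_proc \<mu> ?R ?l) (U, es)"
      unfolding hal_proc_def hon_proc_def pmf_bind pmf_map
      by (subst Bochner_Integration.integral_add; (intro integrable_mult_right measure_pmf.integrable_const_bound[where B=1])?)
         (auto simp: pmf_le_1)
    finally show ?thesis .
  qed
  have "sig_weight S A H prior N n e (upto_rules tb k) k (U, es) \<pi> =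
     (\<integral>\<mu>. Vpi H \<mu> \<pi> * (1 / N * pmf (hal_proc \<mu> ?R ?l) (U, es) + (1 - 1 / N) * pmf (hon_proc \<mu> ?R ?l) (U, es)) \<partial>prior)"
    by (simp only: sig_weight_def prob)
  also have "\<dots> = (\<integral>\<mu>. ?c * (1 / N * (hal_weight U es * (erased_lik H es \<mu> * Vpi H \<mu> \<pi>)) +
      (1 - 1 / N) * (lik H (U, es) \<mu> * Vpi H \<mu> \<pi>)) \<partial>prior)"
  proof (intro integral_cong_AE)
    show "(\<lambda>\<mu>. Vpi H \<mu> \<pi> * (1 / N * pmf (hal_proc \<mu> ?R ?l) (U, es) + (1 - 1 / N) * pmf (hon_proc \<mu> ?R ?l) (U, es))) \<in> borel_measurable prior"
      by (intro borel_measurable_times borel_measurable_add borel_measurable_const Vpi_measurable \<pi>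
          pmf_kernel_pmf[OF kernel_hal_proc[OF R]] pmf_kernel_pmf[OF kernel_hon_proc[OF R]])
    show "(\<lambda>\<mu>. ?c * (1 / N * (hal_weight U es * (erased_lik H es \<mu> * Vpi H \<mu> \<pi>)) +
      (1 - 1 / N) * (lik H (U, es) \<mu> * Vpi H \<mu> \<pi>))) \<in> borel_measurable prior"
      by (intro borel_measurable_times borel_measurable_add borel_measurable_const Vpi_measurable \<pi>
          lik_measurable erased_lik_measurable es)
    show "AE \<mu> in prior. Vpi H \<mu> \<pi> * (1 / N * pmf (hal_proc \<mu> ?R ?l) (U, es) + (1 - 1 / N) * pmf (hon_proc \<mu> ?R ?l) (U, es)) =
      ?c * (1 / N * (hal_weight U es * (erased_lik H es \<mu> * Vpi H \<mu> \<pi>)) + (1 - 1 / N) * (lik H (U, es) \<mu> * Vpi H \<mu> \<pi>))"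
      using pmf_hal_proc[OF R, of ?l U es] AE_space
    proof eventually_elim
      case (elim \<mu>)
      have hal: "pmf (hal_proc \<mu> ?R ?l) (U, es) = hal_weight U es * (?c * erased_lik H es \<mu>)"
        using elim(1) es(2) by (simp only: simp_thms if_True)
      have hon: "pmf (hon_proc \<mu> ?R ?l) (U, es) = ?c * lik H (U, es) \<mu>"
        using pmf_hon[OF R valid_space[OF elim(2)], where l="?l" and U=U and es=es] es(2) unfolding hon_proc_def by (simp only: simp_thms if_True)
      have "V * (a * (w * (c * x)) + b * (c * y)) = c * (a * (w * (x * V)) + b * (y * V))" for V a w c x b y :: real
        by (simp only: algebra_simps)
      then show ?case unfolding hal hon .
    qed
  qed
  also have "\<dots> = ?c * (1 / N * (hal_weight U es * (\<integral>\<mu>. erased_lik H es \<mu> * Vpi H \<mu> \<pi> \<partial>prior)) +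
      (1 - 1 / N) * (\<integral>\<mu>. lik H (U, es) \<mu> * Vpi H \<mu> \<pi> \<partial>prior))"
    using Vpi_lik_integrable(1)[OF \<pi> es(1), of U] Vpi_lik_integrable(2)[OF \<pi> es(1)]
    by (subst integral_mult_right_zero, subst Bochner_Integration.integral_add)
       (simp_all only: integral_mult_right_zero integrable_mult_right)
  finally show ?thesis .
qed

text \<open>After cancelling \<open>choice_weight\<close>, the hallucinated part of the agent's
  value is dropped for \<open>\<pi>\<close>, where it is nonnegative, and bounded for the chosen
  policy by \<open>H\<close> times its mass, which \<open>hal_weight_le\<close> compares with the
  evidence of the ledger read as honest.\<close>

lemma agent_near_optimal:
  assumes tb: "\<forall>X. X \<noteq> {} \<longrightarrow> tb X \<in> X" and k: "k div N = length es" and es: "raw_ok es" "U = UE (erase es)"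
    and c: "0 < choice_weight (rules tb) (erase es)" and \<pi>: "\<pi> \<in> pols"
  shows "(1 - 1 / N) * (\<integral>\<mu>. lik H (U, es) \<mu> * Vpi H \<mu> \<pi> \<partial>prior) \<le>
    (1 - 1 / N) * (\<integral>\<mu>. lik H (U, es) \<mu> * Vpi H \<mu> (rules tb k (U, es)) \<partial>prior) +
    H / (N * q) * (\<integral>\<mu>. lik H (U, es) \<mu> \<partial>prior)"
proof -
  let ?p = "rules tb k (U, es)"
  have p: "?p \<in> pols" using rules_ok[OF tb] by blast
  let ?V = "\<lambda>\<pi>. \<integral>\<mu>. lik H (U, es) \<mu> * Vpi H \<mu> \<pi> \<partial>prior"
  let ?W = "\<lambda>\<pi>. hal_weight U es * (\<integral>\<mu>. erased_lik H es \<mu> * Vpi H \<mu> \<pi> \<partial>prior)"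
  have "sig_weight S A H prior N n e (upto_rules tb k) k (U, es) \<pi> \<le> sig_weight S A H prior N n e (upto_rules tb k) k (U, es) ?p"
    using agent_rule_argmax[OF tb, of "upto_rules tb k" k "(U, es)"] \<pi> unfolding rules_agent by blast
  then have opt: "1 / N * ?W \<pi> + (1 - 1 / N) * ?V \<pi> \<le> 1 / N * ?W ?p + (1 - 1 / N) * ?V ?p"
    using c unfolding sig_weight_eq[OF tb k es \<pi>] sig_weight_eq[OF tb k es p] by simp
  have W: "0 \<le> ?W \<pi>"
    using Vpi_bounds \<pi> by (intro mult_nonneg_nonneg integral_nonneg_prior) auto
  have "?W ?p \<le> H / q * (\<integral>\<mu>. lik H (U, es) \<mu> \<partial>prior)"
  proof -
    have "(\<integral>\<mu>. erased_lik H es \<mu> * Vpi H \<mu> ?p \<partial>prior) \<le> (\<integral>\<mu>. erased_lik H es \<mu> * real H \<partial>prior)"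
      using Vpi_bounds p es Vpi_lik_integrable[OF p es(1)]
      by (intro integral_mono_prior) (auto intro!: mult_left_mono integrable_erased_lik)
    then have "?W ?p \<le> real H * (hal_weight U es * (\<integral>\<mu>. erased_lik H es \<mu> \<partial>prior))"
      using mult_left_mono[OF _ hal_weight_nonneg[of U es]] by (fastforce simp: mult_ac)
    also have "\<dots> \<le> real H * (1 / q * (\<integral>\<mu>. lik H (U, es) \<mu> * pun_ind e U \<mu> \<partial>prior))"
      by (intro mult_left_mono hal_weight_le es) auto
    also have "\<dots> \<le> real H * (1 / q * (\<integral>\<mu>. lik H (U, es) \<mu> \<partial>prior))"
      using q_pos es by (intro mult_left_mono integral_mono_prior integrable_lik_times[OF _ pun_ind_measurable, where B=1] integrable_lik) auto
    finally show ?thesis by simp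
  qed
  then have "1 / N * ?W ?p \<le> 1 / N * (H / q * (\<integral>\<mu>. lik H (U, es) \<mu> \<partial>prior))"
    by (intro mult_left_mono) simp_all
  also have "1 / N * (H / q * (\<integral>\<mu>. lik H (U, es) \<mu> \<partial>prior)) = H / (N * q) * (\<integral>\<mu>. lik H (U, es) \<mu> \<partial>prior)"
    by simp
  finally have up: "1 / N * ?W ?p \<le> H / (N * q) * (\<integral>\<mu>. lik H (U, es) \<mu> \<partial>prior)" .
  have low: "0 \<le> 1 / N * ?W \<pi>" by (intro mult_nonneg_nonneg[OF _ W]) simp
  have "y \<le> y' + b" if "x + y \<le> x' + y'" "x' \<le> b" "0 \<le> x" for x x' y y' b :: real
    using that by linarith
  from this[OF opt up low] show ?thesis .
qed

end

section \<open>Concentration of the empirical model\<close>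

text \<open>Stated for every real \<open>s\<close> and with the bound divided out, so that the
  exponential is the increment of a supermartingale.\<close>

lemma Hoeffding_pmf:
  fixes f :: "'a \<Rightarrow> real"
  assumes f: "\<And>x. x \<in> set_pmf p \<Longrightarrow> 0 \<le> f x \<and> f x \<le> 1"
  shows "(\<integral>\<^sup>+x. ennreal (exp (s * (f x - measure_pmf.expectation p f) - s\<^sup>2 / 8)) \<partial>measure_pmf p) \<le> 1"
proof -
  have key: "(\<integral>\<^sup>+x. ennreal (exp (s * (g x - measure_pmf.expectation p g))) \<partial>measure_pmf p) \<le> ennreal (exp (s\<^sup>2 / 8))"
    if "0 < s" and g: "\<And>x. x \<in> set_pmf p \<Longrightarrow> a \<le> g x \<and> g x \<le> a + 1" for s a :: real and g :: "'a \<Rightarrow> real"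
  proof -
    interpret interval_bounded_random_variable "measure_pmf p" g a "a + 1"
      by unfold_locales (auto simp: AE_measure_pmf_iff g)
    show ?thesis using Hoeffdings_lemma_nn_integral[OF \<open>0 < s\<close>] by simp
  qed
  have le: "(\<integral>\<^sup>+x. ennreal (exp (s * (f x - measure_pmf.expectation p f))) \<partial>measure_pmf p) \<le> ennreal (exp (s\<^sup>2 / 8))"
  proof (cases s "0::real" rule: linorder_cases)
    case greater
    then show ?thesis using key[of s 0 f] f by simp
  next
    case less
    \<comment> \<open>A negative \<open>s\<close> is reduced to a positive parameter by passing to
      \<open>- f\<close>, whose values lie in \<open>[-1, 0]\<close>.\<close>
    then show ?thesis using key[of "- s" "-1" "\<lambda>x. - f x"] f by (simp add: algebra_simps)
  qed simp
  have "(\<integral>\<^sup>+x. ennreal (exp (s * (f x - measure_pmf.expectation p f) - s\<^sup>2 / 8)) \<partial>measure_pmf p) =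
     (\<integral>\<^sup>+x. ennreal (exp (- (s\<^sup>2 / 8))) * ennreal (exp (s * (f x - measure_pmf.expectation p f))) \<partial>measure_pmf p)"
  proof (intro nn_integral_cong)
    have "ennreal (exp (u - v)) = ennreal (exp (- v)) * ennreal (exp u)" for u v :: real
      by (simp add: ennreal_mult[symmetric] exp_add[symmetric])
    then show "ennreal (exp (s * (f x - measure_pmf.expectation p f) - s\<^sup>2 / 8)) =
      ennreal (exp (- (s\<^sup>2 / 8))) * ennreal (exp (s * (f x - measure_pmf.expectation p f)))" for x .
  qed
  also have "\<dots> = ennreal (exp (- (s\<^sup>2 / 8))) * (\<integral>\<^sup>+x. ennreal (exp (s * (f x - measure_pmf.expectation p f))) \<partial>measure_pmf p)"
    by (rule nn_integral_cmult) simp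
  also have "\<dots> \<le> ennreal (exp (- (s\<^sup>2 / 8))) * ennreal (exp (s\<^sup>2 / 8))"
    by (intro mult_left_mono le) simp
  also have "\<dots> = 1" by (simp add: ennreal_mult[symmetric] exp_minus)
  finally show ?thesis .
qed

lemma nn_integral_pmf_le_1:
  assumes "\<And>x. x \<in> set_pmf p \<Longrightarrow> f x \<le> (1 :: ennreal)"
  shows "(\<integral>\<^sup>+x. f x \<partial>measure_pmf p) \<le> 1"
proof -
  have "(\<integral>\<^sup>+x. f x \<partial>measure_pmf p) \<le> (\<integral>\<^sup>+x. 1 \<partial>measure_pmf p)"
    using assms by (intro nn_integral_mono_AE) (auto simp: AE_measure_pmf_iff)
  then show ?thesis by simp
qed

text \<open>The Markov property: once \<open>(x, a)\<close> is reached at the given stage, the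
  reward is drawn afresh and contributes an expectation of at most 1; a trajectory that misses the
  triple contributes 1. The stage is part of the triple, so an episode has at most one
  visit.\<close>

lemma traj_steps_reward_le_1:
  assumes "(\<integral>\<^sup>+r. \<phi> r \<partial>mrew \<mu> x a (h0 + i)) \<le> 1" "i < m"
  shows "(\<integral>\<^sup>+\<tau>. (if fst (\<tau> ! i) = x \<and> fst (snd (\<tau> ! i)) = a then \<phi> (snd (snd (\<tau> ! i))) else 1)
    \<partial>traj_steps m \<mu> \<pi> h0 x0) \<le> 1"
  using assms
proof (induction i arbitrary: m h0 x0)
  case 0
  then obtain m' where m: "m = Suc m'" by (cases m) auto
  show ?case
  proof (cases "x0 = x \<and> \<pi> x0 h0 = a")
    case True
    then show ?thesis using 0 by (auto simp: m cong del: if_weak_cong)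
  next
    case False
    then show ?thesis by (auto simp: m intro!: nn_integral_pmf_le_1 cong del: if_weak_cong)
  qed
next
  case (Suc i)
  then obtain m' where m: "m = Suc m'" by (cases m) auto
  show ?case using Suc.prems
    by (simp add: m cong del: if_weak_cong)
       (intro nn_integral_pmf_le_1[of "mtrans \<mu> x0 (\<pi> x0 h0) h0"] Suc.IH; simp add: m)
qed

text \<open>The same argument with the next state as the fresh sample. The transition out of the
  last stage leaves no trace in the trajectory, hence \<open>Suc i < m\<close>.\<close>

lemma traj_steps_transition_le_1:
  assumes "(\<integral>\<^sup>+y. \<phi> y \<partial>mtrans \<mu> x a (h0 + i)) \<le> 1" "Suc i < m"
  shows "(\<integral>\<^sup>+\<tau>. (if fst (\<tau> ! i) = x \<and> fst (snd (\<tau> ! i)) = a then \<phi> (fst (\<tau> ! Suc i)) else 1)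
    \<partial>traj_steps m \<mu> \<pi> h0 x0) \<le> 1"
  using assms
proof (induction i arbitrary: m h0 x0)
  case 0
  then obtain m' where m: "m = Suc (Suc m')" by (cases m; cases "m - 1") auto
  show ?case
  proof (cases "x0 = x \<and> \<pi> x0 h0 = a")
    case True
    then show ?thesis using 0 by (auto simp: m cong del: if_weak_cong)
  next
    case False
    then show ?thesis by (auto simp: m intro!: nn_integral_pmf_le_1 cong del: if_weak_cong)
  qed
next
  case (Suc i)
  then obtain m' where m: "m = Suc m'" by (cases m) auto
  show ?case using Suc.prems
    by (simp add: m cong del: if_weak_cong)
       (intro nn_integral_pmf_le_1[of "mtrans \<mu> x0 (\<pi> x0 h0) h0"] Suc.IH; simp add: m)
qed

lemma traj_steps_hd: "\<tau> \<in> set_pmf (traj_steps (Suc m) \<mu> \<pi> h x) \<Longrightarrow> fst (\<tau> ! 0) = x"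
  by auto

lemma length_traj_steps: "\<tau> \<in> set_pmf (traj_steps m \<mu> \<pi> h x) \<Longrightarrow> length \<tau> = m"
  by (induction m arbitrary: \<tau> h x) auto

lemma length_traj_pmf: "\<tau> \<in> set_pmf (traj_pmf H \<mu> \<pi>) \<Longrightarrow> length \<tau> = H"
  by (auto simp: traj_pmf_def dest: length_traj_steps)

lemma traj_pmf_reward_le_1:
  assumes "(\<integral>\<^sup>+r. \<phi> r \<partial>mrew \<mu> x a h) \<le> 1" "h < H"
  shows "(\<integral>\<^sup>+\<tau>. (if visited (x, a, h) \<tau> then \<phi> (snd (snd (\<tau> ! h))) else 1) \<partial>traj_pmf H \<mu> \<pi>) \<le> 1"
proof -
  have "(\<integral>\<^sup>+\<tau>. (if visited (x, a, h) \<tau> then \<phi> (snd (snd (\<tau> ! h))) else 1) \<partial>traj_pmf H \<mu> \<pi>) =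
     (\<integral>\<^sup>+\<tau>. (if fst (\<tau> ! h) = x \<and> fst (snd (\<tau> ! h)) = a then \<phi> (snd (snd (\<tau> ! h))) else 1) \<partial>traj_pmf H \<mu> \<pi>)"
    using assms by (intro nn_integral_cong_AE) (auto simp: AE_measure_pmf_iff visited_def dest: length_traj_pmf)
  also have "\<dots> \<le> 1"
    unfolding traj_pmf_def nn_integral_bind_pmf
    using assms by (intro nn_integral_pmf_le_1[of "minit \<mu>"]) (rule traj_steps_reward_le_1, simp_all)
  finally show ?thesis .
qed

lemma traj_pmf_transition_le_1:
  assumes "(\<integral>\<^sup>+y. \<phi> y \<partial>mtrans \<mu> x a h) \<le> 1" "Suc h < H"
  shows "(\<integral>\<^sup>+\<tau>. (if visited (x, a, h) \<tau> then \<phi> (fst (\<tau> ! Suc h)) else 1) \<partial>traj_pmf H \<mu> \<pi>) \<le> 1"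
proof -
  have "(\<integral>\<^sup>+\<tau>. (if visited (x, a, h) \<tau> then \<phi> (fst (\<tau> ! Suc h)) else 1) \<partial>traj_pmf H \<mu> \<pi>) =
     (\<integral>\<^sup>+\<tau>. (if fst (\<tau> ! h) = x \<and> fst (snd (\<tau> ! h)) = a then \<phi> (fst (\<tau> ! Suc h)) else 1) \<partial>traj_pmf H \<mu> \<pi>)"
    using assms by (intro nn_integral_cong_AE) (auto simp: AE_measure_pmf_iff visited_def dest: length_traj_pmf)
  also have "\<dots> \<le> 1"
    unfolding traj_pmf_def nn_integral_bind_pmf
    using assms by (intro nn_integral_pmf_le_1[of "minit \<mu>"]) (rule traj_steps_transition_le_1, simp_all)
  finally show ?thesis .
qed

lemma traj_pmf_init_le_1:
  assumes "(\<integral>\<^sup>+y. \<phi> y \<partial>minit \<mu>) \<le> 1" "0 < H"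
  shows "(\<integral>\<^sup>+\<tau>. \<phi> (fst (\<tau> ! 0)) \<partial>traj_pmf H \<mu> \<pi>) \<le> 1"
proof -
  obtain m where H: "H = Suc m" using assms(2) by (cases H) auto
  have "(\<integral>\<^sup>+\<tau>. \<phi> (fst (\<tau> ! 0)) \<partial>traj_steps H \<mu> \<pi> 0 x) = \<phi> x" for x
  proof -
    have "(\<integral>\<^sup>+\<tau>. \<phi> (fst (\<tau> ! 0)) \<partial>traj_steps H \<mu> \<pi> 0 x) = (\<integral>\<^sup>+\<tau>. \<phi> x \<partial>traj_steps H \<mu> \<pi> 0 x)"
      unfolding H by (intro nn_integral_cong_AE) (auto simp only: AE_measure_pmf_iff dest: traj_steps_hd)
    then show ?thesis by simp
  qed
  then show ?thesis using assms(1) by (simp add: traj_pmf_def)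
qed

section \<open>Deviation bounds along the adaptive process\<close>

context hidden_hallucination begin

text \<open>The bound on one episode is uniform in the policy, so the adaptive choice of policies
  does no harm: conditioning on the past removes one factor at a time.\<close>

lemma raw_proc_prod_le_1:
  fixes f :: "traj \<Rightarrow> ennreal"
  assumes R: "rule_ok R" and f: "\<And>\<pi>. \<pi> \<in> pols \<Longrightarrow> (\<integral>\<^sup>+\<tau>. f \<tau> \<partial>traj_pmf H \<mu> \<pi>) \<le> 1"
  shows "(\<integral>\<^sup>+raw. (\<Prod>p\<leftarrow>raw. f (snd p)) \<partial>raw_proc \<mu> R l) \<le> 1"
proof (induction l)
  case (Suc l)
  have "(\<integral>\<^sup>+raw'. (\<Prod>p\<leftarrow>raw'. f (snd p)) \<partial>raw_step \<mu> R l raw) \<le> (\<Prod>p\<leftarrow>raw. f (snd p))" for raw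
  proof -
    have "(\<integral>\<^sup>+raw'. (\<Prod>p\<leftarrow>raw'. f (snd p)) \<partial>raw_step \<mu> R l raw) =
       (\<Prod>p\<leftarrow>raw. f (snd p)) * (\<integral>\<^sup>+\<pi>. \<integral>\<^sup>+\<tau>. f \<tau> \<partial>traj_pmf H \<mu> \<pi> \<partial>choice R l raw)"
      by (simp add: raw_step_def nn_integral_cmult)
    also have "\<dots> \<le> (\<Prod>p\<leftarrow>raw. f (snd p)) * 1"
      using set_choice[OF R, of l raw] by (intro mult_left_mono nn_integral_pmf_le_1 f) auto
    finally show ?thesis by simp
  qed
  then have "(\<integral>\<^sup>+raw. (\<Prod>p\<leftarrow>raw. f (snd p)) \<partial>raw_proc \<mu> R (Suc l)) \<le> (\<integral>\<^sup>+raw. (\<Prod>p\<leftarrow>raw. f (snd p)) \<partial>raw_proc \<mu> R l)"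
    by (simp add: nn_integral_mono)
  with Suc show ?case by (rule order_trans[rotated])
qed simp

text \<open>The exponential process is a supermartingale in the number of visits, so the bound holds at a
  fixed phase for the random number of samples without any stopping argument.\<close>

lemma deviation_bound:
  fixes \<eta> m :: real and y :: "traj \<Rightarrow> real"
  assumes R: "rule_ok R" and \<eta>: "0 < \<eta>"
    and le_1: "\<And>s \<pi>. \<pi> \<in> pols \<Longrightarrow>
      (\<integral>\<^sup>+\<tau>. (if nv \<tau> then ennreal (exp (s * (y \<tau> - m) - s\<^sup>2 / 8)) else 1) \<partial>traj_pmf H \<mu> \<pi>) \<le> 1"
  defines "vs \<equiv> filter (\<lambda>p. nv (snd p))"
  shows "measure_pmf.prob (raw_proc \<mu> R l)
     {raw. n \<le> length (vs raw) \<and> \<eta> * length (vs raw) < \<bar>\<Sum>p\<leftarrow>vs raw. y (snd p) - m\<bar>} \<le> 2 * exp (- 2 * \<eta>\<^sup>2 * n)"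
proof -
  let ?dev = "\<lambda>raw. \<Sum>p\<leftarrow>vs raw. y (snd p) - m"
  define E where "E = (\<lambda>s raw. exp (s * ?dev raw - s\<^sup>2 / 8 * length (vs raw)))"
  have E_prod: "ennreal (E s raw) = (\<Prod>p\<leftarrow>raw. if nv (snd p) then ennreal (exp (s * (y (snd p) - m) - s\<^sup>2 / 8)) else 1)" for s raw
  proof (induction raw)
    case (Cons p raw)
    have "E s (p # raw) = (if nv (snd p) then exp (s * (y (snd p) - m) - s\<^sup>2 / 8) else 1) * E s raw"
      by (simp add: E_def vs_def exp_add[symmetric] algebra_simps)
    moreover have "0 \<le> E s raw" by (simp add: E_def)
    ultimately show ?case using Cons by (auto simp: ennreal_mult)
  qed (simp add: E_def vs_def)
  have E_le: "(\<integral>\<^sup>+raw. ennreal (E s raw) \<partial>raw_proc \<mu> R l) \<le> 1" for s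
    unfolding E_prod by (rule raw_proc_prod_le_1[OF R le_1])
  have markov: "measure_pmf.prob (raw_proc \<mu> R l) {raw. exp (2 * \<eta>\<^sup>2 * n) \<le> E s raw} \<le> exp (- 2 * \<eta>\<^sup>2 * n)" for s
  proof -
    let ?c = "exp (2 * \<eta>\<^sup>2 * n)"
    have "ennreal ?c * emeasure (raw_proc \<mu> R l) {raw. ?c \<le> E s raw} =
      (\<integral>\<^sup>+raw. ennreal ?c * indicator {raw. ?c \<le> E s raw} raw \<partial>raw_proc \<mu> R l)"
      by (simp add: nn_integral_cmult)
    also have "\<dots> \<le> (\<integral>\<^sup>+raw. ennreal (E s raw) \<partial>raw_proc \<mu> R l)"
      by (intro nn_integral_mono) (auto simp: indicator_def intro: ennreal_leI)
    also have "\<dots> \<le> 1" by (rule E_le)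
    finally have "?c * measure_pmf.prob (raw_proc \<mu> R l) {raw. ?c \<le> E s raw} \<le> 1"
      by (simp add: measure_pmf.emeasure_eq_measure ennreal_mult[symmetric])
    then show ?thesis by (simp add: exp_minus field_simps)
  qed
  \<comment> \<open>With \<open>s = 4 * \<eta>\<close> the exponent gained per sample,
    \<open>s * \<eta> - s\<^sup>2 / 8\<close>, takes its maximal value
    \<open>2 * \<eta>\<^sup>2\<close>. The two signs of the parameter cover the two signs of the
    deviation.\<close>
  have "{raw. n \<le> length (vs raw) \<and> \<eta> * length (vs raw) < \<bar>?dev raw\<bar>} \<subseteq>
     {raw. exp (2 * \<eta>\<^sup>2 * n) \<le> E (4 * \<eta>) raw} \<union> {raw. exp (2 * \<eta>\<^sup>2 * n) \<le> E (- 4 * \<eta>) raw}"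
  proof
    fix raw assume "raw \<in> {raw. n \<le> length (vs raw) \<and> \<eta> * length (vs raw) < \<bar>?dev raw\<bar>}"
    then have n: "real n \<le> length (vs raw)" and d: "\<eta> * length (vs raw) < \<bar>?dev raw\<bar>" by auto
    have "4 * \<eta> * (\<eta> * length (vs raw)) \<le> 4 * \<eta> * \<bar>?dev raw\<bar>"
      using d \<eta> by (intro mult_left_mono) auto
    moreover have "2 * \<eta>\<^sup>2 * n \<le> 2 * \<eta>\<^sup>2 * length (vs raw)"
      using n by (intro mult_left_mono) auto
    ultimately have "2 * \<eta>\<^sup>2 * n \<le> 4 * \<eta> * \<bar>?dev raw\<bar> - 2 * \<eta>\<^sup>2 * length (vs raw)"
      by (simp add: power2_eq_square algebra_simps)
    then show "raw \<in> {raw. exp (2 * \<eta>\<^sup>2 * n) \<le> E (4 * \<eta>) raw} \<union> {raw. exp (2 * \<eta>\<^sup>2 * n) \<le> E (- 4 * \<eta>) raw}"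
      by (cases "0 \<le> ?dev raw") (auto simp: E_def power_mult_distrib algebra_simps)
  qed
  then have "measure_pmf.prob (raw_proc \<mu> R l) {raw. n \<le> length (vs raw) \<and> \<eta> * length (vs raw) < \<bar>?dev raw\<bar>}
    \<le> measure_pmf.prob (raw_proc \<mu> R l) ({raw. exp (2 * \<eta>\<^sup>2 * n) \<le> E (4 * \<eta>) raw} \<union> {raw. exp (2 * \<eta>\<^sup>2 * n) \<le> E (- 4 * \<eta>) raw})"
    by (intro measure_pmf.finite_measure_mono) auto
  also have "\<dots> \<le> measure_pmf.prob (raw_proc \<mu> R l) {raw. exp (2 * \<eta>\<^sup>2 * n) \<le> E (4 * \<eta>) raw} +
      measure_pmf.prob (raw_proc \<mu> R l) {raw. exp (2 * \<eta>\<^sup>2 * n) \<le> E (- 4 * \<eta>) raw}"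
    by (intro measure_Un_le) auto
  also have "\<dots> \<le> 2 * exp (- 2 * \<eta>\<^sup>2 * n)"
    using markov[of "4 * \<eta>"] markov[of "- 4 * \<eta>"] by linarith
  finally show ?thesis .
qed

abbreviation visits :: "triple \<Rightarrow> (policy \<times> traj) list \<Rightarrow> (policy \<times> traj) list" where
  "visits t \<equiv> filter (\<lambda>p. visited t (snd p))"

definition reward_dev :: "model \<Rightarrow> triple \<Rightarrow> (policy \<times> traj) list \<Rightarrow> real" where
  "reward_dev \<mu> t z = (\<Sum>p\<leftarrow>visits t z. snd (snd (snd p ! snd (snd t))) - mean_rew \<mu> t)"

definition trans_prob :: "model \<Rightarrow> triple \<Rightarrow> nat set \<Rightarrow> real" where
  "trans_prob \<mu> t B = measure_pmf.prob (mtrans \<mu> (fst t) (fst (snd t)) (snd (snd t))) B"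

definition trans_dev :: "model \<Rightarrow> triple \<Rightarrow> nat set \<Rightarrow> (policy \<times> traj) list \<Rightarrow> real" where
  "trans_dev \<mu> t B z = (\<Sum>p\<leftarrow>visits t z. indicator B (fst (snd p ! Suc (snd (snd t)))) - trans_prob \<mu> t B)"

definition init_dev :: "model \<Rightarrow> nat set \<Rightarrow> (policy \<times> traj) list \<Rightarrow> real" where
  "init_dev \<mu> B z = (\<Sum>p\<leftarrow>z. indicator B (fst (snd p ! 0)) - measure_pmf.prob (minit \<mu>) B)"

definition close_rewards :: "real \<Rightarrow> model \<Rightarrow> (policy \<times> traj) list \<Rightarrow> bool" where
  "close_rewards \<eta> \<mu> z \<longleftrightarrow> (\<forall>t\<in>trips - UE z. \<bar>reward_dev \<mu> t z\<bar> \<le> \<eta> * length (visits t z))"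

text \<open>Dynamics are compared on all events \<open>B\<close>, which amounts to total variation
  and costs a factor \<open>2 ^ S\<close> in the union bound. The initial law is included only if
  some triple is explored, since then \<open>z\<close> has at least \<open>n\<close> entries. Sums
  instead of averages avoid dividing by a number of visits.\<close>

definition close_dynamics :: "real \<Rightarrow> model \<Rightarrow> (policy \<times> traj) list \<Rightarrow> bool" where
  "close_dynamics \<eta> \<mu> z \<longleftrightarrow>
     (\<forall>t\<in>trips - UE z. Suc (snd (snd t)) < H \<longrightarrow> (\<forall>B\<in>Pow {..<S}. \<bar>trans_dev \<mu> t B z\<bar> \<le> \<eta> * length (visits t z))) \<and>
     (UE z \<noteq> trips \<longrightarrow> (\<forall>B\<in>Pow {..<S}. \<bar>init_dev \<mu> B z\<bar> \<le> \<eta> * length z))"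

lemma explored_visits: "t \<in> trips - UE z \<Longrightarrow> n \<le> length (visits t z)"
  by (auto simp: under_explored_def)

lemma explored_length: "UE z \<noteq> trips \<Longrightarrow> n \<le> length z"
proof -
  assume "UE z \<noteq> trips"
  then obtain t where "t \<in> trips - UE z" using under_explored_subset by blast
  then have "n \<le> length (visits t z)" by (rule explored_visits)
  then show "n \<le> length z" using length_filter_le order_trans by blast
qed

text \<open>Every failure of closeness concerns a statistic with at least \<open>n\<close> samples,
  so \<open>deviation_bound\<close> applies to it; the statistics form three finite families, for
  rewards, transitions and the initial state.\<close>

lemma not_close_bound:
  assumes R: "rule_ok R" and \<eta>: "0 < \<eta>" and \<mu>: "valid \<mu>"
  shows "measure_pmf.prob (raw_proc \<mu> R l) {z. \<not> (close_rewards \<eta> \<mu> z \<and> close_dynamics \<eta> \<mu> z)} \<le>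
    6 * (real S * A * H) * 2 ^ S * exp (- 2 * \<eta>\<^sup>2 * n)"
proof -
  let ?P = "measure_pmf.prob (raw_proc \<mu> R l)"
  let ?b = "2 * exp (- 2 * \<eta>\<^sup>2 * n)"
  let ?E1 = "\<lambda>t. {z. n \<le> length (visits t z) \<and> \<eta> * length (visits t z) < \<bar>reward_dev \<mu> t z\<bar>}"
  let ?E2 = "\<lambda>p. {z. n \<le> length (visits (fst p) z) \<and> \<eta> * length (visits (fst p) z) < \<bar>trans_dev \<mu> (fst p) (snd p) z\<bar>}"
  let ?E3 = "\<lambda>B. {z. n \<le> length z \<and> \<eta> * length z < \<bar>init_dev \<mu> B z\<bar>}"
  let ?I2 = "{t\<in>trips. Suc (snd (snd t)) < H} \<times> Pow {..<S}"
  have E1: "?P (?E1 t) \<le> ?b" if t: "t \<in> trips" for t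
  proof -
    obtain x a h where xah: "t = (x, a, h)" and "x < S" "a < A" "h < H" using t by (auto simp: triples_def)
    have "(\<integral>\<^sup>+r. ennreal (exp (s * (r - mean_rew \<mu> t) - s\<^sup>2 / 8)) \<partial>mrew \<mu> x a h) \<le> 1" for s
      using Hoeffding_pmf[of "mrew \<mu> x a h" "\<lambda>r. r" s] validD(1)[OF \<mu> \<open>x < S\<close> \<open>a < A\<close> \<open>h < H\<close>] Rset_subset
      by (auto simp: mean_rew_def xah subset_iff)
    from traj_pmf_reward_le_1[OF this \<open>h < H\<close>]
    have "(\<integral>\<^sup>+\<tau>. (if visited t \<tau> then ennreal (exp (s * (snd (snd (\<tau> ! h)) - mean_rew \<mu> t) - s\<^sup>2 / 8)) else 1)
        \<partial>traj_pmf H \<mu> \<pi>) \<le> 1" for s \<pi> by (simp add: xah)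
    from deviation_bound[OF R \<eta> this] show ?thesis by (simp add: reward_dev_def xah)
  qed
  have E2: "?P (?E2 p) \<le> ?b" if p: "p \<in> ?I2" for p
  proof -
    obtain x a h B where xah: "p = ((x, a, h), B)" and "Suc h < H" using p by (auto simp: triples_def)
    have "(\<integral>\<^sup>+y. ennreal (exp (s * (indicator B y - trans_prob \<mu> (x, a, h) B) - s\<^sup>2 / 8)) \<partial>mtrans \<mu> x a h) \<le> 1" for s
      using Hoeffding_pmf[of "mtrans \<mu> x a h" "indicator B" s] by (auto simp: trans_prob_def)
    from traj_pmf_transition_le_1[OF this \<open>Suc h < H\<close>]
    have "(\<integral>\<^sup>+\<tau>. (if visited (x, a, h) \<tau>
        then ennreal (exp (s * (indicator B (fst (\<tau> ! Suc h)) - trans_prob \<mu> (x, a, h) B) - s\<^sup>2 / 8)) else 1)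
        \<partial>traj_pmf H \<mu> \<pi>) \<le> 1" for s \<pi> .
    from deviation_bound[OF R \<eta> this] show ?thesis by (simp add: trans_dev_def xah)
  qed
  have E3: "?P (?E3 B) \<le> ?b" for B
  proof -
    have "0 < H" by (rule pos)
    have "(\<integral>\<^sup>+y. ennreal (exp (s * (indicator B y - measure_pmf.prob (minit \<mu>) B) - s\<^sup>2 / 8)) \<partial>minit \<mu>) \<le> 1" for s
      using Hoeffding_pmf[of "minit \<mu>" "indicator B" s] by auto
    from traj_pmf_init_le_1[OF this \<open>0 < H\<close>]
    have "(\<integral>\<^sup>+\<tau>. (if True then ennreal (exp (s * (indicator B (fst (\<tau> ! 0)) - measure_pmf.prob (minit \<mu>) B) - s\<^sup>2 / 8)) else 1)
        \<partial>traj_pmf H \<mu> \<pi>) \<le> 1" for s \<pi> by simp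
    from deviation_bound[OF R \<eta> this] show ?thesis by (simp add: init_dev_def)
  qed
  have union: "?P (\<Union>i\<in>I. E i) \<le> card I * ?b" if "finite I" "\<And>i. i \<in> I \<Longrightarrow> ?P (E i) \<le> ?b" for I :: "'i set" and E
  proof -
    have "?P (\<Union>i\<in>I. E i) \<le> (\<Sum>i\<in>I. ?P (E i))"
      using that by (intro measure_pmf.finite_measure_subadditive_finite) auto
    also have "\<dots> \<le> card I * ?b" using that by (intro sum_bounded_above) auto
    finally show ?thesis .
  qed
  have "{z. \<not> (close_rewards \<eta> \<mu> z \<and> close_dynamics \<eta> \<mu> z)} \<subseteq>
    (\<Union>t\<in>trips. ?E1 t) \<union> ((\<Union>p\<in>?I2. ?E2 p) \<union> (\<Union>B\<in>Pow {..<S}. ?E3 B))"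
  proof
    fix z assume "z \<in> {z. \<not> (close_rewards \<eta> \<mu> z \<and> close_dynamics \<eta> \<mu> z)}"
    then consider (r) "\<not> close_rewards \<eta> \<mu> z" | (d) "\<not> close_dynamics \<eta> \<mu> z" by auto
    then show "z \<in> (\<Union>t\<in>trips. ?E1 t) \<union> ((\<Union>p\<in>?I2. ?E2 p) \<union> (\<Union>B\<in>Pow {..<S}. ?E3 B))"
    proof cases
      case r
      then obtain t where "t \<in> trips - UE z" "\<eta> * length (visits t z) < \<bar>reward_dev \<mu> t z\<bar>"
        unfolding close_rewards_def by (meson not_le)
      then have "t \<in> trips" "z \<in> ?E1 t" using explored_visits[of t z] by auto
      then show ?thesis by blast
    next
      case d
      then consider (t) t B where "t \<in> trips - UE z" "Suc (snd (snd t)) < H" "B \<in> Pow {..<S}"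
          "\<eta> * length (visits t z) < \<bar>trans_dev \<mu> t B z\<bar>"
        | (i) B where "UE z \<noteq> trips" "B \<in> Pow {..<S}" "\<eta> * length z < \<bar>init_dev \<mu> B z\<bar>"
        unfolding close_dynamics_def by (meson not_le)
      then show ?thesis
      proof cases
        case t
        then have "(t, B) \<in> ?I2" "z \<in> ?E2 (t, B)" using explored_visits[of t z] by auto
        then show ?thesis by blast
      next
        case i
        then have "B \<in> Pow {..<S}" "z \<in> ?E3 B" using explored_length[of z] by auto
        then show ?thesis by blast
      qed
    qed
  qed
  then have "?P {z. \<not> (close_rewards \<eta> \<mu> z \<and> close_dynamics \<eta> \<mu> z)} \<le>
    ?P ((\<Union>t\<in>trips. ?E1 t) \<union> ((\<Union>p\<in>?I2. ?E2 p) \<union> (\<Union>B\<in>Pow {..<S}. ?E3 B)))"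
    by (intro measure_pmf.finite_measure_mono) auto
  also have "\<dots> \<le> ?P (\<Union>t\<in>trips. ?E1 t) + ?P ((\<Union>p\<in>?I2. ?E2 p) \<union> (\<Union>B\<in>Pow {..<S}. ?E3 B))"
    by (intro measure_Un_le) auto
  also have "\<dots> \<le> ?P (\<Union>t\<in>trips. ?E1 t) + (?P (\<Union>p\<in>?I2. ?E2 p) + ?P (\<Union>B\<in>Pow {..<S}. ?E3 B))"
    by (intro add_left_mono measure_Un_le) auto
  also have "\<dots> \<le> card trips * ?b + (card ?I2 * ?b + card (Pow {..<S}) * ?b)"
    using finite_triples[of S A H] by (intro add_mono union E1 E2 E3) auto
  \<comment> \<open>Each family has at most \<open>S * A * H * 2 ^ S\<close> members; with the
    factor 2 of the two-sided bound this gives the constant 6.\<close>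
  also have "\<dots> \<le> (real S * A * H * 2 ^ S) * ?b + ((real S * A * H * 2 ^ S) * ?b + (real S * A * H * 2 ^ S) * ?b)"
  proof (intro add_mono mult_right_mono)
    have 1: "1 \<le> real S * A * H"
      using pos of_nat_mono[of 1 "S * A * H"] by (simp add: Suc_le_eq)
    have "card ?I2 \<le> card (trips \<times> Pow {..<S})"
      using finite_triples[of S A H] by (intro card_mono) auto
    also have "\<dots> = S * A * H * 2 ^ S" by (simp add: card_cartesian_product card_triples card_Pow)
    finally have "real (card ?I2) \<le> real (S * A * H * 2 ^ S)" by (rule of_nat_mono)
    then show "real (card ?I2) \<le> real S * A * H * 2 ^ S" by simp
    show "real (card trips) \<le> real S * A * H * 2 ^ S" using mult_left_mono[of "1::real" "2 ^ S" "real S * A * H"] by (simp add: card_triples)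
    show "real (card (Pow {..<S})) \<le> real S * A * H * 2 ^ S" using 1 by (simp add: card_Pow)
  qed auto
  finally show ?thesis by (simp add: algebra_simps)
qed

text \<open>Hidden rewards are filled in with 0 so that the deviations, defined on raw data, apply
  to ledgers. In a ledger of the process this 0 is never read: closeness consults rewards only at
  explored triples, where nothing is hidden.\<close>

definition uncensor :: "(policy \<times> ctraj) list \<Rightarrow> (policy \<times> traj) list" where
  "uncensor = map (apsnd (map (\<lambda>(x, a, ro). (x, a, case ro of None \<Rightarrow> 0 | Some r \<Rightarrow> r))))"

lemma erase_uncensor [simp]: "erase (uncensor es) = erase es"
  by (induction es) (auto simp: uncensor_def erase_def erase_traj_def split: option.splits)

lemma UE_uncensor: "UE (uncensor es) = UE (erase es)"
  using under_explored_cong[of "uncensor es" "erase es"] by simp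

lemma censor_steps_nth:
  "i < length \<tau> \<Longrightarrow> censor_steps U k \<tau> ! i =
     (fst (\<tau> ! i), fst (snd (\<tau> ! i)),
      if (fst (\<tau> ! i), fst (snd (\<tau> ! i)), k + i) \<in> U then None else Some (snd (snd (\<tau> ! i))))"
proof (induction U k \<tau> arbitrary: i rule: censor_steps.induct)
  case (2 U k x a r \<tau>)
  then show ?case by (cases i) auto
qed simp

lemma length_censor_steps [simp]: "length (censor_steps U k \<tau>) = length \<tau>"
  by (induction U k \<tau> rule: censor_steps.induct) auto

definition mask :: "triple set \<Rightarrow> traj \<Rightarrow> traj" where
  "mask U \<tau> = map (\<lambda>(x, a, ro). (x, a, case ro of None \<Rightarrow> 0 | Some r \<Rightarrow> r)) (censor_traj U \<tau>)"

lemma uncensor_censor: "uncensor (censor_list U raw) = map (apsnd (mask U)) raw"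
  by (auto simp: uncensor_def censor_list_def mask_def)

lemma mask_nth:
  assumes "i < length \<tau>"
  shows "fst (mask U \<tau> ! i) = fst (\<tau> ! i)" "fst (snd (mask U \<tau> ! i)) = fst (snd (\<tau> ! i))"
    "(fst (\<tau> ! i), fst (snd (\<tau> ! i)), i) \<notin> U \<Longrightarrow> snd (snd (mask U \<tau> ! i)) = snd (snd (\<tau> ! i))"
  using assms by (auto simp: mask_def censor_traj_eq censor_steps_nth)

lemma length_mask [simp]: "length (mask U \<tau>) = length \<tau>"
  by (simp add: mask_def censor_traj_eq)

lemma visited_mask [simp]: "visited t (mask U \<tau>) \<longleftrightarrow> visited t \<tau>"
  by (cases t) (auto simp: visited_def mask_nth)

lemma visits_mask: "visits t (map (apsnd (mask U)) raw) = map (apsnd (mask U)) (visits t raw)"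
  by (induction raw) auto

text \<open>Censoring alters rewards only inside \<open>UE raw\<close>, and closeness reads them
  only outside. Hence whether a model is close to the raw data can be decided from the honest
  ledger.\<close>

lemma close_uncensor:
  assumes raw: "raw \<in> raws"
  shows "close_rewards \<eta> \<mu> (uncensor (censor_list (UE raw) raw)) \<longleftrightarrow> close_rewards \<eta> \<mu> raw"
    "close_dynamics \<eta> \<mu> (uncensor (censor_list (UE raw) raw)) \<longleftrightarrow> close_dynamics \<eta> \<mu> raw"
proof -
  let ?z = "map (apsnd (mask (UE raw))) raw"
  have z: "uncensor (censor_list (UE raw) raw) = ?z" by (rule uncensor_censor)
  have UE: "UE ?z = UE raw"
    unfolding z[symmetric] UE_uncensor by simp
  have len: "length (snd p) = H" if "p \<in> set raw" for p
    using raw that by (auto simp: raws_def trajs_def)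
  have rew: "reward_dev \<mu> t ?z = reward_dev \<mu> t raw" if t: "t \<in> trips - UE raw" for t
  proof -
    have "snd (snd (mask (UE raw) (snd p) ! snd (snd t))) = snd (snd (snd p ! snd (snd t)))"
      if "p \<in> set (visits t raw)" for p
      using that t by (intro mask_nth) (auto simp: visited_def)
    then show ?thesis
      unfolding reward_dev_def visits_mask map_map
      by (intro arg_cong[where f=sum_list] map_cong refl) auto
  qed
  have tr: "trans_dev \<mu> t B ?z = trans_dev \<mu> t B raw" if t: "Suc (snd (snd t)) < H" for t B
  proof -
    have "fst (mask (UE raw) (snd p) ! Suc (snd (snd t))) = fst (snd p ! Suc (snd (snd t)))"
      if "p \<in> set (visits t raw)" for p
      using that t len by (intro mask_nth) auto
    then show ?thesis
      unfolding trans_dev_def visits_mask map_map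
      by (intro arg_cong[where f=sum_list] map_cong refl) auto
  qed
  have init: "init_dev \<mu> B ?z = init_dev \<mu> B raw" for B
  proof -
    have "fst (mask (UE raw) (snd p) ! 0) = fst (snd p ! 0)" if "p \<in> set raw" for p
      using that len pos by (intro mask_nth) auto
    then show ?thesis
      unfolding init_dev_def map_map
      by (intro arg_cong[where f=sum_list] map_cong refl) auto
  qed
  show "close_rewards \<eta> \<mu> (uncensor (censor_list (UE raw) raw)) \<longleftrightarrow> close_rewards \<eta> \<mu> raw"
    unfolding z close_rewards_def UE using rew by (simp add: visits_mask)
  show "close_dynamics \<eta> \<mu> (uncensor (censor_list (UE raw) raw)) \<longleftrightarrow> close_dynamics \<eta> \<mu> raw"
    unfolding z close_dynamics_def UE init using tr by (simp add: visits_mask)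
qed

definition close :: "real \<Rightarrow> model \<Rightarrow> (policy \<times> traj) list \<Rightarrow> bool" where
  "close \<eta> \<mu> z \<longleftrightarrow> close_rewards \<eta> \<mu> z \<and> close_dynamics \<eta> \<mu> z"

lemma not_close_hon:
  assumes R: "rule_ok R" and \<eta>: "0 < \<eta>" and \<mu>: "valid \<mu>"
  shows "measure_pmf.prob (hon_proc \<mu> R l) {lg. \<not> close \<eta> \<mu> (uncensor (snd lg))} \<le>
    6 * (real S * A * H) * 2 ^ S * exp (- 2 * \<eta>\<^sup>2 * n)"
proof -
  have "measure_pmf.prob (hon_proc \<mu> R l) {lg. \<not> close \<eta> \<mu> (uncensor (snd lg))} =
    measure_pmf.prob (raw_proc \<mu> R l) {z. \<not> (close_rewards \<eta> \<mu> z \<and> close_dynamics \<eta> \<mu> z)}"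
    unfolding hon_proc_def measure_map_pmf
  proof (rule measure_prob_cong_0)
    have *: "raw \<in> raws" if "pmf (raw_proc \<mu> R l) raw \<noteq> 0" for raw
      using that set_raw_proc[OF R \<mu>, of l] by (auto simp: set_pmf_iff)
    fix raw
    assume "raw \<in> hon -` {lg. \<not> close \<eta> \<mu> (uncensor (snd lg))} - {z. \<not> (close_rewards \<eta> \<mu> z \<and> close_dynamics \<eta> \<mu> z)}"
    then show "pmf (raw_proc \<mu> R l) raw = 0"
      using *[of raw] close_uncensor[of raw \<eta> \<mu>] by (auto simp: close_def censor_raw_eq)
  next
    have *: "raw \<in> raws" if "pmf (raw_proc \<mu> R l) raw \<noteq> 0" for raw
      using that set_raw_proc[OF R \<mu>, of l] by (auto simp: set_pmf_iff)
    fix raw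
    assume "raw \<in> {z. \<not> (close_rewards \<eta> \<mu> z \<and> close_dynamics \<eta> \<mu> z)} - hon -` {lg. \<not> close \<eta> \<mu> (uncensor (snd lg))}"
    then show "pmf (raw_proc \<mu> R l) raw = 0"
      using *[of raw] close_uncensor[of raw \<eta> \<mu>] by (auto simp: close_def censor_raw_eq)
  qed
  also have "\<dots> \<le> 6 * (real S * A * H) * 2 ^ S * exp (- 2 * \<eta>\<^sup>2 * n)"
    by (rule not_close_bound[OF R \<eta> \<mu>])
  finally show ?thesis .
qed

lemma sum_list_measurable:
  "(\<And>p. p \<in> set ps \<Longrightarrow> (\<lambda>\<mu>. f \<mu> p) \<in> borel_measurable prior) \<Longrightarrow> (\<lambda>\<mu>. \<Sum>p\<leftarrow>ps. f \<mu> p :: real) \<in> borel_measurable prior"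
  by (induction ps) auto

lemma trans_prob_measurable: "t \<in> trips \<Longrightarrow> (\<lambda>\<mu>. trans_prob \<mu> t B) \<in> borel_measurable prior"
  using pmf_kernel_prob[OF kernel_mtrans, of "fst t" "fst (snd t)" "snd (snd t)" "\<lambda>\<mu> y. y \<in> B"]
  by (auto simp: trans_prob_def triples_def)

lemma init_prob_measurable: "(\<lambda>\<mu>. measure_pmf.prob (minit \<mu>) B) \<in> borel_measurable prior"
  using pmf_kernel_prob[OF kernel_minit, of "\<lambda>\<mu> y. y \<in> B"] by simp

lemma pred_abs_le: "f \<in> borel_measurable prior \<Longrightarrow> Measurable.pred prior (\<lambda>\<mu>. \<bar>f \<mu> :: real\<bar> \<le> c)"
  by measurable

lemma pred_close_rewards [measurable]: "Measurable.pred prior (\<lambda>\<mu>. close_rewards \<eta> \<mu> z)"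
  unfolding close_rewards_def reward_dev_def using finite_triples[of S A H]
  by (intro pred_intros_finite pred_abs_le sum_list_measurable borel_measurable_diff mean_rew_measurable) auto

lemma pred_close_dynamics [measurable]: "Measurable.pred prior (\<lambda>\<mu>. close_dynamics \<eta> \<mu> z)"
  unfolding close_dynamics_def trans_dev_def init_dev_def using finite_triples[of S A H]
  by (intro pred_intros_finite pred_intros_logic pred_abs_le sum_list_measurable borel_measurable_diff
      trans_prob_measurable init_prob_measurable) auto

lemma pred_close [measurable]: "Measurable.pred prior (\<lambda>\<mu>. close \<eta> \<mu> z)"
  unfolding close_def by measurable

end

section \<open>First visits to under-explored triples\<close>

lemma expectation_bind_pmf:
  fixes f :: "'b \<Rightarrow> real"
  assumes f: "\<And>y. y \<in> set_pmf (bind_pmf p k) \<Longrightarrow> 0 \<le> f y \<and> f y \<le> B"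
  shows "measure_pmf.expectation (bind_pmf p k) f = (\<integral>x. measure_pmf.expectation (k x) f \<partial>measure_pmf p)"
proof -
  have f': "0 \<le> f y \<and> f y \<le> B" if "x \<in> set_pmf p" "y \<in> set_pmf (k x)" for x y
    using that by (intro f) auto
  have int: "integrable (measure_pmf (k x)) f" if "x \<in> set_pmf p" for x
    using f'[OF that] by (intro measure_pmf.integrable_const_bound[where B=B]) (auto simp: AE_measure_pmf_iff)
  have "measure_pmf.expectation (bind_pmf p k) f = enn2real (\<integral>\<^sup>+y. ennreal (f y) \<partial>bind_pmf p k)"
    using f by (intro integral_eq_nn_integral) (auto simp: AE_measure_pmf_iff)
  also have "(\<integral>\<^sup>+y. ennreal (f y) \<partial>bind_pmf p k) = (\<integral>\<^sup>+x. ennreal (measure_pmf.expectation (k x) f) \<partial>measure_pmf p)"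
    unfolding nn_integral_bind_pmf
    by (intro nn_integral_cong_AE) (auto simp: AE_measure_pmf_iff f' int intro!: nn_integral_eq_integral)
  also have "enn2real \<dots> = (\<integral>x. measure_pmf.expectation (k x) f \<partial>measure_pmf p)"
    by (intro integral_eq_nn_integral[symmetric]) (auto simp: AE_measure_pmf_iff f' intro!: integral_nonneg_AE)
  finally show ?thesis .
qed

lemma prob_bind_pmf: "measure_pmf.prob (bind_pmf p k) X = (\<integral>x. measure_pmf.prob (k x) X \<partial>measure_pmf p)"
  using expectation_bind_pmf[of p k "indicator X" 1] by (simp add: indicator_le_1)

lemma expectation_pmf_mono:
  fixes f g :: "'a \<Rightarrow> real"
  assumes "\<And>x. x \<in> set_pmf p \<Longrightarrow> f x \<le> g x" "\<And>x. x \<in> set_pmf p \<Longrightarrow> \<bar>f x\<bar> \<le> B" "\<And>x. x \<in> set_pmf p \<Longrightarrow> \<bar>g x\<bar> \<le> B"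
  shows "measure_pmf.expectation p f \<le> measure_pmf.expectation p g"
  using assms by (intro integral_mono_AE measure_pmf.integrable_const_bound[where B=B]) (auto simp: AE_measure_pmf_iff)

lemma expectation_pmf_cong:
  fixes f g :: "'a \<Rightarrow> real"
  assumes "\<And>x. x \<in> set_pmf p \<Longrightarrow> f x = g x"
  shows "measure_pmf.expectation p f = measure_pmf.expectation p g"
  using assms by (intro integral_cong_AE) (auto simp: AE_measure_pmf_iff)

lemma expectation_pmf_bounds:
  fixes f :: "'a \<Rightarrow> real"
  assumes "\<And>x. x \<in> set_pmf p \<Longrightarrow> a \<le> f x \<and> f x \<le> b"
  shows "a \<le> measure_pmf.expectation p f" "measure_pmf.expectation p f \<le> b"
proof -
  have int: "integrable (measure_pmf p) f"
    using assms by (intro measure_pmf.integrable_const_bound[where B="max \<bar>a\<bar> \<bar>b\<bar>"]) (auto simp: AE_measure_pmf_iff, force)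
  show "a \<le> measure_pmf.expectation p f"
    using assms by (intro measure_pmf.integral_ge_const int) (auto simp: AE_measure_pmf_iff)
  show "measure_pmf.expectation p f \<le> b"
    using assms by (intro measure_pmf.integral_le_const int) (auto simp: AE_measure_pmf_iff)
qed

lemma expectation_pmf_affine:
  fixes f :: "'a \<Rightarrow> real"
  assumes "\<And>x. x \<in> set_pmf p \<Longrightarrow> \<bar>f x\<bar> \<le> B"
  shows "measure_pmf.expectation p (\<lambda>x. c + d * f x) = c + d * measure_pmf.expectation p f"
proof -
  have "integrable (measure_pmf p) f"
    using assms by (intro measure_pmf.integrable_const_bound[where B=B]) (auto simp: AE_measure_pmf_iff)
  then show ?thesis by simp
qed

text \<open>Among test functions with values in \<open>[0, 1]\<close> the difference of expectations
  is largest for the indicator of the set where \<open>p\<close> is at least \<open>q\<close>, so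
  closeness on events suffices.\<close>

lemma expectation_le_of_prob_le:
  fixes f :: "nat \<Rightarrow> real"
  assumes p: "set_pmf p \<subseteq> {..<S}" and q: "set_pmf q \<subseteq> {..<S}"
    and le: "\<And>B. B \<subseteq> {..<S} \<Longrightarrow> measure_pmf.prob p B \<le> measure_pmf.prob q B + \<kappa>"
    and f: "\<And>y. y < S \<Longrightarrow> 0 \<le> f y \<and> f y \<le> 1"
  shows "measure_pmf.expectation p f \<le> measure_pmf.expectation q f + \<kappa>"
proof -
  define B where "B = {y\<in>{..<S}. pmf q y \<le> pmf p y}"
  have "measure_pmf.expectation p f - measure_pmf.expectation q f = (\<Sum>y<S. f y * (pmf p y - pmf q y))"
    using p q by (subst (1 2) integral_measure_pmf_real[where A="{..<S}"])
      (auto simp: sum_subtractf[symmetric] right_diff_distrib)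
  also have "\<dots> \<le> (\<Sum>y<S. if y \<in> B then pmf p y - pmf q y else 0)"
  proof (rule sum_mono)
    fix y assume "y \<in> {..<S}"
    with f[of y] show "f y * (pmf p y - pmf q y) \<le> (if y \<in> B then pmf p y - pmf q y else 0)"
      by (auto simp: B_def mult_left_le_one_le mult_nonneg_nonpos)
  qed
  also have "\<dots> = (\<Sum>y\<in>B. pmf p y - pmf q y)"
    by (simp add: sum.If_cases B_def Int_def)
  also have "\<dots> = measure_pmf.prob p B - measure_pmf.prob q B"
    by (simp add: sum_subtractf measure_measure_pmf_finite B_def)
  also have "\<dots> \<le> \<kappa>"
  proof -
    have "B \<subseteq> {..<S}" by (auto simp: B_def)
    from le[OF this] show ?thesis by simp
  qed
  finally show ?thesis by simp
qed

text \<open>The expected weight of the first triple of \<open>U\<close> met within \<open>m\<close>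
  stages. The recursion stops on entering \<open>U\<close>, so it uses transitions only outside
  \<open>U\<close>, which are the ones that the data estimates. With weight 1 it is the probability
  of visiting \<open>U\<close>.\<close>

primrec hit :: "model \<Rightarrow> policy \<Rightarrow> triple set \<Rightarrow> (triple \<Rightarrow> real) \<Rightarrow> nat \<Rightarrow> nat \<Rightarrow> nat \<Rightarrow> real" where
  "hit \<mu> \<pi> U w 0 h x = 0"
| "hit \<mu> \<pi> U w (Suc m) h x = (if (x, \<pi> x h, h) \<in> U then w (x, \<pi> x h, h)
     else measure_pmf.expectation (mtrans \<mu> x (\<pi> x h) h) (hit \<mu> \<pi> U w m (Suc h)))"

primrec steps_value :: "model \<Rightarrow> policy \<Rightarrow> nat \<Rightarrow> nat \<Rightarrow> nat \<Rightarrow> real" where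
  "steps_value \<mu> \<pi> 0 h x = 0"
| "steps_value \<mu> \<pi> (Suc m) h x = mean_rew \<mu> (x, \<pi> x h, h) +
     measure_pmf.expectation (mtrans \<mu> x (\<pi> x h) h) (steps_value \<mu> \<pi> m (Suc h))"

definition hit_init :: "nat \<Rightarrow> model \<Rightarrow> policy \<Rightarrow> triple set \<Rightarrow> (triple \<Rightarrow> real) \<Rightarrow> real" where
  "hit_init H \<mu> \<pi> U w = measure_pmf.expectation (minit \<mu>) (hit \<mu> \<pi> U w H 0)"

definition visit_prob :: "nat \<Rightarrow> model \<Rightarrow> policy \<Rightarrow> triple set \<Rightarrow> real" where
  "visit_prob H \<mu> \<pi> U = measure_pmf.prob (traj_pmf H \<mu> \<pi>) {\<tau>. \<exists>t\<in>U. visited t \<tau>}"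

lemma hit_0: "hit \<mu> \<pi> U w 0 h = (\<lambda>x. 0)"
  by auto

section \<open>Values and first visits, and their stability under a change of dynamics\<close>

context mdp begin

lemma step_ok:
  assumes "valid \<mu>" "\<pi> \<in> pols" "x < S" "h + Suc m \<le> H"
  shows "(x, \<pi> x h, h) \<in> trips" "set_pmf (mtrans \<mu> x (\<pi> x h) h) \<subseteq> {..<S}" "Suc h + m \<le> H" "\<pi> x h < A" "h < H"
    "set_pmf (mrew \<mu> x (\<pi> x h) h) \<subseteq> {0..1}"
  using assms policy_less[of \<pi> x h] validD[of \<mu> x "\<pi> x h" h] Rset_subset by (auto simp: triples_def)

lemma hit_bounds:
  assumes "valid \<mu>" "\<pi> \<in> pols" "\<And>t. t \<in> U \<inter> trips \<Longrightarrow> 0 \<le> w t \<and> w t \<le> 1"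
  shows "x < S \<Longrightarrow> h + m \<le> H \<Longrightarrow> 0 \<le> hit \<mu> \<pi> U w m h x \<and> hit \<mu> \<pi> U w m h x \<le> 1"
proof (induction m arbitrary: h x)
  case (Suc m)
  note ok = step_ok[OF assms(1,2) Suc.prems]
  show ?case
  proof (cases "(x, \<pi> x h, h) \<in> U")
    case False
    have "0 \<le> hit \<mu> \<pi> U w m (Suc h) y \<and> hit \<mu> \<pi> U w m (Suc h) y \<le> 1" if "y \<in> set_pmf (mtrans \<mu> x (\<pi> x h) h)" for y
      using Suc.IH ok that by auto
    from expectation_pmf_bounds[where p="mtrans \<mu> x (\<pi> x h) h" and f="hit \<mu> \<pi> U w m (Suc h)", OF this] show ?thesis using False by simp
  qed (use assms(3) ok in auto)
qed simp

lemma steps_value_bounds: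
  assumes "valid \<mu>" "\<pi> \<in> pols"
  shows "x < S \<Longrightarrow> h + m \<le> H \<Longrightarrow> 0 \<le> steps_value \<mu> \<pi> m h x \<and> steps_value \<mu> \<pi> m h x \<le> m"
proof (induction m arbitrary: h x)
  case (Suc m)
  note ok = step_ok[OF assms Suc.prems]
  have "0 \<le> steps_value \<mu> \<pi> m (Suc h) y \<and> steps_value \<mu> \<pi> m (Suc h) y \<le> m" if "y \<in> set_pmf (mtrans \<mu> x (\<pi> x h) h)" for y
    using Suc.IH ok that by auto
  from expectation_pmf_bounds[where p="mtrans \<mu> x (\<pi> x h) h" and f="steps_value \<mu> \<pi> m (Suc h)", OF this] mean_rew_bounds[OF assms(1) ok(1)] show ?case by simp
qed simp

lemma hit_init_bounds:
  assumes "valid \<mu>" "\<pi> \<in> pols" "\<And>t. t \<in> U \<inter> trips \<Longrightarrow> 0 \<le> w t \<and> w t \<le> 1"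
  shows "0 \<le> hit_init H \<mu> \<pi> U w" "hit_init H \<mu> \<pi> U w \<le> 1"
proof -
  have "0 \<le> hit \<mu> \<pi> U w H 0 y \<and> hit \<mu> \<pi> U w H 0 y \<le> 1" if "y \<in> set_pmf (minit \<mu>)" for y
    using that valid_minit[OF assms(1)] by (intro hit_bounds assms) auto
  from expectation_pmf_bounds[where p="minit \<mu>" and f="hit \<mu> \<pi> U w H 0", OF this] show "0 \<le> hit_init H \<mu> \<pi> U w" "hit_init H \<mu> \<pi> U w \<le> 1"
    by (auto simp: hit_init_def)
qed

text \<open>The mean reward at the first visit is one of the nonnegative summands of the
  return.\<close>

lemma hit_le_steps_value:
  assumes "valid \<mu>" "\<pi> \<in> pols"
  shows "x < S \<Longrightarrow> h + m \<le> H \<Longrightarrow> hit \<mu> \<pi> U (mean_rew \<mu>) m h x \<le> steps_value \<mu> \<pi> m h x"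
proof (induction m arbitrary: h x)
  case (Suc m)
  note ok = step_ok[OF assms Suc.prems]
  have s: "0 \<le> steps_value \<mu> \<pi> m (Suc h) y \<and> steps_value \<mu> \<pi> m (Suc h) y \<le> m" if "y \<in> set_pmf (mtrans \<mu> x (\<pi> x h) h)" for y
    using steps_value_bounds[OF assms] ok that by auto
  have h: "0 \<le> hit \<mu> \<pi> U (mean_rew \<mu>) m (Suc h) y \<and> hit \<mu> \<pi> U (mean_rew \<mu>) m (Suc h) y \<le> 1" if "y \<in> set_pmf (mtrans \<mu> x (\<pi> x h) h)" for y
    using that ok by (intro hit_bounds assms) (auto intro: mean_rew_bounds assms)
  have "measure_pmf.expectation (mtrans \<mu> x (\<pi> x h) h) (hit \<mu> \<pi> U (mean_rew \<mu>) m (Suc h)) \<le>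
     measure_pmf.expectation (mtrans \<mu> x (\<pi> x h) h) (steps_value \<mu> \<pi> m (Suc h))"
  proof (rule expectation_pmf_mono[where B="max 1 (real m)"])
    fix y assume y: "y \<in> set_pmf (mtrans \<mu> x (\<pi> x h) h)"
    show "hit \<mu> \<pi> U (mean_rew \<mu>) m (Suc h) y \<le> steps_value \<mu> \<pi> m (Suc h) y" using Suc.IH ok y by auto
    show "\<bar>hit \<mu> \<pi> U (mean_rew \<mu>) m (Suc h) y\<bar> \<le> max 1 (real m)" using h[OF y] by auto
    show "\<bar>steps_value \<mu> \<pi> m (Suc h) y\<bar> \<le> max 1 (real m)" using s[OF y] by auto
  qed
  moreover have "0 \<le> measure_pmf.expectation (mtrans \<mu> x (\<pi> x h) h) (steps_value \<mu> \<pi> m (Suc h))"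
    using s by (rule expectation_pmf_bounds)
  ultimately show ?case using mean_rew_bounds[OF assms(1) ok(1)] by simp
qed simp

text \<open>Until \<open>U\<close> is entered every stage pays at most \<open>c\<close>; from the
  entry on, the remaining stages pay at most 1 each.\<close>

lemma steps_value_le_hit:
  fixes c :: real
  assumes "valid \<mu>" "\<pi> \<in> pols" "\<And>t. t \<in> trips - U \<Longrightarrow> mean_rew \<mu> t \<le> c" "0 \<le> c"
  shows "x < S \<Longrightarrow> h + m \<le> H \<Longrightarrow> steps_value \<mu> \<pi> m h x \<le> m * c + m * hit \<mu> \<pi> U (\<lambda>_. 1) m h x"
proof (induction m arbitrary: h x)
  case (Suc m)
  note ok = step_ok[OF assms(1,2) Suc.prems]
  show ?case
  proof (cases "(x, \<pi> x h, h) \<in> U")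
    case True
    have "0 \<le> real (Suc m) * c" using assms(4) by simp
    then show ?thesis using True steps_value_bounds[OF assms(1,2) Suc.prems] by (simp del: steps_value.simps of_nat_Suc)
  next
    case False
    let ?p = "mtrans \<mu> x (\<pi> x h) h"
    have s: "0 \<le> steps_value \<mu> \<pi> m (Suc h) y \<and> steps_value \<mu> \<pi> m (Suc h) y \<le> m" if "y \<in> set_pmf ?p" for y
      using steps_value_bounds[OF assms(1,2)] ok that by auto
    have h: "0 \<le> hit \<mu> \<pi> U (\<lambda>_. 1) m (Suc h) y \<and> hit \<mu> \<pi> U (\<lambda>_. 1) m (Suc h) y \<le> 1" if "y \<in> set_pmf ?p" for y
      using that ok by (intro hit_bounds assms) auto
    have "measure_pmf.expectation ?p (steps_value \<mu> \<pi> m (Suc h)) \<le>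
      measure_pmf.expectation ?p (\<lambda>y. m * c + m * hit \<mu> \<pi> U (\<lambda>_. 1) m (Suc h) y)"
    proof (rule expectation_pmf_mono[where B="m * c + m"])
      fix y assume y: "y \<in> set_pmf ?p"
      have mc: "0 \<le> m * c" using assms(4) by simp
      show "steps_value \<mu> \<pi> m (Suc h) y \<le> m * c + m * hit \<mu> \<pi> U (\<lambda>_. 1) m (Suc h) y" using Suc.IH ok y by auto
      show "\<bar>steps_value \<mu> \<pi> m (Suc h) y\<bar> \<le> m * c + m" using s[OF y] mc by auto
      have "0 \<le> m * hit \<mu> \<pi> U (\<lambda>_. 1) m (Suc h) y" "m * hit \<mu> \<pi> U (\<lambda>_. 1) m (Suc h) y \<le> m * 1"
        using h[OF y] mult_left_mono[of "hit \<mu> \<pi> U (\<lambda>_. 1) m (Suc h) y" 1 "real m"] by auto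
      then show "\<bar>m * c + m * hit \<mu> \<pi> U (\<lambda>_. 1) m (Suc h) y\<bar> \<le> m * c + m" using mc by linarith
    qed
    also have "\<dots> = m * c + m * measure_pmf.expectation ?p (hit \<mu> \<pi> U (\<lambda>_. 1) m (Suc h))"
      using h by (intro expectation_pmf_affine[where B=1]) auto
    finally have "steps_value \<mu> \<pi> (Suc m) h x \<le> c + (m * c + m * measure_pmf.expectation ?p (hit \<mu> \<pi> U (\<lambda>_. 1) m (Suc h)))"
      using assms(3)[of "(x, \<pi> x h, h)"] ok(1) False by simp
    moreover have "0 \<le> measure_pmf.expectation ?p (hit \<mu> \<pi> U (\<lambda>_. 1) m (Suc h))"
      using h by (rule expectation_pmf_bounds)
    ultimately show ?thesis using False by (simp add: algebra_simps)
  qed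
qed simp

text \<open>The two chains are exchanged one transition at a time, each exchange costing at most
  \<open>\<kappa>\<close> because the continuation has values in \<open>[0, 1]\<close>. With
  \<open>m\<close> stages left only \<open>m - 1\<close> transitions can matter: the last one leads
  past the considered stages, where \<open>hit\<close> is 0.\<close>

lemma hit_close:
  fixes \<kappa> :: real
  assumes \<mu>: "valid \<mu>" "valid \<nu>" and \<pi>: "\<pi> \<in> pols" and w: "\<And>t. t \<in> U \<inter> trips \<Longrightarrow> 0 \<le> w t \<and> w t \<le> 1"
    and \<kappa>: "0 \<le> \<kappa>"
    and close: "\<And>x a h B. (x, a, h) \<in> trips - U \<Longrightarrow> Suc h < H \<Longrightarrow> B \<subseteq> {..<S} \<Longrightarrow>
       measure_pmf.prob (mtrans \<mu> x a h) B \<le> measure_pmf.prob (mtrans \<nu> x a h) B + \<kappa>"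
  shows "x < S \<Longrightarrow> h + m \<le> H \<Longrightarrow> hit \<mu> \<pi> U w m h x \<le> hit \<nu> \<pi> U w m h x + real (m - 1) * \<kappa>"
proof (induction m arbitrary: h x)
  case (Suc m)
  note ok = step_ok[OF \<mu>(1) \<pi> Suc.prems] and ok' = step_ok[OF \<mu>(2) \<pi> Suc.prems]
  show ?case
  proof (cases "(x, \<pi> x h, h) \<in> U \<or> m = 0")
    case True
    then show ?thesis using \<kappa> by (auto simp: hit_0)
  next
    case False
    then have "(x, \<pi> x h, h) \<in> trips - U" "Suc h < H" using ok(1) Suc.prems by auto
    let ?p = "mtrans \<mu> x (\<pi> x h) h" and ?q = "mtrans \<nu> x (\<pi> x h) h"
    have h: "0 \<le> hit \<mu> \<pi> U w m (Suc h) y \<and> hit \<mu> \<pi> U w m (Suc h) y \<le> 1" if "y < S" for y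
      using that ok by (intro hit_bounds \<mu> \<pi> w) auto
    have h': "0 \<le> hit \<nu> \<pi> U w m (Suc h) y \<and> hit \<nu> \<pi> U w m (Suc h) y \<le> 1" if "y < S" for y
      using that ok by (intro hit_bounds \<mu> \<pi> w) auto
    have "measure_pmf.expectation ?p (hit \<mu> \<pi> U w m (Suc h)) \<le>
      measure_pmf.expectation ?p (\<lambda>y. real (m - 1) * \<kappa> + 1 * hit \<nu> \<pi> U w m (Suc h) y)"
    proof (rule expectation_pmf_mono[where B="real (m - 1) * \<kappa> + 1"])
      fix y assume "y \<in> set_pmf ?p"
      then have y: "y < S" using ok by auto
      have "0 \<le> real (m - 1) * \<kappa>" using \<kappa> by simp
      then show "\<bar>hit \<mu> \<pi> U w m (Suc h) y\<bar> \<le> real (m - 1) * \<kappa> + 1"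
        "\<bar>real (m - 1) * \<kappa> + 1 * hit \<nu> \<pi> U w m (Suc h) y\<bar> \<le> real (m - 1) * \<kappa> + 1"
        using h[OF y] h'[OF y] by auto
      show "hit \<mu> \<pi> U w m (Suc h) y \<le> real (m - 1) * \<kappa> + 1 * hit \<nu> \<pi> U w m (Suc h) y"
        using Suc.IH[OF y ok(3)] by simp
    qed
    also have "\<dots> = real (m - 1) * \<kappa> + 1 * measure_pmf.expectation ?p (hit \<nu> \<pi> U w m (Suc h))"
      using h' ok by (intro expectation_pmf_affine[where B=1]) fastforce
    also have "measure_pmf.expectation ?p (hit \<nu> \<pi> U w m (Suc h)) \<le> measure_pmf.expectation ?q (hit \<nu> \<pi> U w m (Suc h)) + \<kappa>"
      using ok ok' h' close \<open>(x, \<pi> x h, h) \<in> trips - U\<close> \<open>Suc h < H\<close> by (intro expectation_le_of_prob_le) auto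
    finally have "measure_pmf.expectation ?p (hit \<mu> \<pi> U w m (Suc h)) \<le>
       measure_pmf.expectation ?q (hit \<nu> \<pi> U w m (Suc h)) + (real (m - 1) * \<kappa> + \<kappa>)" by simp
    moreover have "real (m - 1) * \<kappa> + \<kappa> = m * \<kappa>" using False by (simp add: of_nat_diff algebra_simps)
    ultimately show ?thesis using False by simp
  qed
qed simp

lemma hit_init_close:
  fixes \<kappa> :: real
  assumes \<mu>: "valid \<mu>" "valid \<nu>" and \<pi>: "\<pi> \<in> pols" and w: "\<And>t. t \<in> U \<inter> trips \<Longrightarrow> 0 \<le> w t \<and> w t \<le> 1"
    and \<kappa>: "0 \<le> \<kappa>"
    and close: "\<And>x a h B. (x, a, h) \<in> trips - U \<Longrightarrow> Suc h < H \<Longrightarrow> B \<subseteq> {..<S} \<Longrightarrow>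
       measure_pmf.prob (mtrans \<mu> x a h) B \<le> measure_pmf.prob (mtrans \<nu> x a h) B + \<kappa>"
    and init: "\<And>B. B \<subseteq> {..<S} \<Longrightarrow> measure_pmf.prob (minit \<mu>) B \<le> measure_pmf.prob (minit \<nu>) B + \<kappa>"
  shows "hit_init H \<mu> \<pi> U w \<le> hit_init H \<nu> \<pi> U w + H * \<kappa>"
proof -
  let ?k = "real (H - 1) * \<kappa>"
  have h: "0 \<le> hit \<mu> \<pi> U w H 0 y \<and> hit \<mu> \<pi> U w H 0 y \<le> 1" "0 \<le> hit \<nu> \<pi> U w H 0 y \<and> hit \<nu> \<pi> U w H 0 y \<le> 1" if "y < S" for y
    using that by (intro hit_bounds \<mu> \<pi> w; auto)+
  have k: "0 \<le> ?k" using \<kappa> by simp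
  have "hit_init H \<mu> \<pi> U w \<le> measure_pmf.expectation (minit \<mu>) (\<lambda>y. ?k + 1 * hit \<nu> \<pi> U w H 0 y)"
    unfolding hit_init_def
  proof (rule expectation_pmf_mono[where B="?k + 1"])
    fix y assume "y \<in> set_pmf (minit \<mu>)"
    then have y: "y < S" using valid_minit[OF \<mu>(1)] by auto
    show "\<bar>hit \<mu> \<pi> U w H 0 y\<bar> \<le> ?k + 1" "\<bar>?k + 1 * hit \<nu> \<pi> U w H 0 y\<bar> \<le> ?k + 1"
      using h[OF y] k by auto
    show "hit \<mu> \<pi> U w H 0 y \<le> ?k + 1 * hit \<nu> \<pi> U w H 0 y"
    proof -
      have "hit \<mu> \<pi> U w H 0 y \<le> hit \<nu> \<pi> U w H 0 y + real (H - 1) * \<kappa>"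
        by (rule hit_close) (use \<mu> \<pi> w \<kappa> close y in auto)
      then show ?thesis by simp
    qed
  qed
  also have "\<dots> = ?k + 1 * measure_pmf.expectation (minit \<mu>) (hit \<nu> \<pi> U w H 0)"
    using h valid_minit[OF \<mu>(1)] by (intro expectation_pmf_affine[where B=1]) fastforce
  also have "measure_pmf.expectation (minit \<mu>) (hit \<nu> \<pi> U w H 0) \<le> measure_pmf.expectation (minit \<nu>) (hit \<nu> \<pi> U w H 0) + \<kappa>"
    using h valid_minit \<mu> init by (intro expectation_le_of_prob_le) auto
  finally have "hit_init H \<mu> \<pi> U w \<le> hit_init H \<nu> \<pi> U w + (?k + \<kappa>)" by (simp add: hit_init_def)
  \<comment> \<open>One error term for the initial law joins those of the \<open>H - 1\<close>
    transitions.\<close>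
  moreover have "?k + \<kappa> = H * \<kappa>" using pos by (simp add: of_nat_diff algebra_simps)
  ultimately show ?thesis by simp
qed

lemma visit_steps:
  assumes "valid \<mu>" "\<pi> \<in> pols"
  shows "x < S \<Longrightarrow> h + m \<le> H \<Longrightarrow>
    measure_pmf.prob (traj_steps m \<mu> \<pi> h x) {\<tau>. \<exists>i<length \<tau>. (fst (\<tau> ! i), fst (snd (\<tau> ! i)), h + i) \<in> U} =
    hit \<mu> \<pi> U (\<lambda>_. 1) m h x"
proof (induction m arbitrary: h x)
  case (Suc m)
  note ok = step_ok[OF assms Suc.prems]
  define V where "V = (\<lambda>h. {\<tau> :: traj. \<exists>i<length \<tau>. (fst (\<tau> ! i), fst (snd (\<tau> ! i)), h + i) \<in> U})"
  have vim: "(#) (x, \<pi> x h, r) -` V h = (if (x, \<pi> x h, h) \<in> U then UNIV else V (Suc h))" for r :: real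
    by (auto simp: V_def less_Suc_eq_0_disj)
  have "measure_pmf.prob (traj_steps (Suc m) \<mu> \<pi> h x) (V h) =
    measure_pmf.expectation (mtrans \<mu> x (\<pi> x h) h) (\<lambda>y. if (x, \<pi> x h, h) \<in> U then 1
      else measure_pmf.prob (traj_steps m \<mu> \<pi> (Suc h) y) (V (Suc h)))"
    by (cases "(x, \<pi> x h, h) \<in> U") (simp_all add: prob_bind_pmf vim)
  also have "\<dots> = hit \<mu> \<pi> U (\<lambda>_. 1) (Suc m) h x"
  proof (cases "(x, \<pi> x h, h) \<in> U")
    case False
    have "measure_pmf.expectation (mtrans \<mu> x (\<pi> x h) h) (\<lambda>y. measure_pmf.prob (traj_steps m \<mu> \<pi> (Suc h) y) (V (Suc h))) =
      measure_pmf.expectation (mtrans \<mu> x (\<pi> x h) h) (hit \<mu> \<pi> U (\<lambda>_. 1) m (Suc h))"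
      using ok Suc.IH[of _ "Suc h"] by (intro expectation_pmf_cong) (auto simp: V_def)
    then show ?thesis using False by simp
  qed simp
  finally show ?case by (simp only: V_def)
qed simp

lemma visit_prob_hit:
  assumes "valid \<mu>" "\<pi> \<in> pols"
  shows "visit_prob H \<mu> \<pi> U = hit_init H \<mu> \<pi> U (\<lambda>_. 1)"
proof -
  have "{\<tau>. \<exists>t\<in>U. visited t \<tau>} = {\<tau>. \<exists>i<length \<tau>. (fst (\<tau> ! i), fst (snd (\<tau> ! i)), 0 + i) \<in> U}"
    by (force simp: visited_def)
  then have "visit_prob H \<mu> \<pi> U = measure_pmf.expectation (minit \<mu>) (\<lambda>x.
     measure_pmf.prob (traj_steps H \<mu> \<pi> 0 x) {\<tau>. \<exists>i<length \<tau>. (fst (\<tau> ! i), fst (snd (\<tau> ! i)), 0 + i) \<in> U})"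
    by (simp add: visit_prob_def traj_pmf_def prob_bind_pmf)
  also have "\<dots> = hit_init H \<mu> \<pi> U (\<lambda>_. 1)"
    unfolding hit_init_def using valid_minit[OF assms(1)]
    by (intro expectation_pmf_cong visit_steps assms) auto
  finally show ?thesis .
qed

lemma steps_value_eq:
  assumes "valid \<mu>" "\<pi> \<in> pols"
  shows "x < S \<Longrightarrow> h + m \<le> H \<Longrightarrow>
    measure_pmf.expectation (traj_steps m \<mu> \<pi> h x) (\<lambda>\<tau>. \<Sum>i<length \<tau>. mean_rew \<mu> (fst (\<tau> ! i), fst (snd (\<tau> ! i)), h + i)) =
    steps_value \<mu> \<pi> m h x"
proof (induction m arbitrary: h x)
  case (Suc m)
  note ok = step_ok[OF assms Suc.prems]
  let ?f = "\<lambda>h \<tau>. \<Sum>i<length \<tau>. mean_rew \<mu> (fst (\<tau> ! i), fst (snd (\<tau> ! i)), h + i)"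
  have fb: "0 \<le> ?f h' \<tau> \<and> ?f h' \<tau> \<le> real H" if "\<tau> \<in> set_pmf (traj_steps m' \<mu> \<pi> h' x')" "x' < S" "h' + m' \<le> H" for \<tau> h' x' m'
  proof -
    have \<tau>: "\<tau> \<in> trajs m'" using set_traj_steps[OF assms that(2,3)] that(1) by auto
    have "(fst (\<tau> ! i), fst (snd (\<tau> ! i)), h' + i) \<in> trips" if "i < length \<tau>" for i
      using trajs_nth[OF \<tau>] that \<open>h' + m' \<le> H\<close> \<tau> by (auto simp: triples_def trajs_def)
    then have b: "0 \<le> mean_rew \<mu> (fst (\<tau> ! i), fst (snd (\<tau> ! i)), h' + i) \<and>
        mean_rew \<mu> (fst (\<tau> ! i), fst (snd (\<tau> ! i)), h' + i) \<le> 1" if "i < length \<tau>" for i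
      using mean_rew_bounds[OF assms(1)] that by blast
    have "?f h' \<tau> \<le> real (card {..<length \<tau>}) * 1" using b by (intro sum_bounded_above) auto
    moreover have "length \<tau> \<le> H" using \<tau> that(3) by (simp add: trajs_def)
    ultimately show ?thesis using b by (auto intro: sum_nonneg)
  qed
  have cons: "?f h ((x, \<pi> x h, r) # \<tau>) = mean_rew \<mu> (x, \<pi> x h, h) + 1 * ?f (Suc h) \<tau>" for r :: real and \<tau>
    by (simp add: sum.lessThan_Suc_shift del: sum.lessThan_Suc)
  let ?tr = "mtrans \<mu> x (\<pi> x h) h"
  let ?k = "\<lambda>r. bind_pmf ?tr (\<lambda>x'. map_pmf ((#) (x, \<pi> x h, r)) (traj_steps m \<mu> \<pi> (Suc h) x'))"
  have inner: "measure_pmf.expectation (?k r) (?f h) = steps_value \<mu> \<pi> (Suc m) h x" if r: "r \<in> set_pmf (mrew \<mu> x (\<pi> x h) h)" for r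
  proof -
    have "measure_pmf.expectation (?k r) (?f h) = measure_pmf.expectation ?tr (\<lambda>x'.
        measure_pmf.expectation (map_pmf ((#) (x, \<pi> x h, r)) (traj_steps m \<mu> \<pi> (Suc h) x')) (?f h))"
    proof (rule expectation_bind_pmf)
      fix y assume "y \<in> set_pmf (?k r)"
      then have "y \<in> set_pmf (traj_steps (Suc m) \<mu> \<pi> h x)" using r by auto
      then show "0 \<le> ?f h y \<and> ?f h y \<le> real H" using fb Suc.prems by blast
    qed
    also have "\<dots> = measure_pmf.expectation ?tr (\<lambda>x'. mean_rew \<mu> (x, \<pi> x h, h) + 1 * steps_value \<mu> \<pi> m (Suc h) x')"
    proof (rule expectation_pmf_cong)
      fix y assume "y \<in> set_pmf ?tr"
      then have y: "y < S" using ok by auto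
      have "measure_pmf.expectation (map_pmf ((#) (x, \<pi> x h, r)) (traj_steps m \<mu> \<pi> (Suc h) y)) (?f h) =
         measure_pmf.expectation (traj_steps m \<mu> \<pi> (Suc h) y) (\<lambda>\<tau>. mean_rew \<mu> (x, \<pi> x h, h) + 1 * ?f (Suc h) \<tau>)"
        unfolding integral_map_pmf cons ..
      also have "\<dots> = mean_rew \<mu> (x, \<pi> x h, h) + 1 * measure_pmf.expectation (traj_steps m \<mu> \<pi> (Suc h) y) (?f (Suc h))"
        using fb[OF _ y ok(3)] by (intro expectation_pmf_affine[where B="real H"]) auto
      finally show "measure_pmf.expectation (map_pmf ((#) (x, \<pi> x h, r)) (traj_steps m \<mu> \<pi> (Suc h) y)) (?f h) =
         mean_rew \<mu> (x, \<pi> x h, h) + 1 * steps_value \<mu> \<pi> m (Suc h) y"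
        using Suc.IH[OF y ok(3)] by simp
    qed
    also have "\<dots> = mean_rew \<mu> (x, \<pi> x h, h) + 1 * measure_pmf.expectation ?tr (steps_value \<mu> \<pi> m (Suc h))"
      using steps_value_bounds[OF assms _ ok(3)] ok(2) by (intro expectation_pmf_affine[where B="real m"]) auto
    finally show ?thesis by simp
  qed
  have "measure_pmf.expectation (traj_steps (Suc m) \<mu> \<pi> h x) (?f h) =
     measure_pmf.expectation (mrew \<mu> x (\<pi> x h) h) (\<lambda>r. measure_pmf.expectation (?k r) (?f h))"
    unfolding traj_steps.simps
  proof (rule expectation_bind_pmf)
    fix y assume "y \<in> set_pmf (bind_pmf (mrew \<mu> x (\<pi> x h) h) ?k)"
    then have "y \<in> set_pmf (traj_steps (Suc m) \<mu> \<pi> h x)" by simp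
    then show "0 \<le> ?f h y \<and> ?f h y \<le> real H" using fb Suc.prems by blast
  qed
  also have "\<dots> = measure_pmf.expectation (mrew \<mu> x (\<pi> x h) h) (\<lambda>r. steps_value \<mu> \<pi> (Suc m) h x)"
    by (intro expectation_pmf_cong inner)
  finally show ?case by simp
qed simp

lemma Vpi_eq:
  assumes "valid \<mu>" "\<pi> \<in> pols"
  shows "Vpi H \<mu> \<pi> = measure_pmf.expectation (minit \<mu>) (steps_value \<mu> \<pi> H 0)"
proof -
  have "Vpi H \<mu> \<pi> = measure_pmf.expectation (minit \<mu>) (\<lambda>x. measure_pmf.expectation (traj_steps H \<mu> \<pi> 0 x)
      (\<lambda>\<tau>. \<Sum>i<length \<tau>. mean_rew \<mu> (fst (\<tau> ! i), fst (snd (\<tau> ! i)), i)))"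
    unfolding Vpi_def traj_pmf_def
  proof (rule expectation_bind_pmf)
    fix \<tau> assume "\<tau> \<in> set_pmf (minit \<mu> \<bind> traj_steps H \<mu> \<pi> 0)"
    then have "\<tau> \<in> trajs H" using set_traj_pmf[OF assms] by (auto simp: traj_pmf_def)
    then show "0 \<le> (\<Sum>i<length \<tau>. mean_rew \<mu> (fst (\<tau> ! i), fst (snd (\<tau> ! i)), i)) \<and>
      (\<Sum>i<length \<tau>. mean_rew \<mu> (fst (\<tau> ! i), fst (snd (\<tau> ! i)), i)) \<le> real H"
      using sum_mean_rew_bounds[OF assms(1)] by auto
  qed
  also have "\<dots> = measure_pmf.expectation (minit \<mu>) (steps_value \<mu> \<pi> H 0)"
    using valid_minit[OF assms(1)] steps_value_eq[OF assms, of _ 0 H] by (intro expectation_pmf_cong) auto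
  finally show ?thesis .
qed

lemma Vpi_ge_hit:
  assumes "valid \<mu>" "\<pi> \<in> pols"
  shows "hit_init H \<mu> \<pi> U (mean_rew \<mu>) \<le> Vpi H \<mu> \<pi>"
  unfolding Vpi_eq[OF assms] hit_init_def
proof (rule expectation_pmf_mono[where B="max 1 (real H)"])
  fix y assume "y \<in> set_pmf (minit \<mu>)"
  then have y: "y < S" using valid_minit[OF assms(1)] by auto
  show "hit \<mu> \<pi> U (mean_rew \<mu>) H 0 y \<le> steps_value \<mu> \<pi> H 0 y"
    using hit_le_steps_value[OF assms y] by simp
  have "0 \<le> hit \<mu> \<pi> U (mean_rew \<mu>) H 0 y \<and> hit \<mu> \<pi> U (mean_rew \<mu>) H 0 y \<le> 1"
    using y by (intro hit_bounds assms) (auto intro: mean_rew_bounds assms)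
  then show "\<bar>hit \<mu> \<pi> U (mean_rew \<mu>) H 0 y\<bar> \<le> max 1 (real H)" by auto
  show "\<bar>steps_value \<mu> \<pi> H 0 y\<bar> \<le> max 1 (real H)"
    using steps_value_bounds[OF assms y, of 0 H] by auto
qed

lemma Vpi_le_visit:
  fixes c :: real
  assumes "valid \<mu>" "\<pi> \<in> pols" "\<And>t. t \<in> trips - U \<Longrightarrow> mean_rew \<mu> t \<le> c" "0 \<le> c"
  shows "Vpi H \<mu> \<pi> \<le> H * c + H * visit_prob H \<mu> \<pi> U"
proof -
  have h: "0 \<le> hit \<mu> \<pi> U (\<lambda>_. 1) H 0 y \<and> hit \<mu> \<pi> U (\<lambda>_. 1) H 0 y \<le> 1" if "y \<in> set_pmf (minit \<mu>)" for y
    using that valid_minit[OF assms(1)] by (intro hit_bounds assms) auto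
  have Hc: "0 \<le> H * c" using assms(4) by simp
  have "Vpi H \<mu> \<pi> \<le> measure_pmf.expectation (minit \<mu>) (\<lambda>y. H * c + H * hit \<mu> \<pi> U (\<lambda>_. 1) H 0 y)"
    unfolding Vpi_eq[OF assms(1,2)]
  proof (rule expectation_pmf_mono[where B="H * c + H"])
    fix y assume y': "y \<in> set_pmf (minit \<mu>)"
    then have y: "y < S" using valid_minit[OF assms(1)] by auto
    show "steps_value \<mu> \<pi> H 0 y \<le> H * c + H * hit \<mu> \<pi> U (\<lambda>_. 1) H 0 y"
      using steps_value_le_hit[OF assms y] by simp
    show "\<bar>steps_value \<mu> \<pi> H 0 y\<bar> \<le> H * c + H"
      using steps_value_bounds[OF assms(1,2) y, of 0 H] Hc by auto
    have "0 \<le> H * hit \<mu> \<pi> U (\<lambda>_. 1) H 0 y" "H * hit \<mu> \<pi> U (\<lambda>_. 1) H 0 y \<le> H * 1"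
      using h[OF y'] mult_left_mono[of "hit \<mu> \<pi> U (\<lambda>_. 1) H 0 y" 1 "real H"] by auto
    then show "\<bar>H * c + H * hit \<mu> \<pi> U (\<lambda>_. 1) H 0 y\<bar> \<le> H * c + H" using Hc by linarith
  qed
  also have "\<dots> = H * c + H * visit_prob H \<mu> \<pi> U"
    unfolding visit_prob_hit[OF assms(1,2)] hit_init_def
    using h by (intro expectation_pmf_affine[where B=1]) auto
  finally show ?thesis .
qed

end

section \<open>The incentive to explore\<close>

context mdp begin

text \<open>With the weight concentrated on \<open>t\<close>, \<open>hit\<close> is the probability
  that \<open>t\<close> is the first triple of \<open>U\<close> to be visited. These coefficients do
  not involve \<open>w\<close>, so rewards can be averaged over a posterior while the dynamics stay
  fixed.\<close>

lemma hit_linear: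
  assumes "valid \<mu>" "\<pi> \<in> pols" "finite U"
  shows "x < S \<Longrightarrow> h + m \<le> H \<Longrightarrow>
    hit \<mu> \<pi> U w m h x = (\<Sum>t\<in>U. w t * hit \<mu> \<pi> U (\<lambda>s. if s = t then 1 else 0) m h x)"
proof (induction m arbitrary: h x)
  case (Suc m)
  note ok = step_ok[OF assms(1,2) Suc.prems]
  let ?p = "mtrans \<mu> x (\<pi> x h) h"
  let ?i = "\<lambda>t. hit \<mu> \<pi> U (\<lambda>s. if s = t then 1 else 0) m (Suc h)"
  show ?case
  proof (cases "(x, \<pi> x h, h) \<in> U")
    case True
    have "(\<Sum>t\<in>U. w t * (if (x, \<pi> x h, h) = t then 1 else 0)) = (\<Sum>t\<in>U. if t = (x, \<pi> x h, h) then w t else 0)"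
      by (intro sum.cong) auto
    then show ?thesis using True assms(3) by simp
  next
    case False
    have "measure_pmf.expectation ?p (hit \<mu> \<pi> U w m (Suc h)) = measure_pmf.expectation ?p (\<lambda>y. \<Sum>t\<in>U. w t * ?i t y)"
      using ok by (intro expectation_pmf_cong Suc.IH) auto
    also have "\<dots> = (\<Sum>t\<in>U. measure_pmf.expectation ?p (\<lambda>y. w t * ?i t y))"
    proof (rule Bochner_Integration.integral_sum)
      fix t
      have "\<bar>?i t y\<bar> \<le> 1" if "y \<in> set_pmf ?p" for y
        using that ok hit_bounds[OF assms(1,2), of U "\<lambda>s. if s = t then 1 else 0" y "Suc h" m] by auto
      then show "integrable (measure_pmf ?p) (\<lambda>y. w t * ?i t y)"
        by (intro integrable_mult_right measure_pmf.integrable_const_bound[where B=1]) (auto simp: AE_measure_pmf_iff)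
    qed
    finally show ?thesis using False by simp
  qed
qed simp

lemma hit_init_linear:
  assumes "valid \<mu>" "\<pi> \<in> pols" "finite U"
  shows "hit_init H \<mu> \<pi> U w = (\<Sum>t\<in>U. w t * hit_init H \<mu> \<pi> U (\<lambda>s. if s = t then 1 else 0))"
proof -
  let ?i = "\<lambda>t. hit \<mu> \<pi> U (\<lambda>s. if s = t then 1 else 0) H 0"
  have "hit_init H \<mu> \<pi> U w = measure_pmf.expectation (minit \<mu>) (\<lambda>y. \<Sum>t\<in>U. w t * ?i t y)"
    unfolding hit_init_def using valid_minit[OF assms(1)]
    by (intro expectation_pmf_cong hit_linear assms) auto
  also have "\<dots> = (\<Sum>t\<in>U. measure_pmf.expectation (minit \<mu>) (\<lambda>y. w t * ?i t y))"
  proof (rule Bochner_Integration.integral_sum)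
    fix t
    have "\<bar>?i t y\<bar> \<le> 1" if "y \<in> set_pmf (minit \<mu>)" for y
      using that valid_minit[OF assms(1)] hit_bounds[OF assms(1,2), of U "\<lambda>s. if s = t then 1 else 0" y 0 H] by auto
    then show "integrable (measure_pmf (minit \<mu>)) (\<lambda>y. w t * ?i t y)"
      by (intro integrable_mult_right measure_pmf.integrable_const_bound[where B=1]) (auto simp: AE_measure_pmf_iff)
  qed
  finally show ?thesis by (simp add: hit_init_def)
qed

lemma visit_prob_bounds: "0 \<le> visit_prob H \<mu> \<pi> U" "visit_prob H \<mu> \<pi> U \<le> 1"
  by (auto simp: visit_prob_def)

lemma visit_prob_all:
  assumes "valid \<mu>" "\<pi> \<in> pols"
  shows "visit_prob H \<mu> \<pi> trips = 1"
proof -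
  obtain m where H: "H = Suc m" using pos by (cases H) auto
  have "hit_init H \<mu> \<pi> trips (\<lambda>_. 1) = measure_pmf.expectation (minit \<mu>) (\<lambda>y. 1)"
    unfolding hit_init_def
  proof (rule expectation_pmf_cong)
    fix y assume "y \<in> set_pmf (minit \<mu>)"
    then have "y < S" using valid_minit[OF assms(1)] by auto
    then have "(y, \<pi> y 0, 0) \<in> trips" using policy_less[OF assms(2)] pos by (auto simp: triples_def)
    then show "hit \<mu> \<pi> trips (\<lambda>_. 1) H 0 y = 1" by (simp add: H)
  qed
  then show ?thesis using visit_prob_hit[OF assms] by simp
qed

lemma visit_prob_ge:
  "t \<in> U \<Longrightarrow> measure_pmf.prob (traj_pmf H \<mu> \<pi>) {\<tau>. visited t \<tau>} \<le> visit_prob H \<mu> \<pi> U"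
  unfolding visit_prob_def by (intro measure_pmf.finite_measure_mono) auto

text \<open>Fixing the law of the first visit to \<open>U\<close> to that of the true model \<open>\<mu>\<close> decouples it from the
  posterior rewards, so that the bound \<open>r_alt\<close> on each posterior mean can be applied.\<close>

lemma lik_hit_ge:
  assumes \<mu>: "valid \<mu>" and \<pi>: "\<pi> \<in> pols" and es: "raw_ok es" and U: "U \<subseteq> trips"
  shows "r_alt S A H prior * visit_prob H \<mu> \<pi> U * (\<integral>\<nu>. lik H (U, es) \<nu> \<partial>prior) \<le>
    (\<integral>\<nu>. lik H (U, es) \<nu> * hit_init H \<mu> \<pi> U (mean_rew \<nu>) \<partial>prior)"
proof -
  have fin: "finite U" using U finite_triples finite_subset by blast
  let ?a = "\<lambda>t. hit_init H \<mu> \<pi> U (\<lambda>s. if s = t then 1 else 0)"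
  let ?L = "\<integral>\<nu>. lik H (U, es) \<nu> \<partial>prior"
  have a: "0 \<le> ?a t" for t
    by (rule hit_init_bounds[OF \<mu> \<pi>]) auto
  have int: "integrable prior (\<lambda>\<nu>. lik H (U, es) \<nu> * mean_rew \<nu> t)" if "t \<in> U" for t
  proof (rule integrable_lik_times[OF es, where B=1])
    have t: "t \<in> trips" using that U by auto
    show "(\<lambda>\<nu>. mean_rew \<nu> t) \<in> borel_measurable prior" by (rule mean_rew_measurable[OF t])
    show "\<bar>mean_rew \<nu> t\<bar> \<le> 1" if "valid \<nu>" for \<nu>
      using mean_rew_bounds[OF that t] by simp
  qed
  have "r_alt S A H prior * visit_prob H \<mu> \<pi> U * ?L = (\<Sum>t\<in>U. (r_alt S A H prior * ?L) * ?a t)"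
    unfolding visit_prob_hit[OF \<mu> \<pi>] hit_init_linear[OF \<mu> \<pi> fin, of "\<lambda>_. 1"]
    by (simp add: sum_distrib_left sum_distrib_right mult_ac)
  also have "\<dots> \<le> (\<Sum>t\<in>U. (\<integral>\<nu>. lik H (U, es) \<nu> * mean_rew \<nu> t \<partial>prior) * ?a t)"
    by (intro sum_mono mult_right_mono r_alt_le es U a)
  also have "\<dots> = (\<Sum>t\<in>U. (\<integral>\<nu>. lik H (U, es) \<nu> * mean_rew \<nu> t * ?a t \<partial>prior))"
    by simp
  also have "\<dots> = (\<integral>\<nu>. (\<Sum>t\<in>U. lik H (U, es) \<nu> * mean_rew \<nu> t * ?a t) \<partial>prior)"
    using int by (intro Bochner_Integration.integral_sum[symmetric] integrable_mult_left) auto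
  also have "\<dots> = (\<integral>\<nu>. lik H (U, es) \<nu> * hit_init H \<mu> \<pi> U (mean_rew \<nu>) \<partial>prior)"
    unfolding hit_init_linear[OF \<mu> \<pi> fin, of "mean_rew _"] by (simp add: sum_distrib_left mult_ac)
  finally show ?thesis .
qed

end

context hidden_hallucination begin

lemma visits_erase: "visits t (erase z) = erase (visits t z)"
  by (induction z) auto

lemma erase_traj_nth: "i < length \<tau> \<Longrightarrow> fst (erase_traj \<tau> ! i) = fst (\<tau> ! i)"
  by (simp add: erase_traj_def case_prod_beta)

text \<open>Deviations of the dynamics do not read rewards. The hallucinated ledger and the true
  data share their erasure, so the true model and the models that the agent believes in are measured
  against the same empirical transitions.\<close>

lemma close_dynamics_erase:
  assumes "raw_ok z"
  shows "close_dynamics \<eta> \<mu> (erase z) \<longleftrightarrow> close_dynamics \<eta> \<mu> z"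
proof -
  have len: "length \<tau> = H" if "(\<pi>, \<tau>) \<in> set z" for \<pi> \<tau>
    using assms that by (auto simp: raw_ok_def shape_def)
  have map: "(\<Sum>p\<leftarrow>erase ps. g (snd p)) = (\<Sum>p\<leftarrow>ps. g (snd p))"
    if "\<And>\<pi> \<tau>. (\<pi>, \<tau>) \<in> set ps \<Longrightarrow> g (erase_traj \<tau>) = g \<tau>" for g :: "traj \<Rightarrow> real" and ps
    using that
  proof (induction ps)
    case (Cons p ps)
    obtain \<pi> \<tau> where "p = (\<pi>, \<tau>)" by (cases p)
    moreover have "g (erase_traj \<tau>) = g \<tau>" if "p = (\<pi>, \<tau>)" for \<pi> \<tau> using that Cons.prems[of \<pi> \<tau>] by simp
    ultimately show ?case using Cons.IH Cons.prems by auto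
  qed simp
  have "trans_dev \<mu> t B (erase z) = trans_dev \<mu> t B z" if "Suc (snd (snd t)) < H" for t B
    unfolding trans_dev_def visits_erase using that len by (intro map) (auto simp: erase_traj_nth)
  moreover have "init_dev \<mu> B (erase z) = init_dev \<mu> B z" for B
    unfolding init_dev_def using len pos by (intro map) (auto simp: erase_traj_nth)
  ultimately show ?thesis by (auto simp: close_dynamics_def visits_erase)
qed

lemma sum_list_minus_const:
  fixes f :: "'a \<Rightarrow> real" and c :: real
  shows "(\<Sum>p\<leftarrow>ps. f p - c) = (\<Sum>p\<leftarrow>ps. f p) - length ps * c"
  by (induction ps) (auto simp: algebra_simps)

text \<open>Both models are within \<open>\<eta>\<close> of the same empirical frequency, so within
  \<open>2 * \<eta>\<close> of each other; \<open>0 < n\<close> guarantees that there is data to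
  divide by.\<close>

lemma close_dynamics_prob:
  assumes c: "close_dynamics \<eta> \<mu> z" "close_dynamics \<eta> \<nu> z" and n: "0 < n"
  shows "(x, a, h) \<in> trips - UE z \<Longrightarrow> Suc h < H \<Longrightarrow> B \<subseteq> {..<S} \<Longrightarrow>
      measure_pmf.prob (mtrans \<mu> x a h) B \<le> measure_pmf.prob (mtrans \<nu> x a h) B + 2 * \<eta>"
    and "UE z \<noteq> trips \<Longrightarrow> B \<subseteq> {..<S} \<Longrightarrow> measure_pmf.prob (minit \<mu>) B \<le> measure_pmf.prob (minit \<nu>) B + 2 * \<eta>"
proof -
  have key: "p \<le> p' + 2 * \<eta>" if "\<bar>s - m * p\<bar> \<le> \<eta> * m" "\<bar>s - m * p'\<bar> \<le> \<eta> * m" "0 < m" for s m p p' :: real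
  proof -
    have "m * p \<le> m * (p' + 2 * \<eta>)" using that(1,2) by (simp add: algebra_simps)
    then show ?thesis using that(3) by simp
  qed
  show "measure_pmf.prob (mtrans \<mu> x a h) B \<le> measure_pmf.prob (mtrans \<nu> x a h) B + 2 * \<eta>"
    if t: "(x, a, h) \<in> trips - UE z" and "Suc h < H" "B \<subseteq> {..<S}"
  proof (rule key)
    let ?s = "\<Sum>p\<leftarrow>visits (x, a, h) z. indicator B (fst (snd p ! Suc h))" and ?m = "real (length (visits (x, a, h) z))"
    have "\<bar>?s - ?m * measure_pmf.prob (mtrans \<kappa> x a h) B\<bar> \<le> \<eta> * ?m" if "close_dynamics \<eta> \<kappa> z" for \<kappa>
    proof -
      have "\<bar>trans_dev \<kappa> (x, a, h) B z\<bar> \<le> \<eta> * ?m"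
        using that[unfolded close_dynamics_def, THEN conjunct1, rule_format, OF t, of B] \<open>Suc h < H\<close> \<open>B \<subseteq> {..<S}\<close> by simp
      then show ?thesis by (simp add: trans_dev_def trans_prob_def sum_list_minus_const)
    qed
    then show "\<bar>?s - ?m * measure_pmf.prob (mtrans \<mu> x a h) B\<bar> \<le> \<eta> * ?m" "\<bar>?s - ?m * measure_pmf.prob (mtrans \<nu> x a h) B\<bar> \<le> \<eta> * ?m"
      using c by auto
    show "0 < ?m" using explored_visits[OF t] n by linarith
  qed
  show "measure_pmf.prob (minit \<mu>) B \<le> measure_pmf.prob (minit \<nu>) B + 2 * \<eta>"
    if t: "UE z \<noteq> trips" and "B \<subseteq> {..<S}"
  proof (rule key)
    let ?s = "\<Sum>p\<leftarrow>z. indicator B (fst (snd p ! 0))" and ?m = "real (length z)"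
    show "\<bar>?s - ?m * measure_pmf.prob (minit \<mu>) B\<bar> \<le> \<eta> * ?m" "\<bar>?s - ?m * measure_pmf.prob (minit \<nu>) B\<bar> \<le> \<eta> * ?m"
      using c that by (auto simp: close_dynamics_def init_dev_def sum_list_minus_const)
    show "0 < ?m" using explored_length[OF t] n by linarith
  qed
qed

lemma close_hit_init:
  fixes \<eta> :: real
  assumes c: "close_dynamics \<eta> \<mu> z" "close_dynamics \<eta> \<nu> z" and n: "0 < n" and \<eta>: "0 \<le> \<eta>" and U: "UE z \<noteq> trips"
    and \<mu>: "valid \<mu>" "valid \<nu>" and \<pi>: "\<pi> \<in> pols" and w: "\<And>t. t \<in> UE z \<inter> trips \<Longrightarrow> 0 \<le> w t \<and> w t \<le> 1"
  shows "hit_init H \<mu> \<pi> (UE z) w \<le> hit_init H \<nu> \<pi> (UE z) w + H * (2 * \<eta>)"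
  using \<eta> close_dynamics_prob[OF c n] U by (intro hit_init_close \<mu> \<pi> w) auto

section \<open>Typical and atypical ledgers\<close>

definition emp_reward :: "triple \<Rightarrow> (policy \<times> traj) list \<Rightarrow> real" where
  "emp_reward t z = (\<Sum>p\<leftarrow>visits t z. snd (snd (snd p ! snd (snd t))))"

lemma reward_dev_eq: "reward_dev \<mu> t z = emp_reward t z - length (visits t z) * mean_rew \<mu> t"
  by (simp add: reward_dev_def emp_reward_def sum_list_minus_const)

definition far :: "real \<Rightarrow> model \<Rightarrow> ledger \<Rightarrow> bool" where
  "far \<eta> \<mu> lg \<longleftrightarrow> \<not> close \<eta> \<mu> (uncensor (snd lg))"

abbreviation far_ind :: "real \<Rightarrow> model \<Rightarrow> ledger \<Rightarrow> real" where
  "far_ind \<eta> \<mu> lg \<equiv> (if far \<eta> \<mu> lg then 1 else 0)"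

text \<open>A property of the ledger alone, so that its probability can be bounded through the
  honest law. The canonical posterior of a typical ledger gives mass at most \<open>d\<close> to
  models far from the data, and the explored rewards of the ledger look punished.\<close>

definition atypical :: "real \<Rightarrow> real \<Rightarrow> ledger set" where
  "atypical \<eta> d = {(U, es). U = UE (uncensor es) \<and>
     (d * (\<integral>\<mu>. lik H (U, es) \<mu> \<partial>prior) < (\<integral>\<mu>. far_ind \<eta> \<mu> (U, es) * lik H (U, es) \<mu> \<partial>prior) \<or>
      (\<exists>t\<in>trips - U. (e + \<eta>) * length (visits t (uncensor es)) < emp_reward t (uncensor es)))}"

lemma pred_far [measurable]: "Measurable.pred prior (\<lambda>\<mu>. far \<eta> \<mu> lg)"
  unfolding far_def by measurable

lemma far_integrable: "raw_ok es \<Longrightarrow> integrable prior (\<lambda>\<mu>. far_ind \<eta> \<mu> lg * lik H (U, es) \<mu>)"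
  using integrable_lik_times[of es "\<lambda>\<mu>. far_ind \<eta> \<mu> lg" 1 U] by (simp add: mult.commute)

end

context punishable begin

text \<open>Both ways of being atypical force mass on far models. In the first case this mass
  exceeds \<open>d\<close> times the evidence, which gives the constant \<open>1 / d\<close>; in the
  second, every punished model is far, since its mean is at most \<open>e\<close> while the
  empirical mean exceeds \<open>e + \<eta>\<close>.\<close>

lemma prob_atypical:
  assumes R: "rule_ok R" and d: "0 < d" "d \<le> 1" and \<eta>: "0 < \<eta>"
  shows "(\<integral>\<mu>. measure_pmf.prob (hal_proc \<mu> R l) (atypical \<eta> d) \<partial>prior) \<le>
    1 / d * (6 * (real S * A * H) * 2 ^ S * exp (- 2 * \<eta>\<^sup>2 * n)) / q"
proof (rule hal_proc_bad[OF R, where G="far \<eta>"])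
  show "measure_pmf.prob (hon_proc \<mu> R l) {lg. far \<eta> \<mu> lg} \<le> 6 * (real S * A * H) * 2 ^ S * exp (- 2 * \<eta>\<^sup>2 * n)" if "valid \<mu>" for \<mu>
    using not_close_hon[OF R \<eta> that, of l] by (simp add: far_def)
  fix U es assume bad: "(U, es) \<in> atypical \<eta> d" and ok: "raw_ok es"
  let ?F = "\<integral>\<mu>. far_ind \<eta> \<mu> (U, es) * lik H (U, es) \<mu> \<partial>prior"
  have pun_int: "integrable prior (\<lambda>\<mu>. pun_ind e U \<mu> * lik H (U, es) \<mu>)"
    using integrable_lik_times[OF ok pun_ind_measurable[of e U], where B=1 and U=U] by (simp add: mult.commute)
  have F: "0 \<le> ?F" by (rule integral_nonneg_prior) auto
  consider (1) "d * (\<integral>\<mu>. lik H (U, es) \<mu> \<partial>prior) < ?F"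
    | (2) t where "U = UE (uncensor es)" "t \<in> trips - U" "(e + \<eta>) * length (visits t (uncensor es)) < emp_reward t (uncensor es)"
    using bad by (auto simp: atypical_def)
  then show "(\<integral>\<mu>. pun_ind e U \<mu> * lik H (U, es) \<mu> \<partial>prior) \<le> 1 / d * ?F"
  proof cases
    case 1
    have "(\<integral>\<mu>. pun_ind e U \<mu> * lik H (U, es) \<mu> \<partial>prior) \<le> (\<integral>\<mu>. lik H (U, es) \<mu> \<partial>prior)"
      by (intro integral_mono_prior pun_int integrable_lik ok) auto
    also have "\<dots> \<le> 1 / d * ?F" using 1 d by (simp add: field_simps)
    finally show ?thesis .
  next
    case 2
    have "far \<eta> \<mu> (U, es)" if "pun_event S A H e U \<mu>" for \<mu>
    proof -
      have "mean_rew \<mu> t \<le> e" using that 2 by (auto simp: pun_event_def)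
      then have "length (visits t (uncensor es)) * mean_rew \<mu> t \<le> length (visits t (uncensor es)) * e"
        by (intro mult_left_mono) auto
      then have "\<eta> * length (visits t (uncensor es)) < reward_dev \<mu> t (uncensor es)"
        using 2(3) by (simp add: reward_dev_eq algebra_simps)
      then show ?thesis using 2(1,2) by (force simp: far_def close_def close_rewards_def)
    qed
    then have "(\<integral>\<mu>. pun_ind e U \<mu> * lik H (U, es) \<mu> \<partial>prior) \<le> ?F"
      by (intro integral_mono_prior pun_int far_integrable ok) auto
    also have "\<dots> \<le> 1 / d * ?F" using mult_right_mono[of 1 "1 / d" ?F] d F by simp
    finally show ?thesis .
  qed
qed (use d in auto)

end

text \<open>The \<open>18 * real H\<close> makes \<open>H * e\<close> equal to 1/18 of
  \<open>r_alt * \<rho>\<close>, and \<open>N_large\<close> makes the value that an agent gives up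
  by suspecting a hallucination at most 1/6 of it.\<close>

locale exploration = punishable +
  fixes \<rho> :: real and tb :: "policy set \<Rightarrow> policy"
  assumes ra_pos: "0 < r_alt S A H prior" and \<rho>: "0 < \<rho>" "\<rho> \<le> 1" and n_pos: "0 < n"
    and e_eq: "e = r_alt S A H prior * \<rho> / (18 * real H)"
    and N_large: "6 * real H / (q_pun S A H prior e * (r_alt S A H prior * \<rho>)) + 1 \<le> N"
    and tb: "\<forall>X. X \<noteq> {} \<longrightarrow> tb X \<in> X"
begin

definition x :: real where "x = r_alt S A H prior * \<rho>"
text \<open>With these tolerances all error terms in the comparison of values below add up to at most
  \<open>10 x / 18\<close>, which leaves a visiting probability of at least \<open>x / (3 H)\<close>.\<close>

definition \<eta> :: real where "\<eta> = x / (36 * real H ^ 2)"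
definition d :: real where "d = x / (12 * real H)"

lemma x_bounds: "0 < x" "x \<le> 1"
  using ra_pos \<rho> r_alt_le_1 by (auto simp: x_def mult_le_one)

lemma \<eta>_pos: "0 < \<eta>" and d_bounds: "0 < d" "d \<le> 1"
proof -
  show "0 < \<eta>" "0 < d" using x_bounds pos by (auto simp: \<eta>_def d_def)
  have "x \<le> 12 * real H" using x_bounds pos by linarith
  then show "d \<le> 1" using pos by (simp add: d_def)
qed

text \<open>All comparisons are made between integrals against the likelihood, and the evidence is
  cancelled at the end by \<open>L\<close>. The competing policy is one that reaches
  \<open>t0\<close> in the true model; only its first visit to the under-explored set is credited,
  so that \<open>lik_hit_ge\<close> applies.\<close>

lemma progress:
  assumes \<mu>: "valid \<mu>" and raw: "raw_ok raw" and es: "erase es = erase raw" and k: "k div N = length es"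
    and c: "0 < choice_weight (rules tb) (erase raw)"
    and L: "0 < (\<integral>\<nu>. lik H (UE raw, es) \<nu> \<partial>prior)"
    and typical: "(UE raw, es) \<notin> atypical \<eta> d" and dyn: "close_dynamics \<eta> \<mu> raw"
    and t0: "t0 \<in> UE raw" "reachable S A H \<rho> \<mu> t0"
  shows "x / (3 * real H) \<le> visit_prob H \<mu> (rules tb k (UE raw, es)) (UE raw)"
proof -
  let ?U = "UE raw" and ?p = "rules tb k (UE raw, es)"
  let ?P = "visit_prob H \<mu> ?p ?U"
  let ?L = "\<integral>\<nu>. lik H (?U, es) \<nu> \<partial>prior"
  have p: "?p \<in> pols" using rules_ok[OF tb] by blast
  have H1: "1 \<le> real H" using pos by linarith
  show ?thesis
  proof (cases "?U = trips")
    \<comment> \<open>Without explored triples closeness says nothing about the initial law, but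
      then every policy meets the set at the first stage.\<close>
    case True
    have "x \<le> 3 * real H" using x_bounds H1 by linarith
    then show ?thesis using visit_prob_all[OF \<mu> p] True H1 by simp
  next
    case False
    have es_ok: "raw_ok es" using raw raw_ok_cong[OF es] by simp
    have U: "?U = UE (erase es)" "?U = UE (uncensor es)"
      using under_explored_cong[of "erase es" raw] under_explored_cong[of "uncensor es" raw] es by auto
    have Usub: "?U \<subseteq> trips" by (rule under_explored_subset)
    let ?z = "uncensor es"
    let ?f = "\<lambda>\<nu>. far_ind \<eta> \<nu> (?U, es)"
    have z: "erase ?z = erase raw" using es by simp
    have zU: "UE (erase raw) = ?U" by simp
    have z_ok: "raw_ok ?z" using raw raw_ok_cong[OF z] by simp
    have dyn': "close_dynamics \<eta> \<mu> (erase raw)" using dyn close_dynamics_erase[OF raw] by simp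
    have near_dyn: "close_dynamics \<eta> \<nu> (erase raw)" if "\<not> far \<eta> \<nu> (?U, es)" for \<nu>
      using that close_dynamics_erase[OF z_ok, of \<eta> \<nu>] z by (simp add: far_def close_def)
    have F: "(\<integral>\<nu>. ?f \<nu> * lik H (?U, es) \<nu> \<partial>prior) \<le> d * ?L"
      and emp: "\<And>t. t \<in> trips - ?U \<Longrightarrow> emp_reward t ?z \<le> (e + \<eta>) * length (visits t ?z)"
      using typical U(2) by (auto simp: atypical_def not_less)
    \<comment> \<open>One \<open>\<eta>\<close> comes from the empirical mean of a typical ledger,
      the other from the closeness of \<open>\<nu>\<close> to it.\<close>
    have near_rew: "mean_rew \<nu> t \<le> e + 2 * \<eta>" if near: "\<not> far \<eta> \<nu> (?U, es)" and t: "t \<in> trips - ?U" for \<nu> t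
    proof -
      let ?m = "real (length (visits t ?z))"
      have "\<bar>emp_reward t ?z - ?m * mean_rew \<nu> t\<bar> \<le> \<eta> * ?m"
        using near t U by (auto simp: far_def close_def close_rewards_def reward_dev_eq)
      with emp[OF t] have "?m * mean_rew \<nu> t \<le> ?m * (e + 2 * \<eta>)" by (simp add: algebra_simps)
      moreover have "t \<in> trips - UE ?z" using t U(2) by simp
      then have "0 < ?m" using explored_visits[of t ?z] n_pos by linarith
      ultimately show ?thesis by simp
    qed
    have e0: "0 \<le> e" using ra_pos \<rho> by (simp add: e_eq)
    let ?u = "H * (e + 2 * \<eta>) + H * (?P + H * (2 * \<eta>))"
    \<comment> \<open>A far model may be worth as much as \<open>H\<close>, so its posterior mass is
      charged at \<open>H\<close>.\<close>
    have upper: "Vpi H \<nu> ?p \<le> ?u + H * ?f \<nu>" if \<nu>: "valid \<nu>" for \<nu>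
    proof (cases "far \<eta> \<nu> (?U, es)")
      case True
      have "0 \<le> ?u" using e0 \<eta>_pos visit_prob_bounds by (intro add_nonneg_nonneg mult_nonneg_nonneg) auto
      then show ?thesis using Vpi_bounds[OF \<nu> p] True by simp
    next
      case near: False
      have "Vpi H \<nu> ?p \<le> H * (e + 2 * \<eta>) + H * visit_prob H \<nu> ?p ?U"
        using near_rew[OF near] e0 \<eta>_pos by (intro Vpi_le_visit \<nu> p) auto
      moreover have "visit_prob H \<nu> ?p ?U \<le> ?P + H * (2 * \<eta>)"
        unfolding visit_prob_hit[OF \<nu> p] visit_prob_hit[OF \<mu> p]
        using close_hit_init[OF near_dyn[OF near] dyn' n_pos _ _ \<nu> \<mu> p, of "\<lambda>_. 1"] False \<eta>_pos by (simp add: zU)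
      then have "H * visit_prob H \<nu> ?p ?U \<le> H * (?P + H * (2 * \<eta>))" by (intro mult_left_mono) auto
      ultimately show ?thesis using near by simp
    qed
    obtain \<pi> where \<pi>: "\<pi> \<in> pols" and reach: "\<rho> \<le> measure_pmf.prob (traj_pmf H \<mu> \<pi>) {\<tau>. visited t0 \<tau>}"
      using t0(2) by (auto simp: reachable_def)
    have \<rho>P: "\<rho> \<le> visit_prob H \<mu> \<pi> ?U"
      using reach visit_prob_ge[OF t0(1)] by (rule order_trans)
    have w: "0 \<le> mean_rew \<nu> t \<and> mean_rew \<nu> t \<le> 1" if "valid \<nu>" "t \<in> ?U \<inter> trips" for \<nu> t
      using mean_rew_bounds[OF that(1)] that(2) by auto
    \<comment> \<open>Here a far model costs at most 1, since only the reward of a single visit is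
      compared.\<close>
    have lower: "hit_init H \<mu> \<pi> ?U (mean_rew \<nu>) \<le> Vpi H \<nu> \<pi> + H * (2 * \<eta>) + ?f \<nu>" if \<nu>: "valid \<nu>" for \<nu>
    proof (cases "far \<eta> \<nu> (?U, es)")
      case True
      have "hit_init H \<mu> \<pi> ?U (mean_rew \<nu>) \<le> 1" by (rule hit_init_bounds[OF \<mu> \<pi> w[OF \<nu>]])
      moreover have "0 \<le> H * (2 * \<eta>)" using \<eta>_pos by simp
      ultimately show ?thesis using Vpi_bounds[OF \<nu> \<pi>] True by simp
    next
      case near: False
      have "hit_init H \<mu> \<pi> ?U (mean_rew \<nu>) \<le> hit_init H \<nu> \<pi> ?U (mean_rew \<nu>) + H * (2 * \<eta>)"
        using close_hit_init[OF dyn' near_dyn[OF near] n_pos _ _ \<mu> \<nu> \<pi>, of "mean_rew \<nu>"] w[OF \<nu>] False \<eta>_pos by (simp add: zU)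
      also have "\<dots> \<le> Vpi H \<nu> \<pi> + H * (2 * \<eta>)" using Vpi_ge_hit[OF \<nu> \<pi>] by simp
      finally show ?thesis using near by simp
    qed
    note Vint = Vpi_lik_integrable(1)[OF _ es_ok, of _ ?U]
    have fint: "integrable prior (\<lambda>\<nu>. lik H (?U, es) \<nu> * ?f \<nu>)"
      using far_integrable[OF es_ok, of \<eta> "(?U, es)" ?U] by (simp add: mult.commute)
    have F': "(\<integral>\<nu>. lik H (?U, es) \<nu> * ?f \<nu> \<partial>prior) \<le> d * ?L" using F by (simp add: mult.commute)
    have hint: "integrable prior (\<lambda>\<nu>. lik H (?U, es) \<nu> * hit_init H \<mu> \<pi> ?U (mean_rew \<nu>))"
    proof (rule integrable_lik_times[OF es_ok, where B=1])
      have fin: "finite ?U" using Usub finite_triples finite_subset by blast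
      show "(\<lambda>\<nu>. hit_init H \<mu> \<pi> ?U (mean_rew \<nu>)) \<in> borel_measurable prior"
        unfolding hit_init_linear[OF \<mu> \<pi> fin, of "mean_rew _"]
        using Usub by (intro borel_measurable_sum borel_measurable_times mean_rew_measurable borel_measurable_const) auto
      show "\<bar>hit_init H \<mu> \<pi> ?U (mean_rew \<nu>)\<bar> \<le> 1" if \<nu>: "valid \<nu>" for \<nu>
        using hit_init_bounds[OF \<mu> \<pi> w[OF \<nu>]] by simp
    qed
    have up: "(\<integral>\<nu>. lik H (?U, es) \<nu> * Vpi H \<nu> ?p \<partial>prior) \<le> ?u * ?L + H * (d * ?L)"
    proof -
      have "(\<integral>\<nu>. lik H (?U, es) \<nu> * Vpi H \<nu> ?p \<partial>prior) \<le> (\<integral>\<nu>. ?u * lik H (?U, es) \<nu> + H * (lik H (?U, es) \<nu> * ?f \<nu>) \<partial>prior)"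
      proof (intro integral_mono_prior Vint p Bochner_Integration.integrable_add integrable_mult_right integrable_lik es_ok fint)
        fix \<nu> assume "valid \<nu>"
        from mult_left_mono[OF upper[OF this] lik_nonneg[of H "(?U, es)" \<nu>]]
        show "lik H (?U, es) \<nu> * Vpi H \<nu> ?p \<le> ?u * lik H (?U, es) \<nu> + H * (lik H (?U, es) \<nu> * ?f \<nu>)"
          by (simp only: algebra_simps)
      qed
      also have "\<dots> = ?u * ?L + H * (\<integral>\<nu>. lik H (?U, es) \<nu> * ?f \<nu> \<partial>prior)"
        by (subst Bochner_Integration.integral_add)
           (simp_all only: integrable_mult_right integrable_lik es_ok fint integral_mult_right_zero)
      also have "\<dots> \<le> ?u * ?L + H * (d * ?L)" using F' by (intro add_left_mono mult_left_mono) auto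
      finally show ?thesis .
    qed
    have low: "x * ?L \<le> (\<integral>\<nu>. lik H (?U, es) \<nu> * Vpi H \<nu> \<pi> \<partial>prior) + H * (2 * \<eta>) * ?L + d * ?L"
    proof -
      have "x * ?L \<le> r_alt S A H prior * visit_prob H \<mu> \<pi> ?U * ?L"
        unfolding x_def using \<rho>P ra_pos L by (intro mult_right_mono mult_left_mono) auto
      also have "\<dots> \<le> (\<integral>\<nu>. lik H (?U, es) \<nu> * hit_init H \<mu> \<pi> ?U (mean_rew \<nu>) \<partial>prior)"
        by (rule lik_hit_ge[OF \<mu> \<pi> es_ok Usub])
      also have "\<dots> \<le> (\<integral>\<nu>. (lik H (?U, es) \<nu> * Vpi H \<nu> \<pi> + H * (2 * \<eta>) * lik H (?U, es) \<nu>) + lik H (?U, es) \<nu> * ?f \<nu> \<partial>prior)"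
      proof (intro integral_mono_prior hint Vint \<pi> Bochner_Integration.integrable_add integrable_mult_right integrable_lik es_ok fint)
        fix \<nu> assume "valid \<nu>"
        from mult_left_mono[OF lower[OF this] lik_nonneg[of H "(?U, es)" \<nu>]]
        show "lik H (?U, es) \<nu> * hit_init H \<mu> \<pi> ?U (mean_rew \<nu>) \<le>
            (lik H (?U, es) \<nu> * Vpi H \<nu> \<pi> + H * (2 * \<eta>) * lik H (?U, es) \<nu>) + lik H (?U, es) \<nu> * ?f \<nu>"
          by (simp only: algebra_simps)
      qed
      also have "\<dots> = (\<integral>\<nu>. lik H (?U, es) \<nu> * Vpi H \<nu> \<pi> \<partial>prior) + H * (2 * \<eta>) * ?L + (\<integral>\<nu>. lik H (?U, es) \<nu> * ?f \<nu> \<partial>prior)"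
        by (subst Bochner_Integration.integral_add, intro Bochner_Integration.integrable_add integrable_mult_right integrable_lik es_ok Vint \<pi>, rule fint,
            subst Bochner_Integration.integral_add, intro Vint \<pi>, intro integrable_mult_right integrable_lik es_ok, simp only: integral_mult_right_zero)
      also have "\<dots> \<le> (\<integral>\<nu>. lik H (?U, es) \<nu> * Vpi H \<nu> \<pi> \<partial>prior) + H * (2 * \<eta>) * ?L + d * ?L"
        using F' by (intro add_left_mono)
      finally show ?thesis .
    qed
    let ?A = "\<integral>\<nu>. lik H (?U, es) \<nu> * Vpi H \<nu> \<pi> \<partial>prior" and ?B = "\<integral>\<nu>. lik H (?U, es) \<nu> * Vpi H \<nu> ?p \<partial>prior"
    have opt: "?A \<le> ?B + x / 6 * ?L"
    proof -
      have "0 < 6 * real H / (q * x)" using q_pos x_bounds pos by simp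
      then have N: "1 < real N" "6 * real H / (q * x) \<le> real N - 1"
        using N_large unfolding x_def by linarith+
      have "(1 - 1 / N) * ?A \<le> (1 - 1 / N) * ?B + H / (N * q) * ?L"
        by (rule agent_near_optimal[OF tb k es_ok U(1) _ \<pi>]) (use c es in simp)
      moreover have "(M - 1) * a \<le> (M - 1) * b + h / c * l"
        if "(1 - 1 / M) * a \<le> (1 - 1 / M) * b + h / (M * c) * l" "1 < M" for M a b h c l :: real
      proof -
        have "M * ((1 - 1 / M) * a) \<le> M * ((1 - 1 / M) * b + h / (M * c) * l)"
          using that by (intro mult_left_mono) auto
        moreover have "M * ((1 - 1 / M) * y) = (M - 1) * y" for y using that by (simp add: field_simps)
        moreover have "M * (h / (M * c) * l) = h / c * l" using that by simp
        ultimately show ?thesis by (simp only: distrib_left)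
      qed
      ultimately have 1: "(real N - 1) * ?A \<le> (real N - 1) * ?B + H / q * ?L"
        using N(1) by blast
      \<comment> \<open>The phase length was chosen for this: after division by \<open>N - 1\<close>
        the loss by suspicion is at most \<open>x / 6\<close> per unit of evidence.\<close>
      have "6 * H \<le> (real N - 1) * (q * x)" using N q_pos x_bounds by (simp add: field_simps)
      then have "H / q \<le> (real N - 1) * (x / 6)" using q_pos by (simp add: field_simps)
      then have "H / q * ?L \<le> (real N - 1) * (x / 6) * ?L" using L by (intro mult_right_mono) auto
      from order_trans[OF 1 add_left_mono[OF this]]
      have "(real N - 1) * ?A \<le> (real N - 1) * (?B + x / 6 * ?L)" by (simp only: distrib_left mult.assoc)
      then show ?thesis using N by simp
    qed
    have "x * ?L \<le> (?u + H * d + x / 6 + H * (2 * \<eta>) + d) * ?L"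
      using up low opt by (simp add: algebra_simps)
    then have main: "x \<le> ?u + H * d + x / 6 + H * (2 * \<eta>) + d"
      using L by simp
    \<comment> \<open>In units of \<open>x / 18\<close> the errors are 1 from \<open>H * e\<close>,
      1 from \<open>H * (H * (2 * \<eta>))\<close>, at most 1 from each of the two terms
      \<open>H * (2 * \<eta>)\<close>, 3/2 from \<open>H * d\<close>, at most 3/2 from
      \<open>d\<close>, and 3 from \<open>x / 6\<close>. Of 18 units 8 remain, and 6 are
      claimed.\<close>
    have v1: "H * e = x / 18" using pos by (simp add: e_eq x_def)
    have v2: "H * (H * (2 * \<eta>)) = x / 18" using pos by (simp add: \<eta>_def power2_eq_square)
    have v3: "H * d = x / 12" using pos by (simp add: d_def)
    have v4: "H * (2 * \<eta>) \<le> x / 18"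
    proof -
      have "H * (2 * \<eta>) * 1 \<le> H * (2 * \<eta>) * H" using H1 \<eta>_pos by (intro mult_left_mono) auto
      then show ?thesis using v2 by (simp add: mult_ac)
    qed
    have v5: "d \<le> x / 12"
    proof -
      have "d * 1 \<le> d * H" using H1 d_bounds by (intro mult_left_mono) auto
      then show ?thesis using v3 by (simp add: mult_ac)
    qed
    have "?u = H * e + H * (2 * \<eta>) + H * ?P + H * (H * (2 * \<eta>))" by (simp add: algebra_simps)
    with main v1 v2 v3 v4 v5 have "x / 3 \<le> H * ?P" using x_bounds by linarith
    then show ?thesis using H1 by (simp add: field_simps)
  qed
qed

end

section \<open>Counting phases\<close>

text \<open>For full histories only measurability in the model is wanted, so the support is left
  anonymous. It stays countable, being a union over the countable \<open>C\<close>.\<close>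

lemma pmf_kernel_bind_ex:
  assumes "\<exists>C. pmf_kernel M C K" "\<And>y. \<exists>D. pmf_kernel M D (\<lambda>m. F m y)"
  shows "\<exists>D. pmf_kernel M D (\<lambda>m. bind_pmf (K m) (F m))"
proof -
  obtain C where C: "pmf_kernel M C K" using assms(1) by blast
  obtain D where D: "\<And>y. pmf_kernel M (D y) (\<lambda>m. F m y)" using assms(2) by metis
  have "countable (\<Union>y\<in>C. D y)" using C D by (auto simp: pmf_kernel_def)
  then have "pmf_kernel M (\<Union>y\<in>C. D y) (\<lambda>m. bind_pmf (K m) (F m))"
    by (intro pmf_kernel_bind[OF C] pmf_kernel_mono[OF D]) auto
  then show ?thesis by blast
qed

lemma pmf_kernel_const_ex: "\<exists>C. pmf_kernel M C (\<lambda>_. p)"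
  using pmf_kernel_const[of "set_pmf p" p M] by auto

lemma pmf_kernel_map_ex: "\<exists>C. pmf_kernel M C K \<Longrightarrow> \<exists>D. pmf_kernel M D (\<lambda>m. map_pmf f (K m))"
  unfolding map_pmf_def by (intro pmf_kernel_bind_ex pmf_kernel_const_ex)

context hidden_hallucination begin

lemma kernel_run_eps:
  assumes "rule_ok R"
  shows "\<exists>C. pmf_kernel prior C (\<lambda>\<mu>. run_eps H \<mu> R sig ks)"
proof (induction ks)
  case (Cons k ks)
  have "\<exists>C. pmf_kernel prior C (\<lambda>\<mu>. traj_pmf H \<mu> (R k (sig k)))"
    using kernel_traj_pmf assms by blast
  then show ?case unfolding run_eps.simps using Cons by (intro pmf_kernel_bind_ex pmf_kernel_map_ex)
qed (simp add: pmf_kernel_const_ex)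

lemma kernel_run_phases:
  assumes "rule_ok R"
  shows "\<exists>C. pmf_kernel prior C (\<lambda>\<mu>. run_phases S A H prior N n e \<mu> R l)"
proof (induction l)
  case (Suc l)
  then show ?case unfolding run_phases.simps phase_step_def Let_def
    by (intro pmf_kernel_bind_ex pmf_kernel_map_ex pmf_kernel_const_ex kernel_run_eps assms)
qed (simp add: pmf_kernel_const_ex)

lemma pred_reachable [measurable]: "Measurable.pred prior (\<lambda>\<mu>. reachable S A H \<rho> \<mu> t)"
proof -
  have "Measurable.pred prior (\<lambda>\<mu>. \<rho> \<le> measure_pmf.prob (traj_pmf H \<mu> \<pi>) {\<tau>. visited t \<tau>})" if "\<pi> \<in> pols" for \<pi>
    using pmf_kernel_prob[OF kernel_traj_pmf[OF that], of "\<lambda>_ \<tau>. visited t \<tau>"] by measurable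
  then show ?thesis unfolding reachable_def using finite_policies[of S A H] by (intro pred_intros_finite) auto
qed

lemma pred_explored: "Measurable.pred prior (\<lambda>\<mu>. explored S A H \<rho> n K \<mu> hs)"
  unfolding explored_def using finite_triples[of S A H] by (intro pred_intros_finite) auto

lemma explored_measurable:
  assumes "rule_ok R"
  shows "(\<lambda>\<mu>. measure_pmf.prob (run_phases S A H prior N n e \<mu> R l) {hs. explored S A H \<rho> n K \<mu> hs}) \<in> borel_measurable prior"
  using kernel_run_phases[OF assms, of l] pred_explored pmf_kernel_prob[of prior _ "\<lambda>\<mu>. run_phases S A H prior N n e \<mu> R l"]
  by blast

definition pending :: "real \<Rightarrow> model \<Rightarrow> (policy \<times> traj) list \<Rightarrow> bool" where
  "pending \<rho> \<mu> raw \<longleftrightarrow> (\<exists>t\<in>UE raw. reachable S A H \<rho> \<mu> t)"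

lemma hist_ok_distinct:
  assumes "hist_ok l hs"
  shows "distinct (fst hs)"
  unfolding distinct_conv_nth
proof (intro allI impI)
  have less: "fst hs ! i < fst hs ! j" if "i < j" "j < l" for i j
  proof -
    have "fst hs ! i \<in> phase i" "fst hs ! j \<in> phase j" using assms that by (auto simp: hist_ok_def)
    moreover have "Suc i * N \<le> j * N" using that by (intro mult_le_mono1) auto
    ultimately show ?thesis by auto
  qed
  fix i j assume "i < length (fst hs)" "j < length (fst hs)" "i \<noteq> j"
  then have "i < l" "j < l" using assms by (auto simp: hist_ok_def)
  with less[of i j] less[of j i] \<open>i \<noteq> j\<close> show "fst hs ! i \<noteq> fst hs ! j"
    by (cases "i < j") auto
qed

text \<open>The hallucination episodes lie in disjoint phases, so visits recorded in the raw ledger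
  happen in distinct episodes. Since \<open>K\<close> may fall inside phase \<open>l\<close>, the
  history is extended by that phase, which leaves the earlier entries untouched.\<close>

lemma explored_of_not_pending:
  assumes hs: "hist_ok l hs" and nopend: "\<not> pending \<rho> \<mu> (hallucinations hs)"
    and hs': "hs' \<in> set_pmf (phase_step S A H prior N n e \<mu> R l hs)" and K: "l * N \<le> K"
  shows "explored S A H \<rho> n K \<mu> hs'"
  unfolding explored_def
proof (intro ballI impI)
  fix t assume t: "t \<in> trips" and r: "reachable S A H \<rho> \<mu> t"
  let ?P = "\<lambda>k. visited t (snd (snd (snd hs ! k)))" and ?P' = "\<lambda>k. visited t (snd (snd (snd hs' ! k)))"
  obtain kh new where h': "hs' = (fst hs @ [kh], snd hs @ new)" using hs' by (rule phase_step_cases)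
  have "t \<notin> UE (hallucinations hs)" using nopend r by (auto simp: pending_def)
  then have "n \<le> length (filter (\<lambda>p. visited t (snd p)) (hallucinations hs))"
    using t by (auto simp: under_explored_def)
  also have "\<dots> = length (filter ?P (fst hs))"
    by (simp add: hallucinations_def filter_map comp_def)
  also have "\<dots> = card (set (filter ?P (fst hs)))"
    using hist_ok_distinct[OF hs] by (intro distinct_card[symmetric]) auto
  also have "\<dots> \<le> card (set (filter ?P' [0..<K]))"
  proof (rule card_mono)
    show "set (filter ?P (fst hs)) \<subseteq> set (filter ?P' [0..<K])"
    proof
      fix k assume k: "k \<in> set (filter ?P (fst hs))"
      then have "k < l * N" using hist_ok_less[OF hs] by auto
      then have "snd hs' ! k = snd hs ! k" "k < K" using hs K by (auto simp: h' hist_ok_def nth_append)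
      then show "k \<in> set (filter ?P' [0..<K])" using k by auto
    qed
  qed simp
  also have "\<dots> = length (filter ?P' [0..<K])" by (intro distinct_card) auto
  finally show "n \<le> length (filter ?P' [0..<K])" .
qed

lemma prob_explored_ge:
  assumes K: "l * N \<le> K"
  shows "1 - measure_pmf.prob (raw_proc \<mu> R l) {raw. pending \<rho> \<mu> raw} \<le>
    measure_pmf.prob (run_phases S A H prior N n e \<mu> R (Suc l)) {hs. explored S A H \<rho> n K \<mu> hs}"
proof -
  let ?run = "run_phases S A H prior N n e \<mu> R l" and ?step = "phase_step S A H prior N n e \<mu> R l"
  have "measure_pmf.prob (raw_proc \<mu> R l) {raw. \<not> pending \<rho> \<mu> raw} =
     measure_pmf.expectation ?run (indicator {hs. \<not> pending \<rho> \<mu> (hallucinations hs)})"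
    by (simp add: hallucinations_run[symmetric] vimage_def)
  also have "\<dots> \<le> measure_pmf.expectation ?run (\<lambda>hs. measure_pmf.prob (?step hs) {hs. explored S A H \<rho> n K \<mu> hs})"
  proof (rule expectation_pmf_mono[where B=1])
    fix hs assume hs: "hs \<in> set_pmf ?run"
    show "indicator {hs. \<not> pending \<rho> \<mu> (hallucinations hs)} hs \<le> measure_pmf.prob (?step hs) {hs. explored S A H \<rho> n K \<mu> hs}"
    proof (cases "pending \<rho> \<mu> (hallucinations hs)")
      case False
      have "measure_pmf.prob (?step hs) {hs. explored S A H \<rho> n K \<mu> hs} = 1"
        using explored_of_not_pending[OF hist_ok_run[OF hs] False _ K]
        by (intro measure_pmf.prob_eq_1[THEN iffD2]) (auto simp: AE_measure_pmf_iff)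
      then show ?thesis by (simp add: indicator_le_1)
    qed simp
  qed (auto simp: indicator_le_1)
  also have "\<dots> = measure_pmf.prob (run_phases S A H prior N n e \<mu> R (Suc l)) {hs. explored S A H \<rho> n K \<mu> hs}"
    by (simp add: prob_bind_pmf)
  also have "measure_pmf.prob (raw_proc \<mu> R l) {raw. \<not> pending \<rho> \<mu> raw} = 1 - measure_pmf.prob (raw_proc \<mu> R l) {raw. pending \<rho> \<mu> raw}"
    using measure_pmf.prob_compl[of "{raw. pending \<rho> \<mu> raw}" "raw_proc \<mu> R l"] by (simp add: Compl_eq_Diff_UNIV[symmetric] Collect_neg_eq)
  finally show ?thesis .
qed

text \<open>Truncation at \<open>n\<close> bounds the sum by \<open>S * A * H * n\<close>, while a
  run that visits some under-explored triple still raises it by at least 1.\<close>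

definition potential :: "(policy \<times> traj) list \<Rightarrow> nat" where
  "potential raw = (\<Sum>t\<in>trips. min n (length (visits t raw)))"

lemma potential_le: "potential raw \<le> S * A * H * n"
proof -
  have "potential raw \<le> of_nat (card trips) * n" unfolding potential_def by (intro sum_bounded_above) auto
  then show ?thesis by (simp add: card_triples)
qed

lemma potential_snoc:
  "potential raw + (if \<exists>t\<in>UE raw. visited t \<tau> then 1 else 0) \<le> potential (raw @ [(\<pi>, \<tau>)])"
proof (cases "\<exists>t\<in>UE raw. visited t \<tau>")
  case False
  then show ?thesis unfolding potential_def by (auto intro!: sum_mono)
next
  case True
  then obtain t where t: "t \<in> UE raw" "visited t \<tau>" by blast
  then have tr: "t \<in> trips" "length (visits t raw) < n" by (auto simp: under_explored_def)
  have "potential raw + 1 = (min n (length (visits t raw)) + 1) + (\<Sum>s\<in>trips - {t}. min n (length (visits s raw)))"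
    unfolding potential_def using tr finite_triples[of S A H] by (subst sum.remove[of _ t]) auto
  also have "\<dots> \<le> min n (length (visits t (raw @ [(\<pi>, \<tau>)]))) + (\<Sum>s\<in>trips - {t}. min n (length (visits s (raw @ [(\<pi>, \<tau>)]))))"
    using tr t by (intro add_mono sum_mono) auto
  also have "\<dots> = potential (raw @ [(\<pi>, \<tau>)])"
    unfolding potential_def using tr finite_triples[of S A H] by (subst (2) sum.remove[of _ t]) auto
  finally show ?thesis using True by simp
qed

lemma UE_snoc: "UE (raw @ [p]) \<subseteq> UE raw"
  by (auto simp: under_explored_def split: if_splits)

end

section \<open>Flagged runs and the decay of an exponential energy\<close>

context exploration begin

abbreviation R :: "nat \<Rightarrow> ledger \<Rightarrow> policy" where "R \<equiv> rules tb"

definition derailed :: "model \<Rightarrow> (policy \<times> traj) list \<Rightarrow> ledger \<Rightarrow> bool" where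
  "derailed \<mu> raw lg \<longleftrightarrow> \<not> close_dynamics \<eta> \<mu> raw \<or> lg \<in> atypical \<eta> d"

text \<open>The flag records, and never forgets, that closeness or typicality has failed. It is
  carried along the chain because the drawn ledger, which decides typicality, is not kept in the raw
  data.\<close>

definition flag_step :: "model \<Rightarrow> nat \<Rightarrow> (policy \<times> traj) list \<times> bool \<Rightarrow> ((policy \<times> traj) list \<times> bool) pmf" where
  "flag_step \<mu> l s = bind_pmf (pmf_of_set (phase l)) (\<lambda>k. bind_pmf (hal (fst s)) (\<lambda>lg.
     map_pmf (\<lambda>\<tau>. (fst s @ [(R k lg, \<tau>)], snd s \<or> derailed \<mu> (fst s) lg)) (traj_pmf H \<mu> (R k lg))))"

primrec flag_proc :: "model \<Rightarrow> nat \<Rightarrow> ((policy \<times> traj) list \<times> bool) pmf" where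
  "flag_proc \<mu> 0 = return_pmf ([], False)"
| "flag_proc \<mu> (Suc l) = bind_pmf (flag_proc \<mu> l) (flag_step \<mu> l)"

lemma fst_flag_proc: "map_pmf fst (flag_proc \<mu> l) = raw_proc \<mu> R l"
proof (induction l)
  case (Suc l)
  have "map_pmf fst (flag_step \<mu> l s) = raw_step \<mu> R l (fst s)" for s
    by (simp add: flag_step_def raw_step_def choice_def map_bind_pmf map_pmf_comp bind_assoc_pmf bind_map_pmf)
  then show ?case by (simp add: Suc[symmetric] map_bind_pmf bind_map_pmf)
qed simp

lemma flag_proc_support: "s \<in> set_pmf (flag_proc \<mu> l) \<Longrightarrow> fst s \<in> set_pmf (raw_proc \<mu> R l)"
  by (simp add: fst_flag_proc[symmetric])

text \<open>A union bound over phases: the flag can rise only through one of two events, and their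
  probabilities can be computed in the process without the flag.\<close>

lemma flag_le:
  "emeasure (flag_proc \<mu> l) {s. snd s} \<le>
    (\<Sum>j<l. emeasure (raw_proc \<mu> R j) {raw. \<not> close_dynamics \<eta> \<mu> raw} + emeasure (hal_proc \<mu> R j) (atypical \<eta> d))"
proof (induction l)
  case (Suc l)
  have step: "emeasure (flag_step \<mu> l s) {s. snd s} \<le>
      indicator {s. snd s} s + (indicator {raw. \<not> close_dynamics \<eta> \<mu> raw} (fst s) + emeasure (hal (fst s)) (atypical \<eta> d))" for s
  proof (cases "snd s \<or> \<not> close_dynamics \<eta> \<mu> (fst s)")
    case True
    have "emeasure (flag_step \<mu> l s) {s. snd s} \<le> 1" by (rule measure_pmf.emeasure_le_1)
    also have "1 \<le> indicator {s. snd s} s + (indicator {raw. \<not> close_dynamics \<eta> \<mu> raw} (fst s) + emeasure (hal (fst s)) (atypical \<eta> d))"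
      using True by (auto simp: indicator_def add_increasing add_increasing2)
    finally show ?thesis .
  next
    case False
    have "emeasure (map_pmf (\<lambda>\<tau>. (fst s @ [(R k lg, \<tau>)], snd s \<or> derailed \<mu> (fst s) lg)) (traj_pmf H \<mu> (R k lg))) {s. snd s} =
       indicator (atypical \<eta> d) lg" for k lg
      using False by (auto simp: derailed_def vimage_def indicator_def)
    then have "emeasure (flag_step \<mu> l s) {s. snd s} = emeasure (hal (fst s)) (atypical \<eta> d)"
      by (simp add: flag_step_def del: emeasure_map_pmf)
    then show ?thesis by (simp add: add_increasing)
  qed
  have "emeasure (flag_proc \<mu> (Suc l)) {s. snd s} \<le> (\<integral>\<^sup>+s. indicator {s. snd s} s +
      (indicator {raw. \<not> close_dynamics \<eta> \<mu> raw} (fst s) + emeasure (hal (fst s)) (atypical \<eta> d)) \<partial>flag_proc \<mu> l)"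
    using step by (simp add: nn_integral_mono)
  also have "\<dots> = emeasure (flag_proc \<mu> l) {s. snd s} + ((\<integral>\<^sup>+raw. indicator {raw. \<not> close_dynamics \<eta> \<mu> raw} raw \<partial>raw_proc \<mu> R l) +
      (\<integral>\<^sup>+raw. emeasure (hal raw) (atypical \<eta> d) \<partial>raw_proc \<mu> R l))"
    unfolding fst_flag_proc[symmetric] nn_integral_map_pmf by (simp add: nn_integral_add)
  also have "\<dots> = emeasure (flag_proc \<mu> l) {s. snd s} + (emeasure (raw_proc \<mu> R l) {raw. \<not> close_dynamics \<eta> \<mu> raw} + emeasure (hal_proc \<mu> R l) (atypical \<eta> d))"
    by (simp add: hal_proc_def)
  finally show ?case using Suc by (simp add: add_mono order_trans[OF _ add_right_mono])
qed simp

definition p0 :: real where "p0 = x / (3 * real H)"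

lemma p0_bounds: "0 < p0" "p0 \<le> 1"
proof -
  show "0 < p0" using x_bounds pos by (simp add: p0_def)
  have "x \<le> 3 * real H" using x_bounds pos by linarith
  then show "p0 \<le> 1" using pos by (simp add: p0_def)
qed

text \<open>Killed as soon as nothing is pending or the flag is up, and neither can be undone. While
  it is alive, a visit at least halves it, and visits have probability at least \<open>p0\<close>,
  so each phase shrinks its expectation by the factor \<open>1 - p0 / 2\<close>.\<close>

definition energy :: "model \<Rightarrow> (policy \<times> traj) list \<times> bool \<Rightarrow> real" where
  "energy \<mu> s = (if pending \<rho> \<mu> (fst s) \<and> \<not> snd s then (1 / 2) ^ potential (fst s) else 0)"

lemma energy_visit:
  assumes \<mu>: "valid \<mu>" and p: "p0 \<le> visit_prob H \<mu> \<pi> (UE raw)"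
  shows "(\<integral>\<^sup>+\<tau>. ennreal ((1 / 2) ^ potential (raw @ [(\<pi>, \<tau>)])) \<partial>traj_pmf H \<mu> \<pi>) \<le>
    ennreal ((1 - p0 / 2) * (1 / 2) ^ potential raw)"
proof -
  let ?V = "{\<tau>. \<exists>t\<in>UE raw. visited t \<tau>}" and ?c = "(1 / 2 :: real) ^ potential raw"
  let ?T = "traj_pmf H \<mu> \<pi>"
  have le: "(1 / 2 :: real) ^ potential (raw @ [(\<pi>, \<tau>)]) \<le> ?c + (- (?c / 2)) * indicator ?V \<tau>" for \<tau>
  proof -
    have "(1 / 2 :: real) ^ potential (raw @ [(\<pi>, \<tau>)]) \<le> (1 / 2) ^ (potential raw + (if \<exists>t\<in>UE raw. visited t \<tau> then 1 else 0))"
      by (rule power_decreasing[OF potential_snoc]) auto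
    also have "\<dots> = ?c + (- (?c / 2)) * indicator ?V \<tau>"
      by (auto simp: indicator_def)
    finally show ?thesis .
  qed
  have "(\<integral>\<^sup>+\<tau>. ennreal ((1 / 2) ^ potential (raw @ [(\<pi>, \<tau>)])) \<partial>?T) \<le> (\<integral>\<^sup>+\<tau>. ennreal (?c + (- (?c / 2)) * indicator ?V \<tau>) \<partial>?T)"
    by (intro nn_integral_mono ennreal_leI le)
  also have "\<dots> = ennreal (measure_pmf.expectation ?T (\<lambda>\<tau>. ?c + (- (?c / 2)) * indicator ?V \<tau>))"
  proof (rule nn_integral_eq_integral)
    show "integrable ?T (\<lambda>\<tau>. ?c + (- (?c / 2)) * indicator ?V \<tau>)"
      by (intro Bochner_Integration.integrable_add integrable_mult_right measure_pmf.integrable_const_bound[where B=1]) (auto simp: indicator_le_1 power_le_one)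
  qed (auto simp: indicator_def)
  also have "measure_pmf.expectation ?T (\<lambda>\<tau>. ?c + (- (?c / 2)) * indicator ?V \<tau>) = ?c + (- (?c / 2)) * visit_prob H \<mu> \<pi> (UE raw)"
    using expectation_pmf_affine[of ?T "indicator ?V" 1 ?c "- (?c / 2)"] by (simp add: visit_prob_def)
  also have "ennreal \<dots> \<le> ennreal ((1 - p0 / 2) * ?c)"
  proof (rule ennreal_leI)
    have "?c / 2 * p0 \<le> ?c / 2 * visit_prob H \<mu> \<pi> (UE raw)" using p by (intro mult_left_mono) auto
    then show "?c + (- (?c / 2)) * visit_prob H \<mu> \<pi> (UE raw) \<le> (1 - p0 / 2) * ?c" by (simp add: algebra_simps)
  qed
  finally show ?thesis .
qed

text \<open>The hypotheses of \<open>progress\<close> follow from the ledger having been drawn: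
  positive choice weight and evidence, a length matching the phase, and closeness and typicality
  from the absence of the flag. If the flag rises in this very step, the new energy is 0.\<close>

lemma energy_step:
  assumes \<mu>: "valid \<mu>" and raw: "fst s \<in> set_pmf (raw_proc \<mu> R l)"
    and ev: "0 < (\<integral>\<nu>. erased_lik H (fst s) \<nu> \<partial>prior)"
  shows "(\<integral>\<^sup>+s'. ennreal (energy \<mu> s') \<partial>flag_step \<mu> l s) \<le> ennreal (1 - p0 / 2) * ennreal (energy \<mu> s)"
proof -
  have R: "rule_ok R" by (rule rules_ok[OF tb])
  let ?raw = "fst s"
  have zero: "energy \<mu> s' = 0" if s': "s' \<in> set_pmf (flag_step \<mu> l s)" and over: "\<not> pending \<rho> \<mu> ?raw \<or> snd s" for s'
  proof -
    obtain k lg \<tau> where "s' = (?raw @ [(R k lg, \<tau>)], snd s \<or> derailed \<mu> ?raw lg)"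
      using s' by (auto simp: flag_step_def)
    then show ?thesis using over UE_snoc[of ?raw "(R k lg, \<tau>)"] by (auto simp: energy_def pending_def)
  qed
  show ?thesis
  proof (cases "pending \<rho> \<mu> ?raw \<and> \<not> snd s")
    case False
    then have "(\<integral>\<^sup>+s'. ennreal (energy \<mu> s') \<partial>flag_step \<mu> l s) = (\<integral>\<^sup>+s'. 0 \<partial>flag_step \<mu> l s)"
      using zero by (intro nn_integral_cong_AE) (auto simp: AE_measure_pmf_iff)
    then show ?thesis by simp
  next
    case True
    obtain t0 where t0: "t0 \<in> UE ?raw" "reachable S A H \<rho> \<mu> t0" using True by (auto simp: pending_def)
    have "?raw \<in> raws" using set_raw_proc[OF R \<mu>] raw by blast
    then have ok: "raw_ok ?raw" by (rule raws_ok)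
    let ?b = "(1 - p0 / 2) * (1 / 2) ^ potential ?raw"
    have inner: "(\<integral>\<^sup>+\<tau>. ennreal (energy \<mu> (?raw @ [(R k lg, \<tau>)], snd s \<or> derailed \<mu> ?raw lg)) \<partial>traj_pmf H \<mu> (R k lg)) \<le> ennreal ?b"
      if k: "k \<in> phase l" and lg: "lg \<in> set_pmf (hal ?raw)" for k lg
    proof (cases "derailed \<mu> ?raw lg")
      case True
      then show ?thesis by (simp add: energy_def)
    next
      case False
      obtain U es where Ues: "lg = (U, es)" by (cases lg)
      have "pmf (hal ?raw) (U, es) \<noteq> 0" using lg Ues by (simp add: set_pmf_iff)
      then have es: "erase es = erase ?raw" and U: "U = UE (erase es)" and w: "hal_weight U es \<noteq> 0"
        using pmf_hal[OF ok ev, of U es] by (auto split: if_splits)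
      \<comment> \<open>Here \<open>w\<close> says that the ledger has positive mass under the
        hallucination; the integrals that follow turn this into the positive evidence that
        \<open>progress\<close> asks for.\<close>
      have Ur: "U = UE ?raw" using U under_explored_cong[of "erase es" ?raw] es by simp
      have es_ok: "raw_ok es" using ok raw_ok_cong[OF es] by simp
      have "0 \<noteq> (\<integral>\<nu>. lik H (U, es) \<nu> * pun_ind e U \<nu> \<partial>prior)" using w by (auto simp: hal_weight_def)
      moreover have "0 \<le> (\<integral>\<nu>. lik H (U, es) \<nu> * pun_ind e U \<nu> \<partial>prior)" by (rule integral_nonneg_prior) auto
      moreover have "(\<integral>\<nu>. lik H (U, es) \<nu> * pun_ind e U \<nu> \<partial>prior) \<le> (\<integral>\<nu>. lik H (U, es) \<nu> \<partial>prior)"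
        by (intro integral_mono_prior integrable_lik_times[OF es_ok pun_ind_measurable, where B=1] integrable_lik es_ok) auto
      ultimately have L: "0 < (\<integral>\<nu>. lik H (UE ?raw, es) \<nu> \<partial>prior)" unfolding Ur by linarith
      have len: "length es = l"
        using arg_cong[OF es, of length] length_raw_proc[OF raw] by simp
      have kl: "k div N = length es"
        unfolding len using k by (intro div_nat_eqI) (auto simp: mult.commute)
      have "x / (3 * real H) \<le> visit_prob H \<mu> (rules tb k (UE ?raw, es)) (UE ?raw)"
        by (rule progress[OF \<mu> ok es kl pmf_raw_proc_support(1)[OF R \<mu> raw] L _ _ t0])
           (use False in \<open>auto simp: derailed_def Ues Ur\<close>)
      then have "p0 \<le> visit_prob H \<mu> (R k lg) (UE ?raw)" by (simp add: p0_def Ues Ur)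
      from energy_visit[OF \<mu> this]
      have "(\<integral>\<^sup>+\<tau>. ennreal ((1 / 2) ^ potential (?raw @ [(R k lg, \<tau>)])) \<partial>traj_pmf H \<mu> (R k lg)) \<le> ennreal ?b" .
      moreover have "(\<integral>\<^sup>+\<tau>. ennreal (energy \<mu> (?raw @ [(R k lg, \<tau>)], snd s \<or> derailed \<mu> ?raw lg)) \<partial>traj_pmf H \<mu> (R k lg)) \<le>
        (\<integral>\<^sup>+\<tau>. ennreal ((1 / 2) ^ potential (?raw @ [(R k lg, \<tau>)])) \<partial>traj_pmf H \<mu> (R k lg))"
        by (intro nn_integral_mono ennreal_leI) (simp add: energy_def)
      ultimately show ?thesis by (rule order_trans[rotated])
    qed
    have const: "(\<integral>\<^sup>+y. f y \<partial>measure_pmf p) \<le> c" if "\<And>y. y \<in> set_pmf p \<Longrightarrow> f y \<le> c" for p :: "'y pmf" and f and c :: ennreal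
    proof -
      have "(\<integral>\<^sup>+y. f y \<partial>measure_pmf p) \<le> (\<integral>\<^sup>+y. c \<partial>measure_pmf p)"
        using that by (intro nn_integral_mono_AE) (auto simp: AE_measure_pmf_iff)
      then show ?thesis by simp
    qed
    have "(\<integral>\<^sup>+s'. ennreal (energy \<mu> s') \<partial>flag_step \<mu> l s) \<le> ennreal ?b"
      unfolding flag_step_def nn_integral_bind_pmf nn_integral_map_pmf
      by (intro const inner) (simp_all only: set_phase)
    also have "\<dots> = ennreal (1 - p0 / 2) * ennreal (energy \<mu> s)"
      using True p0_bounds by (simp add: energy_def ennreal_mult)
    finally show ?thesis .
  qed
qed

lemma energy_proc:
  assumes \<mu>: "valid \<mu>" and ev: "\<forall>j<l. \<forall>raw\<in>set_pmf (raw_proc \<mu> R j). 0 < (\<integral>\<nu>. erased_lik H raw \<nu> \<partial>prior)"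
  shows "(\<integral>\<^sup>+s. ennreal (energy \<mu> s) \<partial>flag_proc \<mu> l) \<le> ennreal ((1 - p0 / 2) ^ l)"
  using ev
proof (induction l)
  case 0
  have "energy \<mu> s \<le> 1" for s by (simp add: energy_def power_le_one)
  then show ?case by simp
next
  case (Suc l)
  have "(\<integral>\<^sup>+s. ennreal (energy \<mu> s) \<partial>flag_proc \<mu> (Suc l)) = (\<integral>\<^sup>+s. \<integral>\<^sup>+s'. ennreal (energy \<mu> s') \<partial>flag_step \<mu> l s \<partial>flag_proc \<mu> l)"
    by simp
  also have "\<dots> \<le> (\<integral>\<^sup>+s. ennreal (1 - p0 / 2) * ennreal (energy \<mu> s) \<partial>flag_proc \<mu> l)"
  proof (rule nn_integral_mono_AE, unfold AE_measure_pmf_iff, intro ballI)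
    fix s assume "s \<in> set_pmf (flag_proc \<mu> l)"
    then have "fst s \<in> set_pmf (raw_proc \<mu> R l)" by (rule flag_proc_support)
    with Suc.prems show "(\<integral>\<^sup>+s'. ennreal (energy \<mu> s') \<partial>flag_step \<mu> l s) \<le> ennreal (1 - p0 / 2) * ennreal (energy \<mu> s)"
      by (intro energy_step \<mu>) auto
  qed
  also have "\<dots> = ennreal (1 - p0 / 2) * (\<integral>\<^sup>+s. ennreal (energy \<mu> s) \<partial>flag_proc \<mu> l)"
    by (rule nn_integral_cmult) simp
  also have "\<dots> \<le> ennreal (1 - p0 / 2) * ennreal ((1 - p0 / 2) ^ l)"
  proof (rule mult_left_mono[OF Suc.IH])
    show "\<forall>j<l. \<forall>raw\<in>set_pmf (raw_proc \<mu> R j). 0 < (\<integral>\<nu>. erased_lik H raw \<nu> \<partial>prior)"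
      using Suc.prems less_SucI by blast
  qed simp
  also have "\<dots> = ennreal ((1 - p0 / 2) ^ Suc l)" using p0_bounds by (simp add: ennreal_mult)
  finally show ?case .
qed

definition \<beta> :: real where "\<beta> = 6 * (real S * A * H) * 2 ^ S * exp (- 2 * \<eta>\<^sup>2 * n)"

text \<open>The potential never exceeds \<open>S * A * H * n\<close>, so
  \<open>2 ^ (S * A * H * n)\<close> times the energy is at least 1 on every pending run without
  flag. Markov's inequality bounds these runs, and the sum over phases bounds the flagged
  ones.\<close>

lemma pending_le:
  assumes \<mu>: "valid \<mu>" and ev: "\<forall>j<l. \<forall>raw\<in>set_pmf (raw_proc \<mu> R j). 0 < (\<integral>\<nu>. erased_lik H raw \<nu> \<partial>prior)"
  shows "measure_pmf.prob (raw_proc \<mu> R l) {raw. pending \<rho> \<mu> raw} \<le>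
    (\<Sum>j<l. \<beta> + measure_pmf.prob (hal_proc \<mu> R j) (atypical \<eta> d)) + 2 ^ (S * A * H * n) * (1 - p0 / 2) ^ l"
proof -
  have R: "rule_ok R" by (rule rules_ok[OF tb])
  let ?M = "S * A * H * n"
  have point: "indicator {s. pending \<rho> \<mu> (fst s)} s \<le> indicator {s. snd s} s + ennreal (2 ^ ?M) * ennreal (energy \<mu> s)" for s
  proof (cases "pending \<rho> \<mu> (fst s) \<and> \<not> snd s")
    case True
    have "(1 :: real) = 2 ^ potential (fst s) * (1 / 2) ^ potential (fst s)" by (simp add: power_mult_distrib[symmetric])
    also have "\<dots> \<le> 2 ^ ?M * (1 / 2) ^ potential (fst s)"
      by (intro mult_right_mono power_increasing potential_le) auto
    finally have "1 \<le> ennreal (2 ^ ?M * energy \<mu> s)" using True by (simp add: energy_def)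
    then show ?thesis using True by (simp add: ennreal_mult energy_def)
  qed (auto simp: indicator_def)
  have "emeasure (raw_proc \<mu> R l) {raw. pending \<rho> \<mu> raw} = (\<integral>\<^sup>+s. indicator {s. pending \<rho> \<mu> (fst s)} s \<partial>flag_proc \<mu> l)"
    by (simp add: fst_flag_proc[symmetric] vimage_def)
  also have "\<dots> \<le> (\<integral>\<^sup>+s. indicator {s. snd s} s + ennreal (2 ^ ?M) * ennreal (energy \<mu> s) \<partial>flag_proc \<mu> l)"
    by (intro nn_integral_mono point)
  also have "\<dots> = emeasure (flag_proc \<mu> l) {s. snd s} + ennreal (2 ^ ?M) * (\<integral>\<^sup>+s. ennreal (energy \<mu> s) \<partial>flag_proc \<mu> l)"
    by (simp add: nn_integral_add nn_integral_cmult)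
  also have "\<dots> \<le> (\<Sum>j<l. emeasure (raw_proc \<mu> R j) {raw. \<not> close_dynamics \<eta> \<mu> raw} + emeasure (hal_proc \<mu> R j) (atypical \<eta> d)) +
      ennreal (2 ^ ?M) * ennreal ((1 - p0 / 2) ^ l)"
    by (intro add_mono flag_le mult_left_mono energy_proc \<mu> ev) simp
  also have "\<dots> \<le> (\<Sum>j<l. ennreal (\<beta> + measure_pmf.prob (hal_proc \<mu> R j) (atypical \<eta> d))) + ennreal (2 ^ ?M * (1 - p0 / 2) ^ l)"
  proof (intro add_mono sum_mono)
    fix j
    have "measure_pmf.prob (raw_proc \<mu> R j) {raw. \<not> close_dynamics \<eta> \<mu> raw} \<le>
       measure_pmf.prob (raw_proc \<mu> R j) {raw. \<not> (close_rewards \<eta> \<mu> raw \<and> close_dynamics \<eta> \<mu> raw)}"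
      by (intro measure_pmf.finite_measure_mono) auto
    also have "\<dots> \<le> \<beta>" unfolding \<beta>_def by (rule not_close_bound[OF R \<eta>_pos \<mu>])
    finally show "emeasure (raw_proc \<mu> R j) {raw. \<not> close_dynamics \<eta> \<mu> raw} + emeasure (hal_proc \<mu> R j) (atypical \<eta> d) \<le>
      ennreal (\<beta> + measure_pmf.prob (hal_proc \<mu> R j) (atypical \<eta> d))"
      by (simp add: measure_pmf.emeasure_eq_measure ennreal_plus[symmetric] ennreal_leI del: ennreal_plus)
  qed (use p0_bounds in \<open>simp add: ennreal_mult\<close>)
  also have "\<dots> = ennreal ((\<Sum>j<l. \<beta> + measure_pmf.prob (hal_proc \<mu> R j) (atypical \<eta> d)) + 2 ^ ?M * (1 - p0 / 2) ^ l)"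
    using p0_bounds by (subst sum_ennreal) (auto simp: ennreal_plus[symmetric] \<beta>_def sum_nonneg simp del: ennreal_plus)
  finally have "emeasure (raw_proc \<mu> R l) {raw. pending \<rho> \<mu> raw} \<le>
    ennreal ((\<Sum>j<l. \<beta> + measure_pmf.prob (hal_proc \<mu> R j) (atypical \<eta> d)) + 2 ^ ?M * (1 - p0 / 2) ^ l)" .
  moreover have "0 \<le> (\<Sum>j<l. \<beta> + measure_pmf.prob (hal_proc \<mu> R j) (atypical \<eta> d)) + 2 ^ ?M * (1 - p0 / 2) ^ l"
    using p0_bounds by (intro add_nonneg_nonneg sum_nonneg mult_nonneg_nonneg zero_le_power) (auto simp: \<beta>_def)
  ultimately show ?thesis unfolding measure_pmf.emeasure_eq_measure by (simp only: ennreal_le_iff)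
qed

text \<open>\<open>pending_le\<close> holds for almost every model, with the atypical probabilities
  left as they are; \<open>prob_atypical\<close> bounds them only in the mean over the prior, so it
  enters after integration.\<close>

lemma success_ge:
  "1 - real (K div N) * (\<beta> + \<beta> / (d * q)) - 2 ^ (S * A * H * n) * (1 - p0 / 2) ^ (K div N) \<le>
    hh_success S A H prior tb N n e \<rho> n K"
proof -
  have R: "rule_ok R" by (rule rules_ok[OF tb])
  let ?l = "K div N" and ?T = "2 ^ (S * A * H * n) * (1 - p0 / 2) ^ (K div N)"
  let ?a = "\<lambda>j \<mu>. measure_pmf.prob (hal_proc \<mu> R j) (atypical \<eta> d)"
  let ?f = "\<lambda>\<mu>. measure_pmf.prob (run_phases S A H prior N n e \<mu> R (Suc ?l)) {hs. explored S A H \<rho> n K \<mu> hs}"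
  have am: "?a j \<in> borel_measurable prior" for j
    using pmf_kernel_prob[OF kernel_hal_proc[OF R], of "\<lambda>_ lg. lg \<in> atypical \<eta> d" j] by simp
  have ai: "integrable prior (?a j)" for j
    by (intro integrable_bounded[where B=1] am) auto
  have "AE \<mu> in prior. \<forall>j\<in>{..<?l}. \<forall>raw\<in>set_pmf (raw_proc \<mu> R j). 0 < (\<integral>\<nu>. erased_lik H raw \<nu> \<partial>prior)"
    using AE_raw_evidence[OF R] by (intro AE_finite_allI) auto
  then have AE: "AE \<mu> in prior. 1 - ((\<Sum>j<?l. \<beta> + ?a j \<mu>) + ?T) \<le> ?f \<mu>"
    using AE_space
  proof eventually_elim
    case (elim \<mu>)
    have "measure_pmf.prob (raw_proc \<mu> R ?l) {raw. pending \<rho> \<mu> raw} \<le> (\<Sum>j<?l. \<beta> + ?a j \<mu>) + ?T"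
      using elim by (intro pending_le) (auto simp: space_prior)
    moreover have "?l * N \<le> K" by (rule div_times_less_eq_dividend)
    ultimately show ?case using prob_explored_ge[of ?l K \<mu> R \<rho>] by linarith
  qed
  have int: "integrable prior (\<lambda>\<mu>. 1 - ((\<Sum>j<?l. \<beta> + ?a j \<mu>) + ?T))"
    using ai by (intro Bochner_Integration.integrable_diff Bochner_Integration.integrable_add Bochner_Integration.integrable_sum integrable_const) auto
  have "(\<integral>\<mu>. 1 - ((\<Sum>j<?l. \<beta> + ?a j \<mu>) + ?T) \<partial>prior) \<le> (\<integral>\<mu>. ?f \<mu> \<partial>prior)"
    by (intro integral_mono_AE int AE integrable_bounded[where B=1] explored_measurable R) auto
  also have "\<dots> = hh_success S A H prior tb N n e \<rho> n K" by (simp add: hh_success_def)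
  also have "(\<integral>\<mu>. 1 - ((\<Sum>j<?l. \<beta> + ?a j \<mu>) + ?T) \<partial>prior) = 1 - ((\<Sum>j<?l. \<beta> + (\<integral>\<mu>. ?a j \<mu> \<partial>prior)) + ?T)"
    using ai by (simp add: prob_space sum.distrib)
  finally have 1: "1 - ((\<Sum>j<?l. \<beta> + (\<integral>\<mu>. ?a j \<mu> \<partial>prior)) + ?T) \<le> hh_success S A H prior tb N n e \<rho> n K" .
  have "(\<Sum>j<?l. \<beta> + (\<integral>\<mu>. ?a j \<mu> \<partial>prior)) \<le> (\<Sum>j<?l. \<beta> + \<beta> / (d * q))"
  proof (intro sum_mono add_left_mono)
    fix j
    have "(\<integral>\<mu>. ?a j \<mu> \<partial>prior) \<le> 1 / d * \<beta> / q"
      unfolding \<beta>_def by (rule prob_atypical[OF R d_bounds \<eta>_pos])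
    then show "(\<integral>\<mu>. ?a j \<mu> \<partial>prior) \<le> \<beta> / (d * q)" by simp
  qed
  with 1 show ?thesis by simp
qed

end

section \<open>Parameter choice\<close>

text \<open>\<open>x\<close> stands for \<open>r_alt * \<rho>\<close>. Half of
  \<open>\<delta>\<close> is spent on failures of closeness and typicality over all \<open>L\<close>
  phases, half on the chance that \<open>L\<close> phases are too few. In the first half
  \<open>W\<close> dominates \<open>H\<close>, \<open>1 / x\<close> and \<open>H / (x * q)\<close>,
  which reduces the estimate to a comparison of powers of \<open>W\<close>.\<close>

lemma exploration_failure_small:
  fixes S A H n :: nat and x q \<delta> :: real
  assumes pos: "0 < S" "0 < A" "0 < H" and x: "0 < x" "x \<le> 1" and q: "0 < q" "q \<le> 1" and \<delta>: "0 < \<delta>" "\<delta> \<le> 1"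
    and n: "38880 * real H ^ 4 / x\<^sup>2 * (real S + ln (real S * A * H / (\<delta> * x * q))) \<le> real n"
  defines "L \<equiv> nat \<lceil>104 * real n * S * A * real H ^ 4 / (q * x ^ 3)\<rceil> div (nat \<lceil>6 * real H / (q * x)\<rceil> + 1)"
  defines "\<beta> \<equiv> 6 * (real S * A * H) * 2 ^ S * exp (- 2 * (x / (36 * real H ^ 2))\<^sup>2 * n)"
  shows "real L * (\<beta> + \<beta> / (x / (12 * real H) * q)) + 2 ^ (S * A * H * n) * (1 - x / (3 * real H) / 2) ^ L \<le> \<delta>"
proof -
  define s where "s = real S * A * H"
  define W where "W = s / (x * q)"
  define \<Lambda> where "\<Lambda> = W / \<delta>"
  define y where "y = (x / (36 * real H ^ 2))\<^sup>2"
  have one: "1 \<le> real S" "1 \<le> real A" "1 \<le> real H" using pos by linarith+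
  have s_H: "real H \<le> s"
  proof -
    have "1 * 1 * real H \<le> real S * A * H" using one by (intro mult_mono) auto
    then show ?thesis by (simp add: s_def)
  qed
  have s1: "1 \<le> s" using s_H one by linarith
  have xq: "0 < x * q" "x * q \<le> x" "x * q \<le> 1" using x q by (auto intro: mult_left_le mult_le_one)
  have W_s: "s \<le> W"
    using xq s1 unfolding W_def by (simp add: le_divide_eq mult_left_le)
  have W1: "1 \<le> W" and W_H: "real H \<le> W" using W_s s1 s_H by linarith+
  have W_x: "1 / x \<le> W"
  proof -
    have "1 / x \<le> s / (x * q)" using s1 xq x by (intro frac_le) auto
    then show ?thesis by (simp add: W_def)
  qed
  have \<Lambda>_W: "W \<le> \<Lambda>" using \<delta> W1 by (simp add: \<Lambda>_def le_divide_eq mult_left_le)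
  have \<Lambda>1: "1 \<le> \<Lambda>" using \<Lambda>_W W1 by linarith
  have \<Lambda>_eq: "real S * A * H / (\<delta> * x * q) = \<Lambda>" by (simp add: \<Lambda>_def W_def s_def mult_ac)
  have y_eq: "y = x\<^sup>2 / (1296 * real H ^ 4)" by (simp add: y_def power_divide power_mult_distrib)
  have y0: "0 < y" using x pos by (simp add: y_eq)
  \<comment> \<open>38880 is 30 times \<open>36 ^ 2\<close>, and \<open>y\<close> is the square of
    the tolerance \<open>x / (36 * real H ^ 2)\<close>. The thirtyfold exponent is a reserve for
    \<open>2 ^ S\<close> and for the powers of \<open>W\<close> below.\<close>
  have yn: "30 * (S + ln \<Lambda>) \<le> y * n"
  proof -
    have "y * (38880 * real H ^ 4 / x\<^sup>2 * (S + ln \<Lambda>)) \<le> y * n"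
      using n y0 unfolding \<Lambda>_eq by (intro mult_left_mono) auto
    moreover have "y * (38880 * real H ^ 4 / x\<^sup>2 * (S + ln \<Lambda>)) = 30 * (S + ln \<Lambda>)"
      using x pos by (simp add: y_eq field_simps)
    ultimately show ?thesis by simp
  qed
  have n_ge: "S + ln \<Lambda> \<le> n"
  proof -
    have "1 \<le> real H ^ 4" "x\<^sup>2 \<le> 1" using one x by (auto simp: power_le_one)
    then have "y \<le> 1" unfolding y_eq by (simp add: divide_le_eq)
    then have "y * n \<le> n" by (simp add: mult_left_le_one_le y0 less_imp_le)
    moreover have "0 \<le> S + ln \<Lambda>" using \<Lambda>1 by simp
    moreover have "z \<le> w" if "30 * z \<le> v" "v \<le> w" "0 \<le> z" for z v w :: real
      using that by linarith
    ultimately show ?thesis using yn by blast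
  qed
  have n1: "1 \<le> real n"
  proof -
    have "0 \<le> ln \<Lambda>" using \<Lambda>1 by simp
    then show ?thesis using n_ge one by linarith
  qed
  have e2: "2 \<le> exp (1 :: real)" using exp_ge_add_one_self[of 1] by simp
  let ?K = "nat \<lceil>104 * real n * S * A * real H ^ 4 / (q * x ^ 3)\<rceil>" and ?N = "nat \<lceil>6 * real H / (q * x)\<rceil> + 1"
  let ?k = "104 * real n * S * A * real H ^ 4 / (q * x ^ 3)"
  have k0: "0 \<le> ?k" using x q by simp
  have K_ge: "?k \<le> real ?K" using k0 by linarith
  have K_le: "real ?K \<le> ?k + 1" using k0 by linarith

  have first: "real L * (\<beta> + \<beta> / (x / (12 * real H) * q)) \<le> \<delta> / 2"
  proof -
    have "real H ^ 3 \<le> W ^ 3" "(1 / x) ^ 2 \<le> W ^ 2" using W_H W_x x by (auto intro!: power_mono simp del: power_divide)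
    then have "W * real H ^ 3 * (1 / x) ^ 2 \<le> W * W ^ 3 * W ^ 2"
      using W1 by (intro mult_mono mult_left_mono) auto
    then have WW: "W * real H ^ 3 * (1 / x) ^ 2 \<le> W ^ 6" by (simp add: power_numeral_reduce mult_ac)
    have "?k = 104 * n * (W * real H ^ 3 * (1 / x) ^ 2)"
      using x q by (simp add: W_def s_def power_numeral_reduce field_simps)
    also have "\<dots> \<le> 104 * n * W ^ 6" using WW by (intro mult_left_mono) auto
    finally have k_le: "?k \<le> 104 * n * W ^ 6" .
    have "1 * 1 \<le> n * W ^ 6" using n1 W1 by (intro mult_mono) auto
    then have K_W: "real ?K \<le> 105 * n * W ^ 6" using K_le k_le by linarith
    have "real L \<le> real ?K" unfolding L_def by (simp add: div_le_dividend)
    then have L_W: "real L \<le> 105 * n * W ^ 6" using K_W by linarith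
    have \<beta>: "\<beta> = 6 * s * 2 ^ S * exp (- (2 * y * n))" by (simp add: \<beta>_def s_def y_def)
    have \<beta>0: "0 \<le> \<beta>" using s1 by (simp add: \<beta>)
    have H_xq: "real H / (x * q) \<le> W" unfolding W_def using s_H xq by (intro divide_right_mono) auto
    have dq: "\<beta> / (x / (12 * real H) * q) = 12 * (real H / (x * q)) * \<beta>" by (simp add: mult_ac)
    have "\<beta> + \<beta> / (x / (12 * real H) * q) \<le> W * \<beta> + 12 * W * \<beta>"
      unfolding dq using W1 H_xq \<beta>0 by (intro add_mono mult_right_mono) (auto simp: mult_le_cancel_right1)
    also have "\<dots> \<le> 24 * W * \<beta>" using W1 \<beta>0 by (simp add: mult_right_mono)
    also have "\<dots> \<le> 24 * W * (6 * W * 2 ^ S * exp (- (2 * y * n)))"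
      unfolding \<beta> using W_s W1 by (intro mult_left_mono mult_right_mono) auto
    finally have b: "\<beta> + \<beta> / (x / (12 * real H) * q) \<le> 24 * W * (6 * W * 2 ^ S * exp (- (2 * y * n)))" .
    have "real L * (\<beta> + \<beta> / (x / (12 * real H) * q)) \<le> (105 * n * W ^ 6) * (24 * W * (6 * W * 2 ^ S * exp (- (2 * y * n))))"
      using L_W b W1 \<beta>0 x q by (intro mult_mono) auto
    \<comment> \<open>The bound on \<open>L\<close> is linear in \<open>n\<close>. One half of the
      exponent absorbs that factor, by \<open>z \<le> exp z\<close>, and the other half beats the
      parameters.\<close>
    also have "exp (- (2 * y * n)) = exp (- (y * n)) * exp (- (y * n))" by (simp add: exp_add[symmetric])
    also have "(105 * n * W ^ 6) * (24 * W * (6 * W * 2 ^ S * (exp (- (y * n)) * exp (- (y * n))))) =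
      15120 * W ^ 8 * 2 ^ S * (n * exp (- (y * n))) * exp (- (y * n))"
      by (simp add: power_numeral_reduce mult_ac)
    also have "\<dots> \<le> 15120 * W ^ 8 * 2 ^ S * (1296 * W ^ 6) * (exp (- 30 * real S) * (1 / \<Lambda> ^ 30))"
    proof -
      have "y * n \<le> exp (y * n)" using exp_ge_add_one_self[of "y * n"] by linarith
      then have "n * exp (- (y * n)) \<le> 1 / y" using y0 by (simp add: exp_minus field_simps)
      also have "1 / y = 1296 * (real H ^ 4 * (1 / x) ^ 2)" using x by (simp add: y_eq power_divide)
      also have "\<dots> \<le> 1296 * (W ^ 4 * W ^ 2)"
        using W_H W_x x W1 by (intro mult_left_mono mult_mono power_mono) auto
      finally have 1: "n * exp (- (y * n)) \<le> 1296 * W ^ 6" by (simp add: power_numeral_reduce mult_ac)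
      have "exp (- (y * n)) \<le> exp (- 30 * real S + - (30 * ln \<Lambda>))" using yn by simp
      also have "\<dots> = exp (- 30 * real S) * (1 / exp (real 30 * ln \<Lambda>))" by (simp only: exp_add exp_minus inverse_eq_divide of_nat_numeral)
      also have "exp (real 30 * ln \<Lambda>) = \<Lambda> ^ 30" using \<Lambda>1 by (subst exp_of_nat_mult) simp
      finally have 2: "exp (- (y * n)) \<le> exp (- 30 * real S) * (1 / \<Lambda> ^ 30)" .
      show ?thesis
        by (rule mult_mono[OF mult_left_mono[OF 1] 2]) (use W1 in auto)
    qed
    also have "\<dots> = 19595520 * (2 ^ S * exp (- 30 * real S)) * (W ^ 14 * (1 / \<Lambda> ^ 30))"
      by (simp add: power_numeral_reduce mult_ac)
    also have "\<dots> \<le> 19595520 * (1 / 2 ^ 29) * \<delta>"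
    proof -
      \<comment> \<open>One power of \<open>\<Lambda>\<close> is kept in reserve:
        \<open>1 / \<Lambda>\<close> is at most \<open>\<delta>\<close>, which supplies the required
        factor.\<close>
      have "W ^ 14 \<le> \<Lambda> ^ 29"
        using power_mono[OF \<Lambda>_W, of 14] power_increasing[of 14 29 \<Lambda>] \<Lambda>1 W1 by linarith
      then have "W ^ 14 * (1 / \<Lambda> ^ 30) \<le> \<Lambda> ^ 29 * (1 / \<Lambda> ^ 30)" by (intro mult_right_mono) (use \<Lambda>1 in auto)
      also have "\<dots> = 1 / \<Lambda>" using \<Lambda>1 by (simp add: power_numeral_reduce)
      also have "\<dots> \<le> \<delta>" using W1 \<delta> by (simp add: \<Lambda>_def divide_le_eq)
      finally have 1: "W ^ 14 * (1 / \<Lambda> ^ 30) \<le> \<delta>" .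
      have "(2 :: real) ^ S \<le> exp 1 ^ S" by (intro power_mono e2) auto
      also have "\<dots> = exp (real S)" by (simp add: exp_of_nat_mult[symmetric])
      finally have "(2 :: real) ^ S * exp (- 30 * real S) \<le> exp (real S) * exp (- 30 * real S)" by (intro mult_right_mono) auto
      also have "\<dots> = exp (- 29 * real S)" by (simp add: exp_add[symmetric])
      also have "\<dots> \<le> exp (- 29)" using one by simp
      also have "\<dots> = 1 / exp (real 29 * 1)" by (simp add: exp_minus inverse_eq_divide)
      also have "exp (real 29 * 1) = exp (1::real) ^ 29" by (rule exp_of_nat_mult)
      also have "1 / exp (1::real) ^ 29 \<le> 1 / 2 ^ 29" using power_mono[OF e2, of 29] by (intro divide_left_mono) auto
      finally have 2: "2 ^ S * exp (- 30 * real S) \<le> 1 / 2 ^ 29" .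
      show ?thesis
        by (rule mult_mono[OF mult_left_mono[OF 2] 1]) (use W1 \<Lambda>1 in auto)
    qed
    \<comment> \<open>19595520 is less than \<open>2 ^ 28\<close>.\<close>
    also have "\<dots> \<le> \<delta> / 2" using \<delta> by simp
    finally show ?thesis .
  qed

  have second: "2 ^ (S * A * H * n) * (1 - x / (3 * real H) / 2) ^ L \<le> \<delta> / 2"
  proof -
    define M where "M = s * n"
    have M: "real (S * A * H * n) = M" by (simp add: M_def s_def)
    have M_n: "real n \<le> M" using mult_right_mono[OF s1, of "real n"] by (simp add: M_def)
    have qx: "0 < q * x" "q * x \<le> 1" using xq by (auto simp: mult.commute)
    have Hqx: "1 \<le> real H / (q * x)" using one qx by (simp add: le_divide_eq)
    have N_le: "real ?N \<le> 8 * (real H / (q * x))"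
    proof -
      have "0 \<le> 6 * real H / (q * x)" using qx by simp
      then have "real (nat \<lceil>6 * real H / (q * x)\<rceil>) \<le> 6 * real H / (q * x) + 1" by linarith
      then have "real ?N \<le> 6 * real H / (q * x) + 2" by linarith
      also have "\<dots> \<le> 8 * (real H / (q * x))" using Hqx by simp
      finally show ?thesis .
    qed
    have N0: "0 < real ?N" by simp
    have Hx: "1 \<le> real H / x" using one x by (simp add: le_divide_eq)
    \<comment> \<open>The 104 in the horizon is 13 times the 8 of \<open>N_le\<close>. Rounding down
      the number of phases costs one phase, which leaves 12 of the 13; multiplied by
      \<open>x / (3 * real H) / 2\<close> this yields the decay \<open>exp (- (2 * M))\<close>
      against the initial factor \<open>2 ^ M\<close>.\<close>
    have "13 * M * (real H / x) * (real H / x) = ?k / (8 * (real H / (q * x)))"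
      using x q pos by (simp add: M_def s_def field_simps power_numeral_reduce)
    also have "\<dots> \<le> real ?K / real ?N"
      using K_ge N_le N0 k0 by (intro frac_le) auto
    also have "\<dots> \<le> real L + 1"
    proof -
      have "?K \<le> ?N + L * ?N" unfolding L_def by (intro less_imp_le dividend_less_div_times) simp
      from of_nat_mono[OF this, where 'a=real] have "real ?K \<le> (real L + 1) * real ?N"
        by (simp only: of_nat_add of_nat_mult distrib_right) simp
      then show ?thesis using N0 by (simp only: pos_divide_le_eq)
    qed
    finally have L_ge: "13 * M * (real H / x) * (real H / x) \<le> real L + 1" .
    have M1: "1 \<le> M" using M_n n1 by linarith
    have MH: "1 \<le> M * (real H / x)" using mult_mono[OF M1 Hx] M1 by simp
    have "13 * (M * (real H / x)) * 1 \<le> 13 * (M * (real H / x)) * (real H / x)"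
      using Hx MH by (intro mult_left_mono) auto
    also have "\<dots> = 13 * M * (real H / x) * (real H / x)" by (simp only: mult.assoc)
    also note L_ge
    finally have "12 * (M * (real H / x)) \<le> L" using MH by linarith
    then have "x / (3 * real H) / 2 * (12 * (M * (real H / x))) \<le> x / (3 * real H) / 2 * L"
      using x by (intro mult_left_mono) auto
    then have pL: "2 * M \<le> x / (3 * real H) / 2 * L" using x pos by simp
    have "x \<le> 3 * real H * 2" using x one by linarith
    then have base: "0 \<le> 1 - x / (3 * real H) / 2" using pos by simp
    have "1 - x / (3 * real H) / 2 \<le> exp (- (x / (3 * real H) / 2))"
      using exp_ge_add_one_self[of "- (x / (3 * real H) / 2)"] by simp
    then have "(1 - x / (3 * real H) / 2) ^ L \<le> exp (- (x / (3 * real H) / 2)) ^ L"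
      using base by (rule power_mono)
    also have "\<dots> = exp (real L * - (x / (3 * real H) / 2))" by (rule exp_of_nat_mult[symmetric])
    also have "\<dots> \<le> exp (- (2 * M))" using pL by (simp add: mult.commute)
    finally have p: "(1 - x / (3 * real H) / 2) ^ L \<le> exp (- (2 * M))" .
    have "(2 :: real) ^ (S * A * H * n) \<le> exp 1 ^ (S * A * H * n)" by (intro power_mono e2) auto
    also have "\<dots> = exp (real (S * A * H * n) * 1)" by (rule exp_of_nat_mult[symmetric])
    finally have two: "(2 :: real) ^ (S * A * H * n) \<le> exp M" unfolding M by simp
    have "2 ^ (S * A * H * n) * (1 - x / (3 * real H) / 2) ^ L \<le> exp M * exp (- (2 * M))"
      using two p base by (intro mult_mono) auto
    also have "\<dots> = exp (- M)" by (simp add: exp_add[symmetric])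
    also have "\<dots> \<le> exp (- 1 + ln \<delta>)"
    proof -
      have "ln \<Lambda> = ln W - ln \<delta>" unfolding \<Lambda>_def using W1 \<delta> by (simp add: ln_div)
      moreover have "0 \<le> ln W" using W1 by simp
      ultimately have "1 - ln \<delta> \<le> M" using n_ge one M_n by linarith
      then show ?thesis by simp
    qed
    also have "\<dots> = \<delta> / exp 1" using \<delta> unfolding exp_add exp_minus by (simp add: field_simps)
    also have "\<dots> \<le> \<delta> / 2" using \<delta> e2 by (intro divide_left_mono) auto
    finally show ?thesis .
  qed
  show ?thesis using first second by linarith
qed

theorem theorem3:
  shows "\<exists>c1 c2 :: real. 0 < c1 \<and> 0 < c2 \<and>
    (\<forall>(S::nat) (A::nat) (H::nat) (Rset::real set) (prior::model measure)
       (tb::policy set \<Rightarrow> policy) (\<rho>::real) (\<delta>::real) (n::nat).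
      let ra = r_alt S A H prior;
          \<epsilon> = ra * \<rho> / (18 * real H);
          qp = q_pun S A H prior \<epsilon>
      in
      0 < S \<longrightarrow> 0 < A \<longrightarrow> 0 < H \<longrightarrow>
      countable Rset \<longrightarrow> Rset \<subseteq> {0..1} \<longrightarrow>
      prob_space prior \<longrightarrow> sets prior = sets (model_space S A H Rset) \<longrightarrow>
      (\<forall>X. X \<noteq> {} \<longrightarrow> tb X \<in> X) \<longrightarrow>
      0 < \<rho> \<longrightarrow> \<rho> \<le> 1 \<longrightarrow> 0 < \<delta> \<longrightarrow> \<delta> \<le> 1 \<longrightarrow>
      0 < ra \<longrightarrow> 0 < qp \<longrightarrow>
      real n \<ge> c1 * real H ^ 4 / (\<rho>\<^sup>2 * ra\<^sup>2)
                 * (real S + ln (real S * real A * real H / (\<delta> * \<rho> * ra * qp))) \<longrightarrow>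
      (\<exists>Nph > 0. hh_success S A H prior tb Nph n \<epsilon> \<rho> n
           (nat \<lceil>c2 * real n * real S * real A * real H ^ 4 / (qp * \<rho> ^ 3 * ra ^ 3)\<rceil>)
         \<ge> 1 - \<delta>))"
proof (rule exI[of _ 38880], rule exI[of _ 104], intro conjI allI)
  fix S A H :: nat and Rset :: "real set" and prior :: "model measure"
    and tb :: "policy set \<Rightarrow> policy" and \<rho> \<delta> :: real and n :: nat
  define ra where "ra = r_alt S A H prior"
  define e where "e = ra * \<rho> / (18 * real H)"
  define qp where "qp = q_pun S A H prior e"
  define y where "y = ra * \<rho>"
  have "\<exists>Nph > 0. hh_success S A H prior tb Nph n e \<rho> n
           (nat \<lceil>104 * real n * real S * real A * real H ^ 4 / (qp * \<rho> ^ 3 * ra ^ 3)\<rceil>) \<ge> 1 - \<delta>"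
    if pos: "0 < S" "0 < A" "0 < H" and "countable Rset" "Rset \<subseteq> {0..1}" "prob_space prior"
      "sets prior = sets (model_space S A H Rset)" and tb: "\<forall>X. X \<noteq> {} \<longrightarrow> tb X \<in> X"
      and \<rho>: "0 < \<rho>" "\<rho> \<le> 1" and \<delta>: "0 < \<delta>" "\<delta> \<le> 1" and ra: "0 < ra" and qp: "0 < qp"
      and n: "38880 * real H ^ 4 / (\<rho>\<^sup>2 * ra\<^sup>2) * (real S + ln (real S * real A * real H / (\<delta> * \<rho> * ra * qp))) \<le> real n"
  proof -
    interpret mdp S A H Rset prior
      by (rule mdp.intro) (fact that)+
    \<comment> \<open>The ceiling is what \<open>N_large\<close> asks for; the extra 1 makes up for
      comparing policies with the factor \<open>N - 1\<close> instead of \<open>N\<close>.\<close>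
    let ?N = "nat \<lceil>6 * real H / (qp * y)\<rceil> + 1"
    let ?K = "nat \<lceil>104 * real n * real S * real A * real H ^ 4 / (qp * \<rho> ^ 3 * ra ^ 3)\<rceil>"
    have y: "0 < y" "y \<le> 1"
      using ra \<rho> r_alt_le_1 by (auto simp: y_def ra_def mult_le_one)
    have qp1: "qp \<le> 1" unfolding qp_def by (rule q_pun_le_1)
    have "\<rho>\<^sup>2 * ra\<^sup>2 = y\<^sup>2" "\<delta> * \<rho> * ra * qp = \<delta> * y * qp" by (simp_all add: y_def power_mult_distrib mult_ac)
    with n have n': "38880 * real H ^ 4 / y\<^sup>2 * (real S + ln (real S * A * H / (\<delta> * y * qp))) \<le> real n" by simp
    have K: "?K = nat \<lceil>104 * real n * S * A * real H ^ 4 / (qp * y ^ 3)\<rceil>"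
      by (simp add: y_def power_mult_distrib mult_ac)
    \<comment> \<open>The logarithm is taken of a number that is at least 1, so the lower bound on
      \<open>n\<close> is positive.\<close>
    have n0: "0 < n"
    proof (rule ccontr)
      assume "\<not> 0 < n"
      have "1 \<le> real (S * A * H)" using pos of_nat_mono[of 1 "S * A * H"] by (simp add: Suc_le_eq)
      moreover have "\<delta> * y * qp \<le> 1" using y \<delta> qp qp1 by (intro mult_le_one) auto
      moreover have "0 < \<delta> * y * qp" using y \<delta> qp by simp
      ultimately have "1 \<le> real S * A * H / (\<delta> * y * qp)" by (simp add: le_divide_eq)
      then have "0 \<le> ln (real S * A * H / (\<delta> * y * qp))" by (rule ln_ge_zero)
      then have "0 < real S + ln (real S * A * H / (\<delta> * y * qp))" using pos by linarith
      then have "0 < 38880 * real H ^ 4 / y\<^sup>2 * (real S + ln (real S * A * H / (\<delta> * y * qp)))"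
        using y pos by (intro mult_pos_pos divide_pos_pos) auto
      with n' \<open>\<not> 0 < n\<close> show False by simp
    qed
    interpret exploration S A H Rset prior ?N n e \<rho> tb
    proof
      show "0 < q_pun S A H prior e" using qp by (simp add: qp_def)
      show "6 * real H / (q_pun S A H prior e * (r_alt S A H prior * \<rho>)) + 1 \<le> real ?N"
        unfolding qp_def y_def ra_def by linarith
      show "0 < r_alt S A H prior" using ra by (simp add: ra_def)
      show "\<forall>X. X \<noteq> {} \<longrightarrow> tb X \<in> X" by (rule tb)
      show "e = r_alt S A H prior * \<rho> / (18 * real H)" by (simp add: e_def ra_def)
    qed (use \<rho> n0 in simp_all)
    have "real (?K div ?N) * (\<beta> + \<beta> / (d * q)) + 2 ^ (S * A * H * n) * (1 - p0 / 2) ^ (?K div ?N) \<le> \<delta>"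
      using exploration_failure_small[OF pos y qp qp1 \<delta> n']
      unfolding K \<beta>_def \<eta>_def d_def p0_def x_def qp_def[symmetric] ra_def[symmetric] y_def[symmetric] by simp
    with success_ge[of ?K] have "1 - \<delta> \<le> hh_success S A H prior tb ?N n e \<rho> n ?K" by linarith
    then show ?thesis by (intro exI[of _ ?N]) simp
  qed
  then show "let ra = r_alt S A H prior;
          \<epsilon> = ra * \<rho> / (18 * real H);
          qp = q_pun S A H prior \<epsilon>
      in
      0 < S \<longrightarrow> 0 < A \<longrightarrow> 0 < H \<longrightarrow>
      countable Rset \<longrightarrow> Rset \<subseteq> {0..1} \<longrightarrow>
      prob_space prior \<longrightarrow> sets prior = sets (model_space S A H Rset) \<longrightarrow>
      (\<forall>X. X \<noteq> {} \<longrightarrow> tb X \<in> X) \<longrightarrow>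
      0 < \<rho> \<longrightarrow> \<rho> \<le> 1 \<longrightarrow> 0 < \<delta> \<longrightarrow> \<delta> \<le> 1 \<longrightarrow>
      0 < ra \<longrightarrow> 0 < qp \<longrightarrow>
      real n \<ge> 38880 * real H ^ 4 / (\<rho>\<^sup>2 * ra\<^sup>2)
                 * (real S + ln (real S * real A * real H / (\<delta> * \<rho> * ra * qp))) \<longrightarrow>
      (\<exists>Nph > 0. hh_success S A H prior tb Nph n \<epsilon> \<rho> n
           (nat \<lceil>104 * real n * real S * real A * real H ^ 4 / (qp * \<rho> ^ 3 * ra ^ 3)\<rceil>)
         \<ge> 1 - \<delta>)"
    unfolding Let_def ra_def[symmetric] e_def[symmetric] qp_def[symmetric] by blast
qed simp_all

end
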